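(* Let $1\le k\le d$ be natural numbers, let $\mathcal{I}=\{I_1,\ldots,I_k\}$ be a partition of $\{1,\ldots,d\}$, let $(j_n^r)_{n=1}^\infty$, $r=1,\ldots,d$, be sequences of natural numbers satisfying the injectivity condition, and let $B_{\mathcal{I}}$ be the associated block. Let $X_1,\ldots,X_d,Y_1,\ldots,Y_k$ be linearly stable sequence classes such that the $(d+k)$-tuple $(X_1,\ldots,X_d,Y_1,\ldots,Y_k)$ is $B_{\mathcal{I}}$-compatible. Then $\left(\mathcal{L}^{B_{\mathcal{I}}}_{X_1,\ldots,X_d;Y_1,\ldots,Y_k},\|\cdot\|_{B_{\mathcal{I}};X_1,\ldots,X_d;Y_1,\ldots,Y_k}\right)$ is a Banach ideal of $d$-linear operators.
   Context: All Banach spaces are over $\mathbb{K}=\mathbb{R}$ or $\mathbb{C}$; $\mathcal{L}(E_1,\ldots,E_d;F)$ is the Banach space of continuous $d$-linear operators $E_1\times\cdots\times E_d\to F$ with the usual operator norm. Blocks. A partition $\mathcal{I}=\{I_1,\ldots,I_k\}$ of $\{1,\ldots,d\}$ is an ordered collection of pairwise disjoint subsets with union $\{1,\ldots,d\}$. For $r\in\{1,\ldots,d\}$ let $s(r)$ be the unique $s$ with $r\in I_s$. Sequences $(j_n^r)_{n=1}^\infty$, $r=1,\ldots,d$, of natural numbers satisfy the injectivity condition if the map $\mathbb{N}^k\to\mathbb{N}^d$, $(n_1,\ldots,n_k)\mapsto (j^1_{n_{s(1)}},\ldots,j^d_{n_{s(d)}})$, is injective; its image $B_{\mathcal{I}}\subseteq\mathbb{N}^d$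 is the block associated to the partition and to the sequences (everything depending on $B_{\mathcal I}$ is understood with the partition and the sequences fixed). For vectors $x_j^r$, the notation $\sum_{s=1}^k\sum_{r\in I_s}x^r_{j^r_{n_s}}*e_r$ denotes the $d$-tuple $(x^1_{j^1_{n_{s(1)}}},\ldots,x^d_{j^d_{n_{s(d)}}})$. Sequence classes. A sequence class is a rule $X$ assigning to each Banach space $E$ a Banach space $X(E)$ of $E$-valued sequences (with coordinatewise operations) such that $c_{00}(E)\subset X(E)\subset\ell_\infty(E)$ with $\|x\|_{\ell_\infty(E)}\le\|x\|_{X(E)}$ for $x\in X(E)$, and $\|e_j\|_{X(\mathbb{K})}=1$ for every $j$, where $c_{00}(E)$ and $\ell_\infty(E)$ are the spaces of eventually null and of bounded sequences and $e_j$ are the canonical scalar unit sequences. $X$ is linearly stable if for all Banach spaces $E,F$, $u\in\mathcal{L}(E;F)$ and $(x_j)_j\in X(E)$ one has $(u(x_j))_j\in X(F)$ and $\|(u(x_j))_j\|_{X(F)}\le\|u\|\,\|(x_j)_j\|_{X(E)}$. $Y_1(\cdots Y_k(F)\cdots)$ is the Banach space obtained by successively applying $Y_k,\ldots,Y_1$. Summing operators. $A\in\mathcal{L}(E_1,\ldots,E_d;F)$ is $(B_{\mathcal{I}};X_1,\ldots,X_d;Y_1,\ldots,Y_k)$-summing if $$\left(\cdots\left(A\left(\sum_{s=1}^k\sum_{r\in I_s}x^r_{j^r_{n_s}}*e_r\right)\right)_{n_k=1}^\infty\cdots\right)_{n_1=1}^\infty\in Y_1(\cdots Y_k(F)\cdots)$$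 whenever $(x_j^r)_j\in X_r(E_r)$, $r=1,\ldots,d$. The set of these operators is $\mathcal{L}^{B_{\mathcal{I}}}_{X_1,\ldots,X_d;Y_1,\ldots,Y_k}(E_1,\ldots,E_d;F)$. The induced map $\widehat{A}_{B_{\mathcal{I}}}:X_1(E_1)\times\cdots\times X_d(E_d)\to Y_1(\cdots Y_k(F)\cdots)$ sends $((x_j^1)_j,\ldots,(x_j^d)_j)$ to the iterated sequence above; it is a continuous $d$-linear operator, and $\|A\|_{B_{\mathcal{I}};X_1,\ldots,X_d;Y_1,\ldots,Y_k}:=\|\widehat{A}_{B_{\mathcal{I}}}\|$ (operator norm). Compatibility. $(X_1,\ldots,X_d,Y_1,\ldots,Y_k)$ is $B_{\mathcal{I}}$-compatible if for all $(\lambda_j^r)_j\in X_r(\mathbb{K})$, $r=1,\ldots,d$, the iterated sequence $\left(\cdots\left(\prod_{s=1}^k\prod_{r\in I_s}\lambda^r_{j^r_{n_s}}\right)_{n_k=1}^\infty\cdots\right)_{n_1=1}^\infty$ belongs to $Y_1(\cdots Y_k(\mathbb{K})\cdots)$ and has norm at most $\prod_{r=1}^d\|(\lambda_j^r)_j\|_{X_r(\mathbb{K})}$. Banach ideal of $d$-linear operators. A class $\mathcal{M}$ of continuous $d$-linear operators between Banach spaces with a function $\|\cdot\|_{\mathcal{M}}:\mathcal{M}\to\mathbb{R}$ is a Banach ideal if, for all Banach spaces $E_1,\ldots,E_d,F$, with $\mathcal{M}(E_1,\ldots,E_d;F)=\mathcal{M}\cap\mathcal{L}(E_1,\ldots,E_d;F)$: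 (i) $\mathcal{M}(E_1,\ldots,E_d;F)$ is a linear subspace of $\mathcal{L}(E_1,\ldots,E_d;F)$ containing all operators $(x^1,\ldots,x^d)\mapsto\varphi_1(x^1)\cdots\varphi_d(x^d)\,b$ with $\varphi_m\in E_m^*$, $b\in F$, and the operator $I^d:\mathbb{K}^d\to\mathbb{K}$, $I^d(\lambda^1,\ldots,\lambda^d)=\lambda^1\cdots\lambda^d$, satisfies $\|I^d\|_{\mathcal{M}}=1$; (ii) $(\mathcal{M}(E_1,\ldots,E_d;F),\|\cdot\|_{\mathcal{M}})$ is a Banach space; (iii) if $A\in\mathcal{M}(E_1,\ldots,E_d;F)$, $u_r\in\mathcal{L}(G_r;E_r)$, $r=1,\ldots,d$, and $t\in\mathcal{L}(F;H)$, then $t\circ A\circ(u_1,\ldots,u_d)\in\mathcal{M}(G_1,\ldots,G_d;H)$ and $\|t\circ A\circ(u_1,\ldots,u_d)\|_{\mathcal{M}}\le\|t\|\,\|A\|_{\mathcal{M}}\,\|u_1\|\cdots\|u_d\|$. *)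

theory Defs
  imports "HOL-Analysis.Analysis" "HOL-Algebra.Module"
begin

text \<open>
  The notions below quantify over all Banach spaces, and a sequence class sends Banach spaces to
  Banach spaces. HOL cannot quantify over types inside a formula, so a Banach space is a structure
  whose carrier is a subset of one universe type, closed under forming scalars and sequences.
  The type \<open>'a\<close> of atoms is arbitrary; through \<open>Atom\<close> every Banach space on it occurs, as do the
  scalar field and every iterated space of sequences.
\<close>

datatype 'a univ = Atom 'a | Scal (scal: complex) | Seq (coord: "nat \<Rightarrow> 'a univ")


subsection \<open>Banach spaces\<close>

record ('a, 'b) normed_module = "('a, 'b) module" +
  vnorm :: "'b \<Rightarrow> real"

text \<open>
  The scalar field is \<open>K = \<real>\<close> or \<open>K = UNIV\<close> as a set of complex numbers. The fields \<open>mult\<close> and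
  \<open>one\<close> inherited from the record of modules play no role in a Banach space.
\<close>

definition scalar_ring :: "complex set \<Rightarrow> complex ring" where
  "scalar_ring K = \<lparr>carrier = K, mult = (*), one = 1, zero = 0, add = (+)\<rparr>"

text \<open>The metric is set to 0 off the carrier because \<^locale>\<open>Metric_space\<close> constrains all arguments.\<close>

definition norm_dist :: "('a, 'b) normed_module \<Rightarrow> 'b \<Rightarrow> 'b \<Rightarrow> real" where
  "norm_dist E x y =
     (if x \<in> carrier E \<and> y \<in> carrier E then vnorm E (x \<ominus>\<^bsub>E\<^esub> y) else 0)"

abbreviation norm_topology :: "('a, 'b) normed_module \<Rightarrow> 'b topology" where
  "norm_topology E \<equiv> Metric_space.mtopology (carrier E) (norm_dist E)"

locale banach_space = Module.module "scalar_ring K" E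
  for K :: "complex set" and E :: "(complex, 'b) normed_module" (structure) +
  assumes vnorm_nonneg: "x \<in> carrier E \<Longrightarrow> 0 \<le> vnorm E x"
    and vnorm_eq_0_iff: "x \<in> carrier E \<Longrightarrow> vnorm E x = 0 \<longleftrightarrow> x = \<zero>"
    and vnorm_smult: "a \<in> K \<Longrightarrow> x \<in> carrier E \<Longrightarrow> vnorm E (a \<odot> x) = cmod a * vnorm E x"
    and vnorm_triangle:
      "x \<in> carrier E \<Longrightarrow> y \<in> carrier E \<Longrightarrow> vnorm E (x \<oplus> y) \<le> vnorm E x + vnorm E y"
    and complete: "Metric_space.mcomplete (carrier E) (norm_dist E)"

type_synonym 'a bspace = "(complex, 'a univ) normed_module"

definition scalar_space :: "complex set \<Rightarrow> 'a bspace" where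
  "scalar_space K =
     \<lparr>carrier = Scal ` K,
      mult = (\<lambda>x y. Scal (scal x * scal y)), one = Scal 1,
      zero = Scal 0, add = (\<lambda>x y. Scal (scal x + scal y)),
      smult = (\<lambda>a x. Scal (a * scal x)),
      vnorm = (\<lambda>x. cmod (scal x))\<rparr>"


subsection \<open>Continuous linear and multilinear operators\<close>

text \<open>
  Operators are extensional (undefined off their domain), so that they form a genuine
  vector space with pointwise operations.
\<close>

definition lin_ops :: "complex set \<Rightarrow> 'a bspace \<Rightarrow> 'a bspace \<Rightarrow> ('a univ \<Rightarrow> 'a univ) set" where
  "lin_ops K E F =
     {u \<in> carrier E \<rightarrow>\<^sub>E carrier F.
        (\<forall>x\<in>carrier E. \<forall>y\<in>carrier E. u (x \<oplus>\<^bsub>E\<^esub> y) = u x \<oplus>\<^bsub>F\<^esub> u y) \<and>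
        (\<forall>a\<in>K. \<forall>x\<in>carrier E. u (a \<odot>\<^bsub>E\<^esub> x) = a \<odot>\<^bsub>F\<^esub> u x) \<and>
        continuous_map (norm_topology E) (norm_topology F) u}"

definition lin_norm :: "'a bspace \<Rightarrow> 'a bspace \<Rightarrow> ('a univ \<Rightarrow> 'a univ) \<Rightarrow> real" where
  "lin_norm E F u = (SUP x\<in>{x \<in> carrier E. vnorm E x \<le> 1}. vnorm F (u x))"

definition tuples :: "nat \<Rightarrow> (nat \<Rightarrow> 'a bspace) \<Rightarrow> (nat \<Rightarrow> 'a univ) set" where
  "tuples d E = (\<Pi>\<^sub>E r\<in>{1..d}. carrier (E r))"

definition multilin_ops ::
  "complex set \<Rightarrow> nat \<Rightarrow> (nat \<Rightarrow> 'a bspace) \<Rightarrow> 'a bspace \<Rightarrow> ((nat \<Rightarrow> 'a univ) \<Rightarrow> 'a univ) set" where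
  "multilin_ops K d E F =
     {A \<in> tuples d E \<rightarrow>\<^sub>E carrier F.
        (\<forall>r\<in>{1..d}. \<forall>x\<in>tuples d E.
           (\<forall>y\<in>carrier (E r). \<forall>z\<in>carrier (E r).
              A (x(r := y \<oplus>\<^bsub>E r\<^esub> z)) = A (x(r := y)) \<oplus>\<^bsub>F\<^esub> A (x(r := z))) \<and>
           (\<forall>a\<in>K. \<forall>y\<in>carrier (E r).
              A (x(r := a \<odot>\<^bsub>E r\<^esub> y)) = a \<odot>\<^bsub>F\<^esub> A (x(r := y)))) \<and>
        continuous_map (product_topology (\<lambda>r. norm_topology (E r)) {1..d}) (norm_topology F) A}"

definition multilin_norm ::
  "nat \<Rightarrow> (nat \<Rightarrow> 'a bspace) \<Rightarrow> 'a bspace \<Rightarrow> ((nat \<Rightarrow> 'a univ) \<Rightarrow> 'a univ) \<Rightarrow> real" where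
  "multilin_norm d E F A =
     (SUP x\<in>{x \<in> tuples d E. \<forall>r\<in>{1..d}. vnorm (E r) (x r) \<le> 1}. vnorm F (A x))"

definition multilin_space ::
  "complex set \<Rightarrow> nat \<Rightarrow> (nat \<Rightarrow> 'a bspace) \<Rightarrow> 'a bspace
     \<Rightarrow> (complex, (nat \<Rightarrow> 'a univ) \<Rightarrow> 'a univ) normed_module" where
  "multilin_space K d E F =
     \<lparr>carrier = multilin_ops K d E F,
      mult = undefined, one = undefined,
      zero = (\<lambda>x\<in>tuples d E. \<zero>\<^bsub>F\<^esub>),
      add = (\<lambda>A B. \<lambda>x\<in>tuples d E. A x \<oplus>\<^bsub>F\<^esub> B x),
      smult = (\<lambda>a A. \<lambda>x\<in>tuples d E. a \<odot>\<^bsub>F\<^esub> A x),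
      vnorm = multilin_norm d E F\<rparr>"


subsection \<open>Sequence classes\<close>

text \<open>Sequences are indexed from 0 instead of 1.\<close>

definition seqs :: "'a bspace \<Rightarrow> (nat \<Rightarrow> 'a univ) set" where
  "seqs E = {x. \<forall>n. x n \<in> carrier E}"

definition c00 :: "'a bspace \<Rightarrow> (nat \<Rightarrow> 'a univ) set" where
  "c00 E = {x \<in> seqs E. \<forall>\<^sub>F n in sequentially. x n = \<zero>\<^bsub>E\<^esub>}"

definition linfty :: "'a bspace \<Rightarrow> (nat \<Rightarrow> 'a univ) set" where
  "linfty E = {x \<in> seqs E. bdd_above (range (\<lambda>n. vnorm E (x n)))}"

definition linfty_norm :: "'a bspace \<Rightarrow> (nat \<Rightarrow> 'a univ) \<Rightarrow> real" where
  "linfty_norm E x = (SUP n. vnorm E (x n))"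

definition sequence_class :: "complex set \<Rightarrow> ('a bspace \<Rightarrow> 'a bspace) \<Rightarrow> bool" where
  "sequence_class K X \<longleftrightarrow>
     (\<forall>E. banach_space K E \<longrightarrow>
        banach_space K (X E) \<and>
        Seq ` c00 E \<subseteq> carrier (X E) \<and> carrier (X E) \<subseteq> Seq ` linfty E \<and>
        \<zero>\<^bsub>X E\<^esub> = Seq (\<lambda>n. \<zero>\<^bsub>E\<^esub>) \<and>
        (\<forall>x y. Seq x \<in> carrier (X E) \<longrightarrow> Seq y \<in> carrier (X E) \<longrightarrow>
           Seq x \<oplus>\<^bsub>X E\<^esub> Seq y = Seq (\<lambda>n. x n \<oplus>\<^bsub>E\<^esub> y n)) \<and>
        (\<forall>a\<in>K. \<forall>x. Seq x \<in> carrier (X E) \<longrightarrow> a \<odot>\<^bsub>X E\<^esub> Seq x = Seq (\<lambda>n. a \<odot>\<^bsub>E\<^esub> x n)) \<and>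
        (\<forall>x. Seq x \<in> carrier (X E) \<longrightarrow> linfty_norm E x \<le> vnorm (X E) (Seq x))) \<and>
     (\<forall>i. vnorm (X (scalar_space K)) (Seq (\<lambda>n. Scal (if n = i then 1 else 0))) = 1)"

definition linearly_stable :: "complex set \<Rightarrow> ('a bspace \<Rightarrow> 'a bspace) \<Rightarrow> bool" where
  "linearly_stable K X \<longleftrightarrow>
     (\<forall>E F. banach_space K E \<longrightarrow> banach_space K F \<longrightarrow>
        (\<forall>u\<in>lin_ops K E F. \<forall>x. Seq x \<in> carrier (X E) \<longrightarrow>
           Seq (\<lambda>n. u (x n)) \<in> carrier (X F) \<and>
           vnorm (X F) (Seq (\<lambda>n. u (x n))) \<le> lin_norm E F u * vnorm (X E) (Seq x)))"

text \<open>\<open>Y\<^sub>1(\<cdots>Y\<^sub>k(F)\<cdots>)\<close>, and the iterated sequence of a family indexed by tuples \<open>(n\<^sub>1, \<dots>, n\<^sub>k)\<close>, in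
  which the index \<open>n\<^sub>1\<close> is outermost.\<close>

definition iterated_space :: "nat \<Rightarrow> (nat \<Rightarrow> 'a bspace \<Rightarrow> 'a bspace) \<Rightarrow> 'a bspace \<Rightarrow> 'a bspace" where
  "iterated_space k Y F = foldr Y [1..<Suc k] F"

primrec nested_seq :: "nat list \<Rightarrow> ((nat \<Rightarrow> nat) \<Rightarrow> 'a univ) \<Rightarrow> (nat \<Rightarrow> nat) \<Rightarrow> 'a univ" where
  "nested_seq [] g m = g m"
| "nested_seq (s # ss) g m = Seq (\<lambda>n. nested_seq ss g (m(s := n)))"

definition iterated_seq :: "nat \<Rightarrow> ((nat \<Rightarrow> nat) \<Rightarrow> 'a univ) \<Rightarrow> 'a univ" where
  "iterated_seq k g = nested_seq [1..<Suc k] g (\<lambda>s\<in>{1..k}. 0)"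


subsection \<open>Blocks\<close>

definition block_partition :: "nat \<Rightarrow> nat \<Rightarrow> (nat \<Rightarrow> nat set) \<Rightarrow> bool" where
  "block_partition d k I \<longleftrightarrow> disjoint_family_on I {1..k} \<and> (\<Union>s\<in>{1..k}. I s) = {1..d}"

definition part_of :: "nat \<Rightarrow> (nat \<Rightarrow> nat set) \<Rightarrow> nat \<Rightarrow> nat" where
  "part_of k I r = (THE s. s \<in> {1..k} \<and> r \<in> I s)"

text \<open>The block \<open>B\<close> is the image of \<open>block_map\<close> on \<open>\<nat>\<^sup>k\<close>. All notions depending on it take the
  partition \<open>I\<close> and the sequences \<open>j\<close> as parameters.\<close>

definition block_map ::
  "nat \<Rightarrow> nat \<Rightarrow> (nat \<Rightarrow> nat set) \<Rightarrow> (nat \<Rightarrow> nat \<Rightarrow> nat) \<Rightarrow> (nat \<Rightarrow> nat) \<Rightarrow> nat \<Rightarrow> nat" where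
  "block_map d k I j n = (\<lambda>r\<in>{1..d}. j r (n (part_of k I r)))"

definition injectivity_condition ::
  "nat \<Rightarrow> nat \<Rightarrow> (nat \<Rightarrow> nat set) \<Rightarrow> (nat \<Rightarrow> nat \<Rightarrow> nat) \<Rightarrow> bool" where
  "injectivity_condition d k I j \<longleftrightarrow> inj_on (block_map d k I j) ({1..k} \<rightarrow>\<^sub>E UNIV)"


subsection \<open>Summing operators\<close>

definition induced_map ::
  "nat \<Rightarrow> nat \<Rightarrow> (nat \<Rightarrow> nat set) \<Rightarrow> (nat \<Rightarrow> nat \<Rightarrow> nat) \<Rightarrow> (nat \<Rightarrow> 'a bspace \<Rightarrow> 'a bspace)
     \<Rightarrow> (nat \<Rightarrow> 'a bspace) \<Rightarrow> ((nat \<Rightarrow> 'a univ) \<Rightarrow> 'a univ) \<Rightarrow> (nat \<Rightarrow> 'a univ) \<Rightarrow> 'a univ" where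
  "induced_map d k I j X E A =
     (\<lambda>x\<in>tuples d (\<lambda>r. X r (E r)).
        iterated_seq k (\<lambda>n. A (\<lambda>r\<in>{1..d}. coord (x r) (block_map d k I j n r))))"

definition summing_ops ::
  "complex set \<Rightarrow> nat \<Rightarrow> nat \<Rightarrow> (nat \<Rightarrow> nat set) \<Rightarrow> (nat \<Rightarrow> nat \<Rightarrow> nat)
     \<Rightarrow> (nat \<Rightarrow> 'a bspace \<Rightarrow> 'a bspace) \<Rightarrow> (nat \<Rightarrow> 'a bspace \<Rightarrow> 'a bspace)
     \<Rightarrow> (nat \<Rightarrow> 'a bspace) \<Rightarrow> 'a bspace \<Rightarrow> ((nat \<Rightarrow> 'a univ) \<Rightarrow> 'a univ) set" where
  "summing_ops K d k I j X Y E F =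
     {A \<in> multilin_ops K d E F.
        \<forall>x\<in>tuples d (\<lambda>r. X r (E r)). induced_map d k I j X E A x \<in> carrier (iterated_space k Y F)}"

definition summing_norm ::
  "nat \<Rightarrow> nat \<Rightarrow> (nat \<Rightarrow> nat set) \<Rightarrow> (nat \<Rightarrow> nat \<Rightarrow> nat)
     \<Rightarrow> (nat \<Rightarrow> 'a bspace \<Rightarrow> 'a bspace) \<Rightarrow> (nat \<Rightarrow> 'a bspace \<Rightarrow> 'a bspace)
     \<Rightarrow> (nat \<Rightarrow> 'a bspace) \<Rightarrow> 'a bspace \<Rightarrow> ((nat \<Rightarrow> 'a univ) \<Rightarrow> 'a univ) \<Rightarrow> real" where
  "summing_norm d k I j X Y E F A =
     multilin_norm d (\<lambda>r. X r (E r)) (iterated_space k Y F) (induced_map d k I j X E A)"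

definition block_compatible ::
  "complex set \<Rightarrow> nat \<Rightarrow> nat \<Rightarrow> (nat \<Rightarrow> nat set) \<Rightarrow> (nat \<Rightarrow> nat \<Rightarrow> nat)
     \<Rightarrow> (nat \<Rightarrow> 'a bspace \<Rightarrow> 'a bspace) \<Rightarrow> (nat \<Rightarrow> 'a bspace \<Rightarrow> 'a bspace) \<Rightarrow> bool" where
  "block_compatible K d k I j X Y \<longleftrightarrow>
     (\<forall>l :: nat \<Rightarrow> nat \<Rightarrow> complex.
        (\<forall>r\<in>{1..d}. Seq (\<lambda>i. Scal (l r i)) \<in> carrier (X r (scalar_space K))) \<longrightarrow>
        (let z = iterated_seq k (\<lambda>n. Scal (\<Prod>s = 1..k. \<Prod>r\<in>I s. l r (j r (n s))))
         in z \<in> carrier (iterated_space k Y (scalar_space K)) \<and>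
            vnorm (iterated_space k Y (scalar_space K)) z
              \<le> (\<Prod>r = 1..d. vnorm (X r (scalar_space K)) (Seq (\<lambda>i. Scal (l r i))))))"


subsection \<open>Banach ideals\<close>

definition rank_one_op ::
  "nat \<Rightarrow> (nat \<Rightarrow> 'a bspace) \<Rightarrow> 'a bspace \<Rightarrow> (nat \<Rightarrow> 'a univ \<Rightarrow> 'a univ) \<Rightarrow> 'a univ
     \<Rightarrow> (nat \<Rightarrow> 'a univ) \<Rightarrow> 'a univ" where
  "rank_one_op d E F \<phi> b = (\<lambda>x\<in>tuples d E. (\<Prod>r = 1..d. scal (\<phi> r (x r))) \<odot>\<^bsub>F\<^esub> b)"

definition scalar_product_op :: "complex set \<Rightarrow> nat \<Rightarrow> (nat \<Rightarrow> 'a univ) \<Rightarrow> 'a univ" where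
  "scalar_product_op K d = (\<lambda>x\<in>tuples d (\<lambda>r. scalar_space K). Scal (\<Prod>r = 1..d. scal (x r)))"

definition compose_op ::
  "nat \<Rightarrow> (nat \<Rightarrow> 'a bspace) \<Rightarrow> ('a univ \<Rightarrow> 'a univ) \<Rightarrow> ((nat \<Rightarrow> 'a univ) \<Rightarrow> 'a univ)
     \<Rightarrow> (nat \<Rightarrow> 'a univ \<Rightarrow> 'a univ) \<Rightarrow> (nat \<Rightarrow> 'a univ) \<Rightarrow> 'a univ" where
  "compose_op d G t A u = (\<lambda>x\<in>tuples d G. t (A (\<lambda>r\<in>{1..d}. u r (x r))))"

text \<open>
  A class of operators together with its norm is given by its components \<open>M E F\<close> and the norms
  \<open>N E F\<close> on them.
\<close>

definition banach_ideal ::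
  "complex set \<Rightarrow> nat
     \<Rightarrow> ((nat \<Rightarrow> 'a bspace) \<Rightarrow> 'a bspace \<Rightarrow> ((nat \<Rightarrow> 'a univ) \<Rightarrow> 'a univ) set)
     \<Rightarrow> ((nat \<Rightarrow> 'a bspace) \<Rightarrow> 'a bspace \<Rightarrow> ((nat \<Rightarrow> 'a univ) \<Rightarrow> 'a univ) \<Rightarrow> real) \<Rightarrow> bool" where
  "banach_ideal K d M N \<longleftrightarrow>
     (\<forall>E F. (\<forall>r\<in>{1..d}. banach_space K (E r)) \<longrightarrow> banach_space K F \<longrightarrow>
        submodule (M E F) (scalar_ring K) (multilin_space K d E F) \<and>
        (\<forall>\<phi> b. (\<forall>r\<in>{1..d}. \<phi> r \<in> lin_ops K (E r) (scalar_space K)) \<longrightarrow> b \<in> carrier F \<longrightarrow>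
           rank_one_op d E F \<phi> b \<in> M E F) \<and>
        banach_space K (multilin_space K d E F\<lparr>carrier := M E F, vnorm := N E F\<rparr>)) \<and>
     N (\<lambda>r. scalar_space K) (scalar_space K) (scalar_product_op K d) = 1 \<and>
     (\<forall>E F G H.
        (\<forall>r\<in>{1..d}. banach_space K (E r) \<and> banach_space K (G r)) \<longrightarrow>
        banach_space K F \<longrightarrow> banach_space K H \<longrightarrow>
        (\<forall>A\<in>M E F. \<forall>u. \<forall>t\<in>lin_ops K F H.
           (\<forall>r\<in>{1..d}. u r \<in> lin_ops K (G r) (E r)) \<longrightarrow>
           compose_op d G t A u \<in> M G H \<and>
           N G H (compose_op d G t A u)
             \<le> lin_norm F H t * N E F A * (\<Prod>r = 1..d. lin_norm (G r) (E r) (u r))))"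

end

theory Submission
  imports Defs
begin

text \<open>
  The entries of an iterated sequence are bounded functionals that determine it, so everything about
  the induced map is checked entry by entry. Each entry of the induced map is continuous, hence its
  graph is closed in every variable, and a multilinear map with this property is bounded: this is the
  Banach--Steinhaus argument with closed graphs in place of continuity. Evaluating on multiples of unit
  sequences gives \<open>\<parallel>A\<parallel> \<le> \<parallel>A\<parallel>\<^sub>B\<close>; so a Cauchy sequence of summing operators converges pointwise,
  and the induced maps converge to the induced map of the limit. The ideal inequality holds because a
  bounded operator acts on every iterated sequence space with the same norm bound. Compatibility says
  exactly that the scalar product \<open>I\<^sup>d\<close> is summing with norm at most 1, and a rank one operator is
  \<open>I\<^sup>d\<close> composed with functionals on one side and \<open>a \<mapsto> a b\<close> on the other.
\<close>

section \<open>Normed modules\<close>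

text \<open>Being summing only means that the induced map takes values in the iterated space, while
  the norm is a real supremum, which carries information only over a bounded set. So boundedness of
  the induced map has to come before any estimate of the summing norm. The norm of the iterated
  space is merely known to dominate the norms of the entries; hence continuity of the entries does
  not pass to the map, whereas closedness of its graph does. With one variable the closed graph
  theorem would suffice. With several, the variables are released one after another, each time for a
  whole family of linear maps indexed by the variables already released, so uniform boundedness is
  needed too, for maps not yet known to be continuous. Entries also tie together the two limits in
  the completeness proof: the values converge in \<open>F\<close>, the induced maps in the iterated
  space, and only a comparison of entries relates them.\<close>

lemma scalar_ring_simps [simp]:
  "carrier (scalar_ring K) = K" "mult (scalar_ring K) = (*)" "one (scalar_ring K) = 1"
  "zero (scalar_ring K) = 0" "add (scalar_ring K) = (+)"
  by (simp_all add: scalar_ring_def)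

lemma cring_scalar_ring:
  assumes "K = \<real> \<or> K = UNIV"
  shows "cring (scalar_ring K)"
proof (rule cringI)
  show "abelian_group (scalar_ring K)"
  proof (rule abelian_groupI)
    fix x assume "x \<in> carrier (scalar_ring K)"
    then show "\<exists>y\<in>carrier (scalar_ring K). y \<oplus>\<^bsub>scalar_ring K\<^esub> x = \<zero>\<^bsub>scalar_ring K\<^esub>"
      using assms by (intro bexI[of _ "- x"]) auto
  qed (use assms in auto)
  show "comm_monoid (scalar_ring K)"
    by (rule comm_monoidI) (use assms in auto)
qed (auto simp: algebra_simps)

text \<open>Completeness is left out so that spaces of operators can be treated as normed spaces
  first and shown complete afterwards. The restriction on \<open>K\<close> is included because
  rescaling needs the real scalars.\<close>

locale normed_mod = Module.module "scalar_ring K" E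
  for K :: "complex set" and E :: "(complex, 'b) normed_module" (structure) +
  assumes field_K: "K = \<real> \<or> K = UNIV"
    and vnorm_nonneg [simp]: "x \<in> carrier E \<Longrightarrow> 0 \<le> vnorm E x"
    and vnorm_eq_0_iff: "x \<in> carrier E \<Longrightarrow> vnorm E x = 0 \<longleftrightarrow> x = \<zero>"
    and vnorm_smult: "a \<in> K \<Longrightarrow> x \<in> carrier E \<Longrightarrow> vnorm E (a \<odot> x) = cmod a * vnorm E x"
    and vnorm_triangle:
      "x \<in> carrier E \<Longrightarrow> y \<in> carrier E \<Longrightarrow> vnorm E (x \<oplus> y) \<le> vnorm E x + vnorm E y"

lemma banach_space_normed_mod:
  assumes "K = \<real> \<or> K = UNIV" "banach_space K E"
  shows "normed_mod K E"
proof -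
  interpret banach_space K E by fact
  show ?thesis
    by unfold_locales (use assms(1) vnorm_nonneg vnorm_eq_0_iff vnorm_smult vnorm_triangle in auto)
qed

text \<open>Phrased with \<open>vnorm\<close> rather than \<open>norm_dist\<close>, whose case split
  on the carrier would otherwise return in every estimate; \<open>limitin_iff_vconv\<close> links it
  to the topology.\<close>

definition vconv :: "(complex, 'b) normed_module \<Rightarrow> (nat \<Rightarrow> 'b) \<Rightarrow> 'b \<Rightarrow> bool" where
  "vconv E x l \<longleftrightarrow> range x \<subseteq> carrier E \<and> l \<in> carrier E \<and> (\<lambda>n. vnorm E (x n \<ominus>\<^bsub>E\<^esub> l)) \<longlonglongrightarrow> 0"

definition vcauchy :: "(complex, 'b) normed_module \<Rightarrow> (nat \<Rightarrow> 'b) \<Rightarrow> bool" where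
  "vcauchy E x \<longleftrightarrow> range x \<subseteq> carrier E \<and>
     (\<forall>e>0. \<exists>N. \<forall>m n. N \<le> m \<longrightarrow> N \<le> n \<longrightarrow> vnorm E (x m \<ominus>\<^bsub>E\<^esub> x n) < e)"

context normed_mod
begin

lemma K_real [simp, intro]: "complex_of_real a \<in> K"
  and K_0 [simp, intro]: "0 \<in> K"
  and K_1 [simp, intro]: "1 \<in> K"
  and K_add [simp, intro]: "b \<in> K \<Longrightarrow> c \<in> K \<Longrightarrow> b + c \<in> K"
  and K_mult [simp, intro]: "b \<in> K \<Longrightarrow> c \<in> K \<Longrightarrow> b * c \<in> K"
  and K_minus [simp, intro]: "b \<in> K \<Longrightarrow> - b \<in> K"
  using field_K by auto

lemma K_prod: "(\<And>i. i \<in> S \<Longrightarrow> f i \<in> K) \<Longrightarrow> prod f S \<in> K"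
  by (induction S rule: infinite_finite_induct) auto

lemma add_smult: "a \<in> K \<Longrightarrow> b \<in> K \<Longrightarrow> x \<in> carrier E \<Longrightarrow> (a + b) \<odot> x = a \<odot> x \<oplus> b \<odot> x"
  using smult_l_distr[of a b x] by simp

lemma smult_add: "a \<in> K \<Longrightarrow> x \<in> carrier E \<Longrightarrow> y \<in> carrier E \<Longrightarrow> a \<odot> (x \<oplus> y) = a \<odot> x \<oplus> a \<odot> y"
  using smult_r_distr[of a x y] by simp

lemma mult_smult: "a \<in> K \<Longrightarrow> b \<in> K \<Longrightarrow> x \<in> carrier E \<Longrightarrow> (a * b) \<odot> x = a \<odot> (b \<odot> x)"
  using smult_assoc1[of a b x] by simp

lemma one_smult [simp]: "x \<in> carrier E \<Longrightarrow> 1 \<odot> x = x"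
  using smult_one[of x] by simp

lemma zero_smult [simp]: "x \<in> carrier E \<Longrightarrow> 0 \<odot> x = \<zero>"
  using smult_l_null[of x] by simp

lemma smult_zero [simp]: "a \<in> K \<Longrightarrow> a \<odot> \<zero> = \<zero>"
  using smult_r_null[of a] by simp

lemma smult_in [simp, intro]: "a \<in> K \<Longrightarrow> x \<in> carrier E \<Longrightarrow> a \<odot> x \<in> carrier E"
  using smult_closed[of a x] by simp

lemma minus_one_smult: "x \<in> carrier E \<Longrightarrow> (- 1) \<odot> x = \<ominus> x"
  using add_smult[of "-1" 1 x] by (intro M.minus_equality[symmetric]) auto

text \<open>With this, maps that respect sums and scalar multiples respect differences, without a
  separate treatment of additive inverses.\<close>

lemma minus_eq_add_smult: "y \<in> carrier E \<Longrightarrow> x \<ominus> y = x \<oplus> (- 1) \<odot> y"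
  by (simp add: minus_one_smult a_minus_def)

lemma vnorm_zero [simp]: "vnorm E \<zero> = 0"
  using vnorm_eq_0_iff by simp

lemma vnorm_uminus: "x \<in> carrier E \<Longrightarrow> vnorm E (\<ominus> x) = vnorm E x"
  using vnorm_smult[of "-1" x] by (simp add: minus_one_smult)

lemma minus_self [simp]: "x \<in> carrier E \<Longrightarrow> x \<ominus> x = \<zero>"
  by (simp add: a_minus_def M.r_neg)

lemma minus_zero [simp]: "x \<in> carrier E \<Longrightarrow> x \<ominus> \<zero> = x"
  by (simp add: a_minus_def)

lemma add_neg_cancel:
  assumes "x \<in> carrier E" "y \<in> carrier E"
  shows "x \<oplus> (y \<oplus> \<ominus> x) = y" "x \<oplus> (\<ominus> y \<oplus> \<ominus> x) = \<ominus> y"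
  using assms by (simp_all add: M.a_lcomm[of x] M.r_neg)

lemma add_minus_cancel [simp]:
  "x \<in> carrier E \<Longrightarrow> y \<in> carrier E \<Longrightarrow> (x \<oplus> y) \<ominus> y = x"
  "x \<in> carrier E \<Longrightarrow> y \<in> carrier E \<Longrightarrow> (x \<ominus> y) \<oplus> y = x"
  "x \<in> carrier E \<Longrightarrow> y \<in> carrier E \<Longrightarrow> (x \<oplus> y) \<ominus> x = y"
  "x \<in> carrier E \<Longrightarrow> y \<in> carrier E \<Longrightarrow> x \<oplus> (y \<ominus> x) = y"
  "x \<in> carrier E \<Longrightarrow> y \<in> carrier E \<Longrightarrow> x \<ominus> (x \<ominus> y) = y"
  by (simp_all add: a_minus_def M.a_ac M.r_neg M.l_neg M.minus_add M.r_neg1 M.r_neg2 add_neg_cancel)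

lemma minus_eq_0_iff: "x \<in> carrier E \<Longrightarrow> y \<in> carrier E \<Longrightarrow> x \<ominus> y = \<zero> \<longleftrightarrow> x = y"
  using add_minus_cancel(2)[of x y] by (auto simp del: add_minus_cancel)

lemma minus_add_minus:
  assumes "x \<in> carrier E" "y \<in> carrier E" "z \<in> carrier E"
  shows "(x \<ominus> y) \<oplus> (y \<ominus> z) = x \<ominus> z"
  using assms by (simp add: a_minus_def M.a_assoc M.r_neg1)

lemma add_diff_add:
  assumes "x \<in> carrier E" "y \<in> carrier E" "x' \<in> carrier E" "y' \<in> carrier E"
  shows "(x \<oplus> y) \<ominus> (x' \<oplus> y') = (x \<ominus> x') \<oplus> (y \<ominus> y')"
  using assms by (simp add: a_minus_def M.a_ac M.minus_add)

lemma minus_minus_interchange: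
  assumes "x \<in> carrier E" "y \<in> carrier E" "u \<in> carrier E" "v \<in> carrier E"
  shows "(x \<ominus> y) \<ominus> (u \<ominus> v) = (x \<ominus> u) \<ominus> (y \<ominus> v)"
  using assms by (simp add: a_minus_def M.minus_add M.a_ac)

lemma minus_minus_cancel_left:
  assumes "x \<in> carrier E" "y \<in> carrier E" "z \<in> carrier E"
  shows "(x \<ominus> y) \<ominus> (x \<ominus> z) = z \<ominus> y"
proof -
  have "(x \<ominus> y) \<ominus> (x \<ominus> z) = \<zero> \<ominus> (y \<ominus> z)"
    using assms minus_minus_interchange[of x y x z] by simp
  also have "\<dots> = z \<ominus> y" using assms by (simp add: a_minus_def M.minus_add M.a_ac)
  finally show ?thesis .
qed

lemma smult_minus:
  assumes "a \<in> K" "x \<in> carrier E" "y \<in> carrier E"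
  shows "a \<odot> (x \<ominus> y) = a \<odot> x \<ominus> a \<odot> y"
  using assms by (simp add: minus_eq_add_smult smult_add mult_smult[symmetric] mult.commute)

lemma vnorm_minus_commute:
  assumes "x \<in> carrier E" "y \<in> carrier E"
  shows "vnorm E (x \<ominus> y) = vnorm E (y \<ominus> x)"
proof -
  have "\<ominus> (x \<ominus> y) = y \<ominus> x"
    using assms by (simp add: a_minus_def M.minus_add M.a_ac)
  then show ?thesis using vnorm_uminus[of "x \<ominus> y"] assms by simp
qed

lemma vnorm_minus_triangle:
  assumes "x \<in> carrier E" "y \<in> carrier E" "z \<in> carrier E"
  shows "vnorm E (x \<ominus> z) \<le> vnorm E (x \<ominus> y) + vnorm E (y \<ominus> z)"
  using vnorm_triangle[of "x \<ominus> y" "y \<ominus> z"] assms by (simp add: minus_add_minus)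

lemma vnorm_minus_le:
  assumes "x \<in> carrier E" "y \<in> carrier E"
  shows "vnorm E (x \<ominus> y) \<le> vnorm E x + vnorm E y"
  using vnorm_minus_triangle[of x \<zero> y] vnorm_minus_commute[of \<zero> y] assms by simp

lemma vnorm_le_add_minus:
  assumes "x \<in> carrier E" "y \<in> carrier E"
  shows "vnorm E x \<le> vnorm E y + vnorm E (x \<ominus> y)"
  using vnorm_triangle[of y "x \<ominus> y"] assms by simp

lemma Metric_space_norm_dist: "Metric_space (carrier E) (norm_dist E)"
proof
  fix x y z
  show "0 \<le> norm_dist E x y" by (simp add: norm_dist_def)
  show "norm_dist E x y = norm_dist E y x" by (simp add: norm_dist_def vnorm_minus_commute)
  assume "x \<in> carrier E" "y \<in> carrier E"
  then show "norm_dist E x y = 0 \<longleftrightarrow> x = y"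
    by (simp add: norm_dist_def vnorm_eq_0_iff minus_eq_0_iff)
  assume "z \<in> carrier E"
  then show "norm_dist E x z \<le> norm_dist E x y + norm_dist E y z"
    using \<open>x \<in> carrier E\<close> \<open>y \<in> carrier E\<close> by (simp add: norm_dist_def vnorm_minus_triangle)
qed

sublocale metric: Metric_space "carrier E" "norm_dist E"
  by (rule Metric_space_norm_dist)

section \<open>Limits and Cauchy sequences in terms of the norm\<close>

lemma limitin_iff_vconv:
  assumes "range x \<subseteq> carrier E"
  shows "limitin (norm_topology E) x l sequentially \<longleftrightarrow> vconv E x l"
proof -
  have "norm_dist E (x n) l = vnorm E (x n \<ominus> l)" if "l \<in> carrier E" for n
    using assms that by (auto simp: norm_dist_def)
  then show ?thesis
    using assms by (auto simp: metric.limitin_metric_dist_null vconv_def range_subsetD)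
qed

lemma MCauchy_iff_vcauchy: "metric.MCauchy x \<longleftrightarrow> vcauchy E x"
proof (cases "range x \<subseteq> carrier E")
  case True
  then have "norm_dist E (x m) (x n) = vnorm E (x m \<ominus> x n)" for m n
    by (auto simp: norm_dist_def)
  with True show ?thesis by (simp add: metric.MCauchy_def vcauchy_def)
qed (simp add: metric.MCauchy_def vcauchy_def)

lemma mcomplete_iff: "metric.mcomplete \<longleftrightarrow> (\<forall>x. vcauchy E x \<longrightarrow> (\<exists>l. vconv E x l))"
  unfolding metric.mcomplete_def MCauchy_iff_vcauchy
  using limitin_iff_vconv by (auto simp: vcauchy_def)

text \<open>Closed balls are sequentially closed: \<open>c\<close> bounds the distance from
  \<open>a\<close> up to the vanishing term \<open>vnorm E (x n \<ominus> l)\<close>. The bound is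
  required only eventually, as Cauchy estimates provide it.\<close>

lemma vconv_vnorm_le:
  assumes x: "vconv E x l" and a: "a \<in> carrier E"
    and le: "\<forall>\<^sub>F n in sequentially. vnorm E (x n \<ominus> a) \<le> c"
  shows "vnorm E (l \<ominus> a) \<le> c"
proof -
  have xl: "l \<in> carrier E" "\<And>n. x n \<in> carrier E" "(\<lambda>n. vnorm E (x n \<ominus> l)) \<longlonglongrightarrow> 0"
    using x by (auto simp: vconv_def)
  have "(\<lambda>n. vnorm E (x n \<ominus> l) + c) \<longlonglongrightarrow> 0 + c"
    by (intro tendsto_intros xl)
  moreover have "\<forall>\<^sub>F n in sequentially. vnorm E (l \<ominus> a) \<le> vnorm E (x n \<ominus> l) + c"
    using le
  proof eventually_elim
    case (elim n)
    then show ?case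
      using vnorm_minus_triangle[of l "x n" a] vnorm_minus_commute[of l "x n"] xl a by simp
  qed
  ultimately show ?thesis
    using tendsto_lowerbound by fastforce
qed

lemma vconv_vnorm_le0:
  assumes x: "vconv E x l" and le: "\<forall>\<^sub>F n in sequentially. vnorm E (x n) \<le> c"
  shows "vnorm E l \<le> c"
  using vconv_vnorm_le[OF x, of \<zero> c] le x by (auto simp: vconv_def range_subsetD)

lemma vconv_unique:
  assumes "vconv E x l" "vconv E x l'"
  shows "l = l'"
  using assms metric.limitin_metric_unique[of x l sequentially l']
  by (metis limitin_iff_vconv vconv_def trivial_limit_sequentially)

lemma vconv_add:
  assumes "vconv E x a" "vconv E y b"
  shows "vconv E (\<lambda>n. x n \<oplus> y n) (a \<oplus> b)"
proof -
  have xy: "a \<in> carrier E" "b \<in> carrier E" "\<And>n. x n \<in> carrier E" "\<And>n. y n \<in> carrier E"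
    "(\<lambda>n. vnorm E (x n \<ominus> a)) \<longlonglongrightarrow> 0" "(\<lambda>n. vnorm E (y n \<ominus> b)) \<longlonglongrightarrow> 0"
    using assms by (auto simp: vconv_def)
  have "(\<lambda>n. vnorm E ((x n \<oplus> y n) \<ominus> (a \<oplus> b))) \<longlonglongrightarrow> 0"
    by (rule tendsto_sandwich[OF _ _ tendsto_const tendsto_add_zero[OF xy(5,6)]])
      (use xy in \<open>auto simp: add_diff_add vnorm_triangle\<close>)
  with xy show ?thesis by (auto simp: vconv_def)
qed

lemma vconv_smult:
  assumes "vconv E x a" "c \<in> K"
  shows "vconv E (\<lambda>n. c \<odot> x n) (c \<odot> a)"
proof -
  have x: "a \<in> carrier E" "\<And>n. x n \<in> carrier E" "(\<lambda>n. vnorm E (x n \<ominus> a)) \<longlonglongrightarrow> 0"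
    using assms by (auto simp: vconv_def)
  have "(\<lambda>n. cmod c * vnorm E (x n \<ominus> a)) \<longlonglongrightarrow> 0"
    using x(3) by (rule tendsto_mult_right_zero)
  with x assms(2) show ?thesis by (auto simp: vconv_def vnorm_smult simp flip: smult_minus)
qed

end

lemma banach_space_vcauchy_vconv:
  assumes "K = \<real> \<or> K = UNIV" "banach_space K E" "vcauchy E x"
  shows "\<exists>l. vconv E x l"
proof -
  interpret normed_mod K E using assms by (simp add: banach_space_normed_mod)
  show ?thesis using banach_space.complete[OF assms(2)] assms(3) by (simp add: mcomplete_iff)
qed

lemma (in normed_mod) banach_spaceI:
  assumes "\<And>x. vcauchy E x \<Longrightarrow> \<exists>l. vconv E x l"
  shows "banach_space K E"
  by unfold_locales
    (use assms mcomplete_iff vnorm_eq_0_iff vnorm_smult vnorm_triangle in auto)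

section \<open>Bounded linear maps\<close>

definition linear_on ::
  "complex set \<Rightarrow> (complex, 'b) normed_module \<Rightarrow> (complex, 'c) normed_module \<Rightarrow> ('b \<Rightarrow> 'c) \<Rightarrow> bool"
  where "linear_on K E F u \<longleftrightarrow> u \<in> carrier E \<rightarrow> carrier F \<and>
     (\<forall>x\<in>carrier E. \<forall>y\<in>carrier E. u (x \<oplus>\<^bsub>E\<^esub> y) = u x \<oplus>\<^bsub>F\<^esub> u y) \<and>
     (\<forall>a\<in>K. \<forall>x\<in>carrier E. u (a \<odot>\<^bsub>E\<^esub> x) = a \<odot>\<^bsub>F\<^esub> u x)"

lemma linear_on_closed: "linear_on K E F u \<Longrightarrow> x \<in> carrier E \<Longrightarrow> u x \<in> carrier F"
  and linear_on_add: "linear_on K E F u \<Longrightarrow> x \<in> carrier E \<Longrightarrow> y \<in> carrier E \<Longrightarrow>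
    u (x \<oplus>\<^bsub>E\<^esub> y) = u x \<oplus>\<^bsub>F\<^esub> u y"
  and linear_on_smult: "linear_on K E F u \<Longrightarrow> a \<in> K \<Longrightarrow> x \<in> carrier E \<Longrightarrow>
    u (a \<odot>\<^bsub>E\<^esub> x) = a \<odot>\<^bsub>F\<^esub> u x"
  by (auto simp: linear_on_def)

locale normed_pair = E: normed_mod K E + F: normed_mod K F
  for K and E :: "(complex, 'b) normed_module" and F :: "(complex, 'c) normed_module"
begin

context
  fixes u assumes u: "linear_on K E F u"
begin

lemma linear_on_zero: "u \<zero>\<^bsub>E\<^esub> = \<zero>\<^bsub>F\<^esub>"
  using linear_on_smult[OF u, of 0 "\<zero>\<^bsub>E\<^esub>"] linear_on_closed[OF u, of "\<zero>\<^bsub>E\<^esub>"] by simp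

lemma linear_on_minus:
  assumes "x \<in> carrier E" "y \<in> carrier E"
  shows "u (x \<ominus>\<^bsub>E\<^esub> y) = u x \<ominus>\<^bsub>F\<^esub> u y"
  using assms u by (simp add: E.minus_eq_add_smult F.minus_eq_add_smult linear_on_add
    linear_on_smult linear_on_closed)

text \<open>Scaling by \<open>\<delta> / vnorm E x\<close> moves a nonzero \<open>x\<close> to norm
  \<open>\<delta>\<close>. No continuity enters, so the bound also serves maps whose continuity is
  still to be shown.\<close>

lemma linear_on_bound_scale:
  assumes d: "0 < \<delta>" and M: "\<And>x. x \<in> carrier E \<Longrightarrow> vnorm E x \<le> \<delta> \<Longrightarrow> vnorm F (u x) \<le> M"
    and x: "x \<in> carrier E"
  shows "vnorm F (u x) \<le> M / \<delta> * vnorm E x"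
proof (cases "x = \<zero>\<^bsub>E\<^esub>")
  case False
  then have pos: "0 < vnorm E x"
    using x E.vnorm_eq_0_iff[OF x] E.vnorm_nonneg[OF x] by linarith
  define c where "c = \<delta> / vnorm E x"
  have c: "0 < c" using pos d by (simp add: c_def)
  have "vnorm E (complex_of_real c \<odot>\<^bsub>E\<^esub> x) \<le> \<delta>"
    using x pos d c E.vnorm_smult[of "complex_of_real c" x] by (simp add: c_def del: of_real_divide)
  then have "vnorm F (u (complex_of_real c \<odot>\<^bsub>E\<^esub> x)) \<le> M"
    using x by (intro M) auto
  then have "c * vnorm F (u x) \<le> M"
    using c x u by (simp add: linear_on_smult F.vnorm_smult linear_on_closed)
  then show ?thesis
    using c pos d by (simp add: c_def field_simps)
qed (simp add: linear_on_zero)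

lemma linear_on_continuous_iff:
  "continuous_map (norm_topology E) (norm_topology F) u \<longleftrightarrow>
     (\<exists>C. \<forall>x\<in>carrier E. vnorm F (u x) \<le> C * vnorm E x)"
proof
  assume "continuous_map (norm_topology E) (norm_topology F) u"
  then obtain U where U: "openin (norm_topology E) U" "\<zero>\<^bsub>E\<^esub> \<in> U"
    "\<And>y. y \<in> U \<Longrightarrow> u y \<in> F.metric.mball (u \<zero>\<^bsub>E\<^esub>) 1"
    unfolding F.metric.continuous_map_to_metric
    by (metis E.metric.topspace_mtopology E.M.zero_closed zero_less_one)
  then obtain r where r: "r > 0" "E.metric.mball \<zero>\<^bsub>E\<^esub> r \<subseteq> U"
    by (meson E.metric.openin_mtopology)
  \<comment> \<open>Half the radius, because a bound on a closed ball is wanted and \<open>r\<close>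
    is the radius of an open one.\<close>
  have "vnorm F (u x) \<le> 1" if "x \<in> carrier E" "vnorm E x \<le> r / 2" for x
  proof -
    have "x \<in> E.metric.mball \<zero>\<^bsub>E\<^esub> r"
      using that r(1) by (simp add: norm_dist_def E.vnorm_minus_commute[of "\<zero>\<^bsub>E\<^esub>"])
    then have "u x \<in> F.metric.mball (u \<zero>\<^bsub>E\<^esub>) 1" using U(3) r(2) by blast
    then show ?thesis
      by (auto simp: linear_on_zero norm_dist_def F.vnorm_minus_commute[of "\<zero>\<^bsub>F\<^esub>"])
  qed
  then have "\<forall>x\<in>carrier E. vnorm F (u x) \<le> 1 / (r / 2) * vnorm E x"
    using linear_on_bound_scale[of "r / 2" 1] r(1) by auto
  then show "\<exists>C. \<forall>x\<in>carrier E. vnorm F (u x) \<le> C * vnorm E x" ..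
next
  assume "\<exists>C. \<forall>x\<in>carrier E. vnorm F (u x) \<le> C * vnorm E x"
  then obtain C where C: "\<And>x. x \<in> carrier E \<Longrightarrow> vnorm F (u x) \<le> C * vnorm E x" by blast
  show "continuous_map (norm_topology E) (norm_topology F) u"
    unfolding F.metric.continuous_map_to_metric
  proof (intro ballI allI impI)
    fix x \<epsilon> assume x: "x \<in> topspace (norm_topology E)" and e: "0 < (\<epsilon>::real)"
    \<comment> \<open>\<open>C\<close> may be zero or negative, hence the positive constant
      \<open>\<bar>C\<bar> + 1\<close> in its place.\<close>
    define \<delta> where "\<delta> = \<epsilon> / (\<bar>C\<bar> + 1)"
    have d: "0 < \<delta>" using e by (simp add: \<delta>_def add_nonneg_pos)
    have "u y \<in> F.metric.mball (u x) \<epsilon>" if "y \<in> E.metric.mball x \<delta>" for y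
    proof -
      have xy: "x \<in> carrier E" "y \<in> carrier E" "vnorm E (x \<ominus>\<^bsub>E\<^esub> y) < \<delta>"
        using that by (auto simp: norm_dist_def)
      have "vnorm F (u x \<ominus>\<^bsub>F\<^esub> u y) \<le> C * vnorm E (x \<ominus>\<^bsub>E\<^esub> y)"
        using C[of "x \<ominus>\<^bsub>E\<^esub> y"] xy by (simp add: linear_on_minus)
      also have "\<dots> \<le> (\<bar>C\<bar> + 1) * vnorm E (x \<ominus>\<^bsub>E\<^esub> y)"
        using xy by (intro mult_right_mono) auto
      also have "\<dots> < (\<bar>C\<bar> + 1) * \<delta>"
        using xy by (intro mult_strict_left_mono) auto
      also have "\<dots> = \<epsilon>" by (simp add: \<delta>_def add_nonneg_pos)
      finally show ?thesis using xy u by (simp add: norm_dist_def linear_on_closed)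
    qed
    then show "\<exists>U. openin (norm_topology E) U \<and> x \<in> U \<and> (\<forall>y\<in>U. u y \<in> F.metric.mball (u x) \<epsilon>)"
      using x d by (intro exI[of _ "E.metric.mball x \<delta>"]) (simp add: E.metric.openin_mball)
  qed
qed

lemma linear_on_vconv:
  assumes C: "\<And>x. x \<in> carrier E \<Longrightarrow> vnorm F (u x) \<le> C * vnorm E x" and x: "vconv E x l"
  shows "vconv F (\<lambda>n. u (x n)) (u l)"
proof -
  have xl: "l \<in> carrier E" "\<And>n. x n \<in> carrier E" "(\<lambda>n. vnorm E (x n \<ominus>\<^bsub>E\<^esub> l)) \<longlonglongrightarrow> 0"
    using x by (auto simp: vconv_def)
  have "(\<lambda>n. vnorm F (u (x n) \<ominus>\<^bsub>F\<^esub> u l)) \<longlonglongrightarrow> 0"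
  proof (rule tendsto_sandwich[OF _ _ tendsto_const])
    show "(\<lambda>n. C * vnorm E (x n \<ominus>\<^bsub>E\<^esub> l)) \<longlonglongrightarrow> 0"
      using xl(3) by (rule tendsto_mult_right_zero)
    show "\<forall>\<^sub>F n in sequentially. vnorm F (u (x n) \<ominus>\<^bsub>F\<^esub> u l) \<le> C * vnorm E (x n \<ominus>\<^bsub>E\<^esub> l)"
      using C xl by (simp flip: linear_on_minus)
  qed (use xl u in \<open>auto simp: linear_on_closed\<close>)
  then show ?thesis using xl u by (auto simp: vconv_def linear_on_closed)
qed

end

end

text \<open>Continuity enters the definition through topologies; a norm bound is the form in which
  it is verified and used below.\<close>

lemma lin_ops_iff:
  assumes "normed_mod K E" "normed_mod K F"
  shows "u \<in> lin_ops K E F \<longleftrightarrow> u \<in> extensional (carrier E) \<and> linear_on K E F u \<and>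
    (\<exists>C. \<forall>x\<in>carrier E. vnorm F (u x) \<le> C * vnorm E x)"
proof -
  interpret normed_pair K E F using assms by (simp add: normed_pair_def)
  show ?thesis
    using linear_on_continuous_iff[of u] by (auto simp: lin_ops_def linear_on_def PiE_def)
qed

lemma lin_ops_linear_on:
  "normed_mod K E \<Longrightarrow> normed_mod K F \<Longrightarrow> u \<in> lin_ops K E F \<Longrightarrow> linear_on K E F u"
  by (simp add: lin_ops_iff)

text \<open>\<open>SUP\<close> over the unit ball is informative only if the values are bounded
  above; the constant from continuity ensures this.\<close>

lemma lin_norm_upper:
  assumes E: "normed_mod K E" and F: "normed_mod K F" and u: "u \<in> lin_ops K E F"
    and x: "x \<in> carrier E" "vnorm E x \<le> 1"
  shows "vnorm F (u x) \<le> lin_norm E F u"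
proof -
  interpret normed_pair K E F using assms by (simp add: normed_pair_def)
  obtain C where C: "\<And>x. x \<in> carrier E \<Longrightarrow> vnorm F (u x) \<le> C * vnorm E x"
    using u lin_ops_iff[OF E F] by blast
  have "vnorm F (u x) \<le> \<bar>C\<bar>" if "x \<in> carrier E" "vnorm E x \<le> 1" for x
  proof -
    have "vnorm F (u x) \<le> \<bar>C\<bar> * vnorm E x"
      using C[of x] that by (smt (verit) E.vnorm_nonneg mult_right_mono)
    also have "\<dots> \<le> \<bar>C\<bar> * 1" using that by (intro mult_left_mono) auto
    finally show ?thesis by simp
  qed
  then show ?thesis
    unfolding lin_norm_def using x by (intro cSUP_upper bdd_aboveI2) auto
qed

lemma lin_ops_vnorm_le:
  assumes E: "normed_mod K E" and F: "normed_mod K F" and u: "u \<in> lin_ops K E F"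
    and x: "x \<in> carrier E"
  shows "vnorm F (u x) \<le> lin_norm E F u * vnorm E x"
proof -
  interpret normed_pair K E F using assms by (simp add: normed_pair_def)
  show ?thesis
    using linear_on_bound_scale[OF lin_ops_linear_on[OF E F u], of 1] lin_norm_upper[OF E F u] x
    by auto
qed

lemma lin_norm_nonneg:
  assumes E: "normed_mod K E" and F: "normed_mod K F" and u: "u \<in> lin_ops K E F"
  shows "0 \<le> lin_norm E F u"
proof -
  interpret normed_pair K E F using assms by (simp add: normed_pair_def)
  show ?thesis
    using lin_norm_upper[OF E F u, of "\<zero>\<^bsub>E\<^esub>"] linear_on_zero[OF lin_ops_linear_on[OF E F u]]
    by simp
qed

lemma lin_norm_le:
  assumes E: "normed_mod K E" and C: "0 \<le> C"
    and le: "\<And>x. x \<in> carrier E \<Longrightarrow> vnorm F (u x) \<le> C * vnorm E x"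
  shows "lin_norm E F u \<le> C"
proof -
  interpret E: normed_mod K E by fact
  show ?thesis unfolding lin_norm_def
  proof (rule cSUP_least)
    show "{x \<in> carrier E. vnorm E x \<le> 1} \<noteq> {}" using E.M.zero_closed by force
    fix x assume x: "x \<in> {x \<in> carrier E. vnorm E x \<le> 1}"
    then have "vnorm F (u x) \<le> C * vnorm E x" using le by auto
    also have "\<dots> \<le> C * 1" using C x by (intro mult_left_mono) auto
    finally show "vnorm F (u x) \<le> C" by simp
  qed
qed

section \<open>Bounded multilinear maps\<close>

declare One_nat_def [simp del]

text \<open>Linearity in each slot, with the others frozen by function update, gives access to all
  facts on \<open>linear_on\<close>. Boundedness is kept out since the induced map is known to be
  multilinear earlier than bounded.\<close>

definition multilinear_on ::
  "complex set \<Rightarrow> nat \<Rightarrow> (nat \<Rightarrow> 'a bspace) \<Rightarrow> 'a bspace \<Rightarrow> ((nat \<Rightarrow> 'a univ) \<Rightarrow> 'a univ) \<Rightarrow> bool"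
  where "multilinear_on K d E F A \<longleftrightarrow> A \<in> tuples d E \<rightarrow> carrier F \<and>
     (\<forall>r\<in>{1..d}. \<forall>x\<in>tuples d E. linear_on K (E r) F (\<lambda>y. A (x(r := y))))"

lemma tuples_upd [intro]:
  "x \<in> tuples d E \<Longrightarrow> r \<in> {1..d} \<Longrightarrow> y \<in> carrier (E r) \<Longrightarrow> x(r := y) \<in> tuples d E"
  by (auto simp: tuples_def PiE_iff extensional_def)

lemma tuples_restrict [intro]:
  "(\<And>r. r \<in> {1..d} \<Longrightarrow> f r \<in> carrier (E r)) \<Longrightarrow> restrict f {1..d} \<in> tuples d E"
  by (auto simp: tuples_def)

lemma tuples_mem: "x \<in> tuples d E \<Longrightarrow> r \<in> {1..d} \<Longrightarrow> x r \<in> carrier (E r)"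
  by (auto simp: tuples_def)

lemma tuples_ext: "x \<in> tuples d E \<Longrightarrow> y \<in> tuples d E \<Longrightarrow> (\<And>r. r \<in> {1..d} \<Longrightarrow> x r = y r) \<Longrightarrow> x = y"
  unfolding tuples_def by (rule PiE_ext)

lemma multilinear_onI:
  assumes "\<And>x. x \<in> tuples d E \<Longrightarrow> A x \<in> carrier F"
    and "\<And>r x y z. r \<in> {1..d} \<Longrightarrow> x \<in> tuples d E \<Longrightarrow> y \<in> carrier (E r) \<Longrightarrow> z \<in> carrier (E r) \<Longrightarrow>
      A (x(r := y \<oplus>\<^bsub>E r\<^esub> z)) = A (x(r := y)) \<oplus>\<^bsub>F\<^esub> A (x(r := z))"
    and "\<And>r x a y. r \<in> {1..d} \<Longrightarrow> x \<in> tuples d E \<Longrightarrow> a \<in> K \<Longrightarrow> y \<in> carrier (E r) \<Longrightarrow>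
      A (x(r := a \<odot>\<^bsub>E r\<^esub> y)) = a \<odot>\<^bsub>F\<^esub> A (x(r := y))"
  shows "multilinear_on K d E F A"
  using assms by (simp add: multilinear_on_def linear_on_def Pi_iff tuples_upd)

locale normed_mods =
  fixes K :: "complex set" and d :: nat and E :: "nat \<Rightarrow> 'a bspace" and F :: "'a bspace"
  assumes d_pos: "1 \<le> d" and E: "\<And>r. r \<in> {1..d} \<Longrightarrow> normed_mod K (E r)" and F: "normed_mod K F"
begin

sublocale F: normed_mod K F by (rule F)

definition zero_tuple :: "nat \<Rightarrow> 'a univ" where
  "zero_tuple = (\<lambda>r\<in>{1..d}. \<zero>\<^bsub>E r\<^esub>)"

lemma E_zero: "r \<in> {1..d} \<Longrightarrow> \<zero>\<^bsub>E r\<^esub> \<in> carrier (E r)" "r \<in> {1..d} \<Longrightarrow> vnorm (E r) \<zero>\<^bsub>E r\<^esub> = 0"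
proof -
  assume r: "r \<in> {1..d}"
  interpret normed_mod K "E r" using r by (rule E)
  show "\<zero>\<^bsub>E r\<^esub> \<in> carrier (E r)" "vnorm (E r) \<zero>\<^bsub>E r\<^esub> = 0" by simp_all
qed

lemma zero_tuple: "zero_tuple \<in> tuples d E"
  by (auto simp: zero_tuple_def E_zero)

lemma tuples_vnorm_nonneg: "x \<in> tuples d E \<Longrightarrow> r \<in> {1..d} \<Longrightarrow> 0 \<le> vnorm (E r) (x r)"
  using normed_mod.vnorm_nonneg[OF E tuples_mem] .

lemma tuples_prod_nonneg: "x \<in> tuples d E \<Longrightarrow> 0 \<le> (\<Prod>r = 1..d. vnorm (E r) (x r))"
  by (intro prod_nonneg) (use tuples_vnorm_nonneg in auto)

context
  fixes A assumes A: "multilinear_on K d E F A"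
begin

lemma multilinear_on_linear_on:
  "r \<in> {1..d} \<Longrightarrow> x \<in> tuples d E \<Longrightarrow> linear_on K (E r) F (\<lambda>y. A (x(r := y)))"
  and multilinear_on_closed: "x \<in> tuples d E \<Longrightarrow> A x \<in> carrier F"
  using A by (auto simp: multilinear_on_def)

lemma multilinear_on_eq_zero:
  assumes r: "r \<in> {1..d}" and x: "x \<in> tuples d E" and 0: "x r = \<zero>\<^bsub>E r\<^esub>"
  shows "A x = \<zero>\<^bsub>F\<^esub>"
proof -
  interpret normed_pair K "E r" F using E[OF r] F by (simp add: normed_pair_def)
  have "A (x(r := \<zero>\<^bsub>E r\<^esub>)) = \<zero>\<^bsub>F\<^esub>"
    using linear_on_zero[OF multilinear_on_linear_on[OF r x]] .
  moreover have "x(r := \<zero>\<^bsub>E r\<^esub>) = x" using 0 by auto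
  ultimately show ?thesis by simp
qed

lemma multilinear_on_scale:
  assumes c: "\<And>r. r \<in> {1..d} \<Longrightarrow> c r \<in> K" and x: "x \<in> tuples d E"
  shows "A (\<lambda>r\<in>{1..d}. c r \<odot>\<^bsub>E r\<^esub> x r) = (\<Prod>r = 1..d. c r) \<odot>\<^bsub>F\<^esub> A x"
proof -
  have Ec: "c r \<odot>\<^bsub>E r\<^esub> x r \<in> carrier (E r)" if "r \<in> {1..d}" for r
    using normed_mod.smult_in[OF E[OF that] c[OF that] tuples_mem[OF x that]] .
  \<comment> \<open>For the induction the set \<open>S\<close> of slots already scaled is made
    variable; enlarging it by \<open>q\<close> changes a single slot.\<close>
  have "A (\<lambda>r\<in>{1..d}. if r \<in> S then c r \<odot>\<^bsub>E r\<^esub> x r else x r) = (\<Prod>r\<in>S. c r) \<odot>\<^bsub>F\<^esub> A x"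
    if "finite S" "S \<subseteq> {1..d}" for S
    using that
  proof (induction S)
    case empty
    have "(\<lambda>r\<in>{1..d}. x r) = x" using x by (auto simp: tuples_def)
    then show ?case using x multilinear_on_closed by simp
  next
    case (insert q S)
    let ?y = "\<lambda>r\<in>{1..d}. if r \<in> S then c r \<odot>\<^bsub>E r\<^esub> x r else x r"
    have q: "q \<in> {1..d}" using insert by simp
    have y: "?y \<in> tuples d E" using Ec x by (intro tuples_restrict) (auto simp: tuples_mem)
    have "(\<lambda>r\<in>{1..d}. if r \<in> insert q S then c r \<odot>\<^bsub>E r\<^esub> x r else x r) = ?y(q := c q \<odot>\<^bsub>E q\<^esub> x q)"
      using q by (auto simp: fun_eq_iff)
    moreover have "?y(q := x q) = ?y" using q insert by (auto simp: fun_eq_iff)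
    ultimately have "A (\<lambda>r\<in>{1..d}. if r \<in> insert q S then c r \<odot>\<^bsub>E r\<^esub> x r else x r) = c q \<odot>\<^bsub>F\<^esub> A ?y"
      using linear_on_smult[OF multilinear_on_linear_on[OF q y] c[OF q] tuples_mem[OF x q]] by simp
    also have "\<dots> = (\<Prod>r\<in>insert q S. c r) \<odot>\<^bsub>F\<^esub> A x"
    proof -
      have "prod c S \<in> K" using insert.prems c by (intro F.K_prod) auto
      moreover have "A ?y = (\<Prod>r\<in>S. c r) \<odot>\<^bsub>F\<^esub> A x" using insert by blast
      ultimately show ?thesis
        using insert.hyps c[OF q] multilinear_on_closed[OF x] by (simp only: prod.insert F.mult_smult not_False_eq_True)
    qed
    finally show ?case .
  qed
  from this[of "{1..d}"] show ?thesis by (simp cong: restrict_cong)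
qed

text \<open>If some \<open>x r\<close> is zero, both sides vanish. Otherwise each slot is scaled to
  norm \<open>\<delta>\<close> separately, and the product of the factors,
  \<open>\<delta> ^ d\<close> over the product of the norms, comes out of \<open>A\<close>.\<close>

lemma multilinear_on_bound_scale:
  assumes \<delta>: "0 < \<delta>"
    and M: "\<And>x. x \<in> tuples d E \<Longrightarrow> (\<And>r. r \<in> {1..d} \<Longrightarrow> vnorm (E r) (x r) \<le> \<delta>) \<Longrightarrow> vnorm F (A x) \<le> M"
    and x: "x \<in> tuples d E"
  shows "vnorm F (A x) \<le> M / \<delta> ^ d * (\<Prod>r = 1..d. vnorm (E r) (x r))"
proof (cases "\<exists>r\<in>{1..d}. x r = \<zero>\<^bsub>E r\<^esub>")
  case True
  then obtain r where "r \<in> {1..d}" "x r = \<zero>\<^bsub>E r\<^esub>" by blast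
  moreover from this have 0: "(\<Prod>r = 1..d. vnorm (E r) (x r)) = 0"
    using E_zero(2) by (intro prod_zero bexI[of _ r]) auto
  ultimately show ?thesis
    using multilinear_on_eq_zero[of r x] x by (simp only: 0 mult_zero_right F.vnorm_zero order_refl)
next
  case False
  have pos: "0 < vnorm (E r) (x r)" if r: "r \<in> {1..d}" for r
    using normed_mod.vnorm_eq_0_iff[OF E[OF r] tuples_mem[OF x r]] tuples_vnorm_nonneg[OF x r] False r
    by force
  define c where "c = (\<lambda>r. \<delta> / vnorm (E r) (x r))"
  let ?y = "\<lambda>r\<in>{1..d}. complex_of_real (c r) \<odot>\<^bsub>E r\<^esub> x r"
  have c: "0 < c r" if "r \<in> {1..d}" for r using pos[OF that] \<delta> by (simp add: c_def)
  have "vnorm F (A ?y) \<le> M"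
  proof (rule M)
    show "?y \<in> tuples d E"
      using normed_mod.smult_in[OF E F.K_real tuples_mem[OF x]] by auto
    fix r assume r: "r \<in> {1..d}"
    then show "vnorm (E r) (?y r) \<le> \<delta>"
      using normed_mod.vnorm_smult[OF E[OF r] F.K_real tuples_mem[OF x r], of "c r"] c[OF r] pos[OF r]
      \<delta> by (simp add: c_def del: of_real_divide)
  qed
  also have "A ?y = complex_of_real (\<Prod>r = 1..d. c r) \<odot>\<^bsub>F\<^esub> A x"
    using multilinear_on_scale[of "\<lambda>r. complex_of_real (c r)" x] x by simp
  finally have "(\<Prod>r = 1..d. c r) * vnorm F (A x) \<le> M"
    using c prod_pos[of "{1..d}" c] multilinear_on_closed[OF x]
    by (simp add: F.vnorm_smult less_imp_le del: of_real_prod)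
  moreover have "(\<Prod>r = 1..d. c r) = \<delta> ^ d / (\<Prod>r = 1..d. vnorm (E r) (x r))"
    by (simp add: c_def prod_dividef)
  moreover have "0 < (\<Prod>r = 1..d. vnorm (E r) (x r))" using pos by (intro prod_pos) auto
  ultimately show ?thesis using \<delta> by (simp add: field_simps)
qed

text \<open>Telescoping: \<open>z i\<close> takes its first \<open>i\<close> slots from
  \<open>y\<close> and the others from \<open>x\<close>. Neighbours differ in one slot, where
  linearity leaves one factor of size at most \<open>\<delta>\<close> and \<open>d - 1\<close>
  factors of size at most \<open>M\<close>.\<close>

lemma multilinear_on_diff:
  fixes C M \<delta> :: real
  assumes C: "0 \<le> C" "\<And>x. x \<in> tuples d E \<Longrightarrow> vnorm F (A x) \<le> C * (\<Prod>r = 1..d. vnorm (E r) (x r))"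
    and x: "x \<in> tuples d E" "\<And>r. r \<in> {1..d} \<Longrightarrow> vnorm (E r) (x r) \<le> M"
    and y: "y \<in> tuples d E" "\<And>r. r \<in> {1..d} \<Longrightarrow> vnorm (E r) (y r) \<le> M"
    and \<delta>: "\<And>r. r \<in> {1..d} \<Longrightarrow> vnorm (E r) (y r \<ominus>\<^bsub>E r\<^esub> x r) \<le> \<delta>"
  shows "vnorm F (A y \<ominus>\<^bsub>F\<^esub> A x) \<le> d * (C * (\<delta> * M ^ (d - 1)))"
proof -
  define z where "z i = (\<lambda>r\<in>{1..d}. if r \<le> i then y r else x r)" for i :: nat
  have z: "z i \<in> tuples d E" for i
    unfolding z_def using x y by (intro tuples_restrict) (auto simp: tuples_mem)
  have step: "vnorm F (A (z (Suc i)) \<ominus>\<^bsub>F\<^esub> A (z i)) \<le> C * (\<delta> * M ^ (d - 1))" if i: "i < d" for i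
  proof -
    let ?q = "Suc i"
    have q: "?q \<in> {1..d}" using i by simp
    interpret normed_pair K "E ?q" F using E[OF q] F by (simp add: normed_pair_def)
    let ?h = "y ?q \<ominus>\<^bsub>E ?q\<^esub> x ?q"
    have h: "?h \<in> carrier (E ?q)" using tuples_mem x(1) y(1) q by blast
    have "z (Suc i) = (z i)(?q := y ?q)" "z i = (z i)(?q := x ?q)"
      using i by (auto simp: z_def fun_eq_iff)
    then have "A (z (Suc i)) \<ominus>\<^bsub>F\<^esub> A (z i) = A ((z i)(?q := ?h))"
      using linear_on_minus[OF multilinear_on_linear_on[OF q z[of i]], of "y ?q" "x ?q"]
        tuples_mem[OF x(1) q] tuples_mem[OF y(1) q] by simp
    also have "vnorm F \<dots> \<le> C * (\<Prod>r = 1..d. vnorm (E r) (((z i)(?q := ?h)) r))"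
      using z q h by (intro C) auto
    also have "(\<Prod>r = 1..d. vnorm (E r) (((z i)(?q := ?h)) r))
        = vnorm (E ?q) ?h * (\<Prod>r\<in>{1..d} - {?q}. vnorm (E r) (z i r))"
      using q by (subst prod.remove[of _ ?q]) auto
    also have "C * \<dots> \<le> C * (\<delta> * M ^ (d - 1))"
    proof (intro mult_left_mono mult_mono)
      have "(\<Prod>r\<in>{1..d} - {?q}. vnorm (E r) (z i r)) \<le> (\<Prod>r\<in>{1..d} - {?q}. M)"
        using x y tuples_vnorm_nonneg[OF z] by (intro prod_mono) (auto simp: z_def)
      also have "\<dots> = M ^ (d - 1)" using q by simp
      finally show "(\<Prod>r\<in>{1..d} - {?q}. vnorm (E r) (z i r)) \<le> M ^ (d - 1)" .
      show "vnorm (E ?q) ?h \<le> \<delta>" by (rule \<delta>[OF q])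
      then show "0 \<le> \<delta>" using E.vnorm_nonneg[OF h] by linarith
      show "0 \<le> (\<Prod>r\<in>{1..d} - {?q}. vnorm (E r) (z i r))"
        using tuples_vnorm_nonneg[OF z] by (intro prod_nonneg) auto
    qed fact
    finally show ?thesis .
  qed
  have "vnorm F (A (z i) \<ominus>\<^bsub>F\<^esub> A (z 0)) \<le> i * (C * (\<delta> * M ^ (d - 1)))" if "i \<le> d" for i
    using that
  proof (induction i)
    case 0
    then show ?case using multilinear_on_closed[OF z] by simp
  next
    case (Suc i)
    then have "vnorm F (A (z (Suc i)) \<ominus>\<^bsub>F\<^esub> A (z 0))
        \<le> C * (\<delta> * M ^ (d - 1)) + i * (C * (\<delta> * M ^ (d - 1)))"
      using F.vnorm_minus_triangle[of "A (z (Suc i))" "A (z i)" "A (z 0)"]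
        multilinear_on_closed[OF z] step[of i] by auto
    then show ?case by (simp add: algebra_simps)
  qed
  moreover have "z d = y" "z 0 = x"
    using x(1) y(1) by (intro tuples_ext[OF z]; simp add: z_def)+
  ultimately show ?thesis by auto
qed

lemma E_metric: "r \<in> {1..d} \<Longrightarrow> Metric_space (carrier (E r)) (norm_dist (E r))"
  using normed_mod.Metric_space_norm_dist[OF E] .

lemma topspace_tuples: "topspace (product_topology (\<lambda>r. norm_topology (E r)) {1..d}) = tuples d E"
  unfolding tuples_def topspace_product_topology
  by (intro PiE_cong) (rule Metric_space.topspace_mtopology[OF E_metric])

text \<open>Forwards, continuity at the zero tuple bounds \<open>A\<close> on a box around it, which
  scaling turns into a global bound. Backwards, \<open>multilinear_on_diff\<close> is a local
  Lipschitz estimate.\<close>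

lemma multilinear_on_continuous_iff:
  "continuous_map (product_topology (\<lambda>r. norm_topology (E r)) {1..d}) (norm_topology F) A \<longleftrightarrow>
     (\<exists>C. \<forall>x\<in>tuples d E. vnorm F (A x) \<le> C * (\<Prod>r = 1..d. vnorm (E r) (x r)))"
  (is "continuous_map ?T _ _ \<longleftrightarrow> ?bdd")
proof
  assume "continuous_map ?T (norm_topology F) A"
  then obtain U where U: "openin ?T U" "zero_tuple \<in> U"
    "\<And>y. y \<in> U \<Longrightarrow> A y \<in> F.metric.mball (A zero_tuple) 1"
    unfolding F.metric.continuous_map_to_metric topspace_tuples using zero_tuple zero_less_one by meson
  obtain V where V: "\<forall>r\<in>{1..d}. openin (norm_topology (E r)) (V r)"
    "zero_tuple \<in> Pi\<^sub>E {1..d} V" "Pi\<^sub>E {1..d} V \<subseteq> U"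
    using U(1,2) unfolding openin_product_topology_alt by blast
  have "\<exists>e>0. Metric_space.mball (carrier (E r)) (norm_dist (E r)) \<zero>\<^bsub>E r\<^esub> e \<subseteq> V r"
    if r: "r \<in> {1..d}" for r
  proof -
    have "\<zero>\<^bsub>E r\<^esub> \<in> V r" using V(2) r by (auto simp: zero_tuple_def PiE_iff)
    then show ?thesis using bspec[OF V(1) r] Metric_space.openin_mtopology[OF E_metric[OF r]] by blast
  qed
  then obtain e where e: "\<And>r. r \<in> {1..d} \<Longrightarrow> e r > (0::real)"
    "\<And>r. r \<in> {1..d} \<Longrightarrow> Metric_space.mball (carrier (E r)) (norm_dist (E r)) \<zero>\<^bsub>E r\<^esub> (e r) \<subseteq> V r"
    by metis
  \<comment> \<open>The minimum over the finitely many slots gives one radius for all; half of it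
    keeps the closed box inside the open balls.\<close>
  define \<delta> where "\<delta> = Min (e ` {1..d}) / 2"
  have Min: "0 < Min (e ` {1..d})" using e(1) d_pos by (subst Min_gr_iff) auto
  have \<delta>: "0 < \<delta>" using Min by (simp add: \<delta>_def)
  have \<delta>_less: "\<delta> < e r" if "r \<in> {1..d}" for r
  proof -
    have "Min (e ` {1..d}) \<le> e r" using that by (intro Min_le) auto
    then show ?thesis using Min by (simp add: \<delta>_def)
  qed
  have "vnorm F (A x) \<le> 1" if x: "x \<in> tuples d E" "\<And>r. r \<in> {1..d} \<Longrightarrow> vnorm (E r) (x r) \<le> \<delta>" for x
  proof -
    have "x r \<in> V r" if r: "r \<in> {1..d}" for r
    proof -
      interpret Er: normed_mod K "E r" by (rule E[OF r])
      have "x r \<in> Er.metric.mball \<zero>\<^bsub>E r\<^esub> (e r)"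
        using tuples_mem[OF x(1) r] x(2)[OF r] \<delta>_less[OF r]
        by (simp add: norm_dist_def Er.vnorm_minus_commute[of "\<zero>\<^bsub>E r\<^esub>"])
      then show ?thesis using e(2)[OF r] by blast
    qed
    then have "x \<in> Pi\<^sub>E {1..d} V" using x(1) by (simp add: tuples_def PiE_iff)
    then have "x \<in> U" using V(3) by blast
    then have "A x \<in> F.metric.mball (A zero_tuple) 1" using U(3) by blast
    moreover have "A zero_tuple = \<zero>\<^bsub>F\<^esub>"
      using d_pos by (intro multilinear_on_eq_zero[of 1] zero_tuple) (auto simp: zero_tuple_def)
    ultimately show ?thesis
      by (auto simp: norm_dist_def F.vnorm_minus_commute[of "\<zero>\<^bsub>F\<^esub>"])
  qed
  then show "\<exists>C. \<forall>x\<in>tuples d E. vnorm F (A x) \<le> C * (\<Prod>r = 1..d. vnorm (E r) (x r))"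
    using multilinear_on_bound_scale[OF \<delta>, of 1] by blast
next
  assume "\<exists>C. \<forall>x\<in>tuples d E. vnorm F (A x) \<le> C * (\<Prod>r = 1..d. vnorm (E r) (x r))"
  then obtain C' where C': "\<And>x. x \<in> tuples d E \<Longrightarrow> vnorm F (A x) \<le> C' * (\<Prod>r = 1..d. vnorm (E r) (x r))"
    by blast
  define C where "C = \<bar>C'\<bar>"
  have C: "0 \<le> C" "\<And>x. x \<in> tuples d E \<Longrightarrow> vnorm F (A x) \<le> C * (\<Prod>r = 1..d. vnorm (E r) (x r))"
    using order_trans[OF C' mult_right_mono[OF abs_ge_self tuples_prod_nonneg]] by (auto simp: C_def)
  show "continuous_map ?T (norm_topology F) A"
    unfolding F.metric.continuous_map_to_metric topspace_tuples
  proof (intro ballI allI impI)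
    fix x and \<epsilon> :: real assume x: "x \<in> tuples d E" and \<epsilon>: "0 < \<epsilon>"
    \<comment> \<open>\<open>M\<close> exceeds each norm of \<open>x\<close> by at least 1, so it
      also bounds every slot of a tuple within \<open>\<delta> \<le> 1\<close> of \<open>x\<close>.
      The added 1 in the denominator of \<open>\<delta>\<close> excludes division by zero.\<close>
    define M where "M = (\<Sum>r = 1..d. vnorm (E r) (x r)) + 1"
    define \<delta> where "\<delta> = min 1 (\<epsilon> / (d * C * M ^ (d - 1) + 1))"
    have xM: "vnorm (E r) (x r) \<le> M - 1" if "r \<in> {1..d}" for r
      unfolding M_def using that tuples_vnorm_nonneg[OF x]
        member_le_sum[of r "{1..d}" "\<lambda>r. vnorm (E r) (x r)"] by auto
    have M: "0 \<le> M" using tuples_vnorm_nonneg[OF x] by (auto simp: M_def intro!: sum_nonneg add_nonneg_nonneg)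
    have nn: "0 \<le> d * C * M ^ (d - 1)" using C(1) M by simp
    have \<delta>: "0 < \<delta>" "\<delta> \<le> 1" "d * (C * (\<delta> * M ^ (d - 1))) < \<epsilon>"
    proof -
      show "0 < \<delta>" "\<delta> \<le> 1" using nn \<epsilon> by (auto simp: \<delta>_def add_nonneg_pos)
      have "d * (C * (\<delta> * M ^ (d - 1))) = \<delta> * (d * C * M ^ (d - 1))" by simp
      also have "\<dots> < \<delta> * (d * C * M ^ (d - 1) + 1)" using \<open>0 < \<delta>\<close> by simp
      also have "\<dots> \<le> \<epsilon> / (d * C * M ^ (d - 1) + 1) * (d * C * M ^ (d - 1) + 1)"
        using nn by (intro mult_right_mono) (auto simp: \<delta>_def)
      also have "\<dots> = \<epsilon>" using nn by simp
      finally show "d * (C * (\<delta> * M ^ (d - 1))) < \<epsilon>" .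
    qed
    let ?B = "\<lambda>r. Metric_space.mball (carrier (E r)) (norm_dist (E r)) (x r) \<delta>"
    have "A y \<in> F.metric.mball (A x) \<epsilon>" if "y \<in> Pi\<^sub>E {1..d} ?B" for y
    proof -
      have yr: "y r \<in> carrier (E r) \<and> vnorm (E r) (y r \<ominus>\<^bsub>E r\<^esub> x r) \<le> \<delta> \<and> vnorm (E r) (y r) \<le> M"
        if r: "r \<in> {1..d}" for r
      proof -
        interpret Er: normed_mod K "E r" by (rule E[OF r])
        have "y r \<in> Er.metric.mball (x r) \<delta>" using PiE_mem[OF \<open>y \<in> Pi\<^sub>E {1..d} ?B\<close> r] .
        then have *: "y r \<in> carrier (E r)" "x r \<in> carrier (E r)" "vnorm (E r) (y r \<ominus>\<^bsub>E r\<^esub> x r) < \<delta>"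
          by (auto simp: norm_dist_def Er.vnorm_minus_commute[of "x r"])
        then show ?thesis
          using Er.vnorm_le_add_minus[of "y r" "x r"] xM[OF r] \<delta>(2) by auto
      qed
      have y: "y \<in> tuples d E" using that yr by (auto simp: tuples_def PiE_iff)
      have "vnorm F (A y \<ominus>\<^bsub>F\<^esub> A x) \<le> d * (C * (\<delta> * M ^ (d - 1)))"
        using yr xM by (intro multilinear_on_diff C x y) force+
      then show ?thesis
        using \<delta>(3) multilinear_on_closed x y
        by (simp add: norm_dist_def F.vnorm_minus_commute[of "A x"])
    qed
    moreover have "openin ?T (Pi\<^sub>E {1..d} ?B)"
      by (subst openin_PiE) (auto simp: Metric_space.openin_mball[OF E_metric])
    moreover have "x \<in> Pi\<^sub>E {1..d} ?B"
      using x \<delta>(1) by (auto simp: tuples_def PiE_iff Metric_space.centre_in_mball_iff[OF E_metric])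
    ultimately show "\<exists>U. openin ?T U \<and> x \<in> U \<and> (\<forall>y\<in>U. A y \<in> F.metric.mball (A x) \<epsilon>)"
      by blast
  qed
qed

end

section \<open>Norms of bounded multilinear maps\<close>

lemma multilin_ops_iff:
  "A \<in> multilin_ops K d E F \<longleftrightarrow> A \<in> extensional (tuples d E) \<and> multilinear_on K d E F A \<and>
    (\<exists>C. \<forall>x\<in>tuples d E. vnorm F (A x) \<le> C * (\<Prod>r = 1..d. vnorm (E r) (x r)))"
proof -
  have "A \<in> multilin_ops K d E F \<longleftrightarrow> A \<in> extensional (tuples d E) \<and> multilinear_on K d E F A \<and>
    continuous_map (product_topology (\<lambda>r. norm_topology (E r)) {1..d}) (norm_topology F) A"
    by (auto simp: multilin_ops_def multilinear_on_def linear_on_def PiE_def tuples_upd Pi_iff)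
  then show ?thesis using multilinear_on_continuous_iff[of A] by blast
qed

lemma multilin_ops_multilinear_on: "A \<in> multilin_ops K d E F \<Longrightarrow> multilinear_on K d E F A"
  by (simp add: multilin_ops_iff)

lemma multilin_ops_closed: "A \<in> multilin_ops K d E F \<Longrightarrow> x \<in> tuples d E \<Longrightarrow> A x \<in> carrier F"
  using multilin_ops_multilinear_on multilinear_on_closed by blast

lemma multilin_norm_upper:
  assumes A: "A \<in> multilin_ops K d E F"
    and x: "x \<in> tuples d E" "\<And>r. r \<in> {1..d} \<Longrightarrow> vnorm (E r) (x r) \<le> 1"
  shows "vnorm F (A x) \<le> multilin_norm d E F A"
proof -
  obtain C where C: "\<And>x. x \<in> tuples d E \<Longrightarrow> vnorm F (A x) \<le> C * (\<Prod>r = 1..d. vnorm (E r) (x r))"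
    using A by (auto simp: multilin_ops_iff)
  have "vnorm F (A x) \<le> \<bar>C\<bar>"
    if x: "x \<in> tuples d E" "\<forall>r\<in>{1..d}. vnorm (E r) (x r) \<le> 1" for x
  proof -
    have "vnorm F (A x) \<le> \<bar>C\<bar> * (\<Prod>r = 1..d. vnorm (E r) (x r))"
      using order_trans[OF C mult_right_mono[OF abs_ge_self tuples_prod_nonneg]] x by blast
    also have "\<dots> \<le> \<bar>C\<bar> * 1"
      using x tuples_vnorm_nonneg by (intro mult_left_mono prod_le_1) auto
    finally show ?thesis by simp
  qed
  then show ?thesis
    unfolding multilin_norm_def using x by (intro cSUP_upper bdd_aboveI2) auto
qed

lemma multilin_norm_vnorm_le:
  assumes A: "A \<in> multilin_ops K d E F" and x: "x \<in> tuples d E"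
  shows "vnorm F (A x) \<le> multilin_norm d E F A * (\<Prod>r = 1..d. vnorm (E r) (x r))"
  using multilinear_on_bound_scale[OF multilin_ops_multilinear_on[OF A], of 1] multilin_norm_upper[OF A] x
  by simp

lemma multilin_norm_least:
  assumes "\<And>x. x \<in> tuples d E \<Longrightarrow> (\<And>r. r \<in> {1..d} \<Longrightarrow> vnorm (E r) (x r) \<le> 1) \<Longrightarrow> vnorm F (A x) \<le> C"
  shows "multilin_norm d E F A \<le> C"
  unfolding multilin_norm_def
proof (rule cSUP_least)
  \<comment> \<open>A least upper bound argument needs a nonempty set; the zero tuple shows that the
    unit ball is inhabited.\<close>
  have "zero_tuple \<in> {x \<in> tuples d E. \<forall>r\<in>{1..d}. vnorm (E r) (x r) \<le> 1}"
    using zero_tuple E_zero by (auto simp: zero_tuple_def)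
  then show "{x \<in> tuples d E. \<forall>r\<in>{1..d}. vnorm (E r) (x r) \<le> 1} \<noteq> {}" by blast
qed (use assms in auto)

lemma multilin_norm_nonneg:
  assumes A: "A \<in> multilin_ops K d E F"
  shows "0 \<le> multilin_norm d E F A"
proof -
  have "0 \<le> vnorm F (A zero_tuple)" using multilin_ops_closed[OF A zero_tuple] by simp
  also have "\<dots> \<le> multilin_norm d E F A"
    by (intro multilin_norm_upper[OF A zero_tuple]) (auto simp: zero_tuple_def E_zero)
  finally show ?thesis .
qed

end

section \<open>Closed multilinear maps are bounded\<close>

text \<open>
  This combines the closed graph theorem and the uniform boundedness principle; their common proof
  applies Baire's theorem to the sets of all \<open>x\<close> with \<open>\<parallel>T x\<parallel> \<le> n\<close> for all members \<open>T\<close> of the family.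
\<close>

theorem uniform_boundedness_closed_graph:
  fixes E :: "(complex, 'b) normed_module" and W :: "(complex, 'c) normed_module"
  assumes K: "K = \<real> \<or> K = UNIV" and E: "banach_space K E" and W: "banach_space K W"
    and lin: "\<And>T. T \<in> \<T> \<Longrightarrow> linear_on K E W T"
    and closed: "\<And>T x l w. T \<in> \<T> \<Longrightarrow> vconv E x l \<Longrightarrow> vconv W (\<lambda>n. T (x n)) w \<Longrightarrow> T l = w"
    and pointwise: "\<And>x. x \<in> carrier E \<Longrightarrow> \<exists>C. \<forall>T\<in>\<T>. vnorm W (T x) \<le> C"
  shows "\<exists>C. \<forall>T\<in>\<T>. \<forall>x\<in>carrier E. vnorm W (T x) \<le> C * vnorm E x"
proof -
  interpret normed_pair K E W
    using banach_space_normed_mod[OF K E] banach_space_normed_mod[OF K W] by (simp add: normed_pair_def)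
  have T_in: "T x \<in> carrier W" if "T \<in> \<T>" "x \<in> carrier E" for T x
    using linear_on_closed[OF lin] that by blast
  define A where "A c = {x \<in> carrier E. \<forall>T\<in>\<T>. vnorm W (T x) \<le> c}" for c :: real
  have A_minus: "x \<ominus>\<^bsub>E\<^esub> y \<in> A (b + c)" if "x \<in> A b" "y \<in> A c" for x y b c
  proof -
    have "vnorm W (T (x \<ominus>\<^bsub>E\<^esub> y)) \<le> b + c" if T: "T \<in> \<T>" for T
    proof -
      have xy: "x \<in> carrier E" "y \<in> carrier E" using \<open>x \<in> A b\<close> \<open>y \<in> A c\<close> by (auto simp: A_def)
      have "vnorm W (T (x \<ominus>\<^bsub>E\<^esub> y)) \<le> vnorm W (T x) + vnorm W (T y)"
        using linear_on_minus[OF lin[OF T] xy] F.vnorm_minus_le[of "T x" "T y"] T_in[OF T] xy by simp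
      also have "\<dots> \<le> b + c" using \<open>x \<in> A b\<close> \<open>y \<in> A c\<close> T by (intro add_mono) (auto simp: A_def)
      finally show ?thesis .
    qed
    then show ?thesis using that by (auto simp: A_def)
  qed
  let ?cl = "\<lambda>c. norm_topology E closure_of A c"
  \<comment> \<open>Pointwise boundedness makes the sets \<open>A n\<close> cover the space, so
    their countably many closures cannot all have empty interior.\<close>
  have "\<exists>n::nat. norm_topology E interior_of ?cl (real n) \<noteq> {}"
  proof (rule ccontr)
    assume "\<not> ?thesis"
    then have "norm_topology E interior_of (\<Union>n::nat. ?cl (real n)) = {}"
      by (intro E.metric.metric_Baire_category_alt[OF banach_space.complete[OF E]]) auto
    moreover have "(\<Union>n::nat. ?cl (real n)) = carrier E"
    proof
      show "(\<Union>n::nat. ?cl (real n)) \<subseteq> carrier E"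
        using closure_of_subset_topspace[of "norm_topology E"] by fastforce
      show "carrier E \<subseteq> (\<Union>n::nat. ?cl (real n))"
      proof
        fix x assume x: "x \<in> carrier E"
        then obtain C where C: "\<forall>T\<in>\<T>. vnorm W (T x) \<le> C" using pointwise by blast
        obtain n :: nat where "C \<le> real n" using real_arch_simple by blast
        then have "x \<in> A (real n)" using C x by (force simp: A_def)
        moreover have "A (real n) \<subseteq> ?cl (real n)"
          by (rule closure_of_subset) (auto simp: A_def)
        ultimately show "x \<in> (\<Union>n::nat. ?cl (real n))" by blast
      qed
    qed
    ultimately show False
      using interior_of_topspace[of "norm_topology E"] E.M.zero_closed
      by (metis E.metric.topspace_mtopology empty_iff)
  qed
  then obtain n :: nat and a where "a \<in> norm_topology E interior_of ?cl (real n)" by blast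
  moreover define N where "N = real n"
  moreover have "openin (norm_topology E) (norm_topology E interior_of ?cl (real n))" by simp
  ultimately obtain \<delta> where \<delta>: "0 < \<delta>" and a: "a \<in> carrier E"
    and ball: "E.metric.mball a \<delta> \<subseteq> norm_topology E interior_of ?cl N"
    unfolding E.metric.openin_mtopology by blast
  have ball_cl: "x \<in> ?cl N" if "x \<in> carrier E" "vnorm E (x \<ominus>\<^bsub>E\<^esub> a) < \<delta>" for x
  proof -
    have "x \<in> E.metric.mball a \<delta>"
      using that a E.vnorm_minus_commute[of x a] by (simp add: norm_dist_def)
    then show ?thesis using ball interior_of_subset[of "norm_topology E" "?cl N"] by blast
  qed
  have cl: "\<exists>y\<in>A N. vnorm E (x \<ominus>\<^bsub>E\<^esub> y) < e" if x: "x \<in> ?cl N" and e: "0 < e" for x e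
  proof -
    obtain y where "y \<in> A N" "y \<in> E.metric.mball x e"
      using x e unfolding E.metric.metric_closure_of by blast
    then show ?thesis by (auto simp: norm_dist_def intro!: bexI[of _ y])
  qed
  \<comment> \<open>Writing \<open>z\<close> as \<open>z + a\<close> minus \<open>a\<close> moves
    the ball from \<open>a\<close> to 0 at the price of doubling \<open>N\<close>. Members of
    \<open>A (2 * N)\<close> only approximate \<open>z\<close>: with \<open>T\<close> not known to
    be continuous, the bound does not yet pass to \<open>z\<close> itself.\<close>
  have approx: "\<exists>w\<in>A (2 * N). vnorm E (z \<ominus>\<^bsub>E\<^esub> w) < e"
    if z: "z \<in> carrier E" "vnorm E z < \<delta>" and e: "0 < e" for z e
  proof -
    have "z \<oplus>\<^bsub>E\<^esub> a \<in> ?cl N" "a \<in> ?cl N" using z a \<delta> by (auto intro!: ball_cl)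
    then obtain y y' where y: "y \<in> A N" "vnorm E ((z \<oplus>\<^bsub>E\<^esub> a) \<ominus>\<^bsub>E\<^esub> y) < e / 2"
      and y': "y' \<in> A N" "vnorm E (a \<ominus>\<^bsub>E\<^esub> y') < e / 2"
      using cl e by (metis half_gt_zero)
    have yE: "y \<in> carrier E" "y' \<in> carrier E" using y y' by (auto simp: A_def)
    have "z \<ominus>\<^bsub>E\<^esub> (y \<ominus>\<^bsub>E\<^esub> y') = ((z \<oplus>\<^bsub>E\<^esub> a) \<ominus>\<^bsub>E\<^esub> y) \<ominus>\<^bsub>E\<^esub> (a \<ominus>\<^bsub>E\<^esub> y')"
      using yE z(1) a by (simp add: E.minus_minus_interchange[of "z \<oplus>\<^bsub>E\<^esub> a"])
    then have "vnorm E (z \<ominus>\<^bsub>E\<^esub> (y \<ominus>\<^bsub>E\<^esub> y')) < e"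
      using E.vnorm_minus_le[of "(z \<oplus>\<^bsub>E\<^esub> a) \<ominus>\<^bsub>E\<^esub> y" "a \<ominus>\<^bsub>E\<^esub> y'"] y(2) y'(2) yE z(1) a by simp
    moreover have "y \<ominus>\<^bsub>E\<^esub> y' \<in> A (2 * N)" using A_minus[OF y(1) y'(1)] by simp
    ultimately show ?thesis by blast
  qed
  \<comment> \<open>Homogeneity carries the approximation to every ball of radius
    \<open>\<delta> * c\<close>; the remainder then lies in a ball half as large, so the step can be
    repeated.\<close>
  have approx_scaled: "\<exists>w\<in>A (2 * N * c). vnorm E (z \<ominus>\<^bsub>E\<^esub> w) < \<delta> * c / 2"
    if z: "z \<in> carrier E" "vnorm E z < \<delta> * c" and c: "0 < c" for z c
  proof -
    let ?z = "complex_of_real (1 / c) \<odot>\<^bsub>E\<^esub> z"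
    have "vnorm E ?z = vnorm E z / c"
      using E.vnorm_smult[OF E.K_real z(1), of "1 / c"] c by (simp del: of_real_divide)
    then have "vnorm E ?z < \<delta>"
      using z(2) c by (simp add: pos_divide_less_eq)
    then obtain w where w: "w \<in> A (2 * N)" "vnorm E (?z \<ominus>\<^bsub>E\<^esub> w) < \<delta> / 2"
      using approx[of ?z "\<delta> / 2"] E.smult_in[OF E.K_real z(1)] half_gt_zero[OF \<delta>] by blast
    let ?w = "complex_of_real c \<odot>\<^bsub>E\<^esub> w"
    have wE: "w \<in> carrier E" using w by (simp add: A_def)
    have "z = complex_of_real c \<odot>\<^bsub>E\<^esub> ?z"
      using c z(1) by (simp flip: E.mult_smult of_real_mult del: of_real_divide)
    then have "z \<ominus>\<^bsub>E\<^esub> ?w = complex_of_real c \<odot>\<^bsub>E\<^esub> (?z \<ominus>\<^bsub>E\<^esub> w)"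
      using wE E.smult_in[OF E.K_real z(1)] by (metis E.K_real E.smult_minus)
    then have "vnorm E (z \<ominus>\<^bsub>E\<^esub> ?w) = c * vnorm E (?z \<ominus>\<^bsub>E\<^esub> w)"
      using wE E.smult_in[OF E.K_real z(1), of "1 / c"] c by (simp add: E.vnorm_smult del: of_real_divide)
    also have "\<dots> < c * (\<delta> / 2)" using w(2) c by (intro mult_strict_left_mono)
    finally have "vnorm E (z \<ominus>\<^bsub>E\<^esub> ?w) < \<delta> * c / 2" by (simp add: mult.commute)
    moreover have "vnorm W (T ?w) \<le> 2 * N * c" if T: "T \<in> \<T>" for T
    proof -
      have "vnorm W (T ?w) = c * vnorm W (T w)"
        using linear_on_smult[OF lin[OF T] E.K_real wE, of c] T_in[OF T wE] c by (simp add: F.vnorm_smult)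
      also have "\<dots> \<le> c * (2 * N)" using w(1) T c by (intro mult_left_mono) (auto simp: A_def)
      finally show ?thesis by (simp add: mult.commute)
    qed
    then have "?w \<in> A (2 * N * c)" using wE by (simp add: A_def)
    ultimately show ?thesis by blast
  qed
  \<comment> \<open>Successive approximation as in the open mapping theorem. The corrections are
    bounded under \<open>T\<close> by \<open>2 * N\<close> times powers of 1/2, which sum to
    \<open>4 * N\<close>; starting within \<open>\<delta> / 2\<close> gives the strict bound
    \<open>\<delta>\<close> needed for the first step.\<close>
  have bound: "vnorm W (T z) \<le> 4 * N" if T: "T \<in> \<T>" and z: "z \<in> carrier E" "vnorm E z \<le> \<delta> / 2" for T z
  proof -
    obtain f where f: "\<And>z c. z \<in> carrier E \<Longrightarrow> vnorm E z < \<delta> * c \<Longrightarrow> 0 < c \<Longrightarrow>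
        f z c \<in> A (2 * N * c) \<and> vnorm E (z \<ominus>\<^bsub>E\<^esub> f z c) < \<delta> * c / 2"
      using approx_scaled by metis
    \<comment> \<open>\<open>zs m\<close> is what remains of \<open>z\<close> after \<open>m\<close>
      corrections, of norm below \<open>\<delta> * (1/2) ^ m\<close>; the partial sums of the
      corrections are the \<open>s m\<close> below.\<close>
    define zs where "zs = rec_nat z (\<lambda>m y. y \<ominus>\<^bsub>E\<^esub> f y ((1/2) ^ m))"
    have zs_0: "zs 0 = z" and zs_Suc: "zs (Suc m) = zs m \<ominus>\<^bsub>E\<^esub> f (zs m) ((1/2) ^ m)" for m
      by (simp_all add: zs_def)
    have zs: "zs m \<in> carrier E \<and> vnorm E (zs m) < \<delta> * (1/2) ^ m" for m
    proof (induction m)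
      case (Suc m)
      then show ?case using f[of "zs m" "(1/2) ^ m"] by (auto simp: zs_Suc A_def)
    qed (use z \<delta> in \<open>auto simp: zs_0\<close>)
    have fz: "f (zs m) ((1/2) ^ m) \<in> A (2 * N * (1/2) ^ m)" for m
      using f[of "zs m" "(1/2) ^ m"] zs[of m] by simp
    define s where "s m = z \<ominus>\<^bsub>E\<^esub> zs m" for m
    have s_in: "s m \<in> carrier E" for m using z zs by (simp add: s_def)
    have s_conv: "vconv E s z"
    proof -
      have "vnorm E (s m \<ominus>\<^bsub>E\<^esub> z) = vnorm E (zs m)" for m
        using E.vnorm_minus_commute[of "s m" z] s_in z zs by (simp add: s_def)
      moreover have "(\<lambda>m. vnorm E (zs m)) \<longlonglongrightarrow> 0"
      proof (rule tendsto_sandwich[OF _ _ tendsto_const])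
        show "(\<lambda>m. \<delta> * (1/2) ^ m) \<longlonglongrightarrow> 0"
          by (intro tendsto_mult_right_zero LIMSEQ_power_zero) simp
      qed (use zs less_imp_le in \<open>auto intro!: always_eventually\<close>)
      ultimately show ?thesis using s_in z by (auto simp: vconv_def)
    qed
    have step: "vnorm W (T (s (Suc m)) \<ominus>\<^bsub>W\<^esub> T (s m)) \<le> 2 * N * (1/2) ^ m" for m
    proof -
      let ?f = "f (zs m) ((1/2) ^ m)"
      have fE: "?f \<in> carrier E" using fz by (simp add: A_def)
      have "s (Suc m) \<ominus>\<^bsub>E\<^esub> s m = ?f"
        using fE zs[of m] z(1)
        by (simp add: s_def zs_Suc E.minus_minus_cancel_left)
      then have "T (s (Suc m)) \<ominus>\<^bsub>W\<^esub> T (s m) = T ?f"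
        using linear_on_minus[OF lin[OF T] s_in s_in] by metis
      then show ?thesis using fz T by (simp add: A_def)
    qed
    \<comment> \<open>The geometric sum of the steps is kept in closed form, which makes the
      induction on \<open>p\<close> exact.\<close>
    have diff: "vnorm W (T (s (m + p)) \<ominus>\<^bsub>W\<^esub> T (s m)) \<le> 4 * N * ((1/2) ^ m - (1/2) ^ (m + p))" for m p
    proof (induction p)
      case (Suc p)
      have "vnorm W (T (s (m + Suc p)) \<ominus>\<^bsub>W\<^esub> T (s m))
          \<le> 2 * N * (1/2) ^ (m + p) + 4 * N * ((1/2) ^ m - (1/2) ^ (m + p))"
        using F.vnorm_minus_triangle[of "T (s (m + Suc p))" "T (s (m + p))" "T (s m)"]
          step[of "m + p"] Suc T_in[OF T s_in] by simp
      also have "\<dots> = 4 * N * ((1/2) ^ m - (1/2) ^ (m + Suc p))" by (simp add: algebra_simps)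
      finally show ?case .
    qed (use T_in[OF T s_in] in simp)
    have N: "0 \<le> N" by (simp add: N_def)
    have diff': "vnorm W (T (s (m + p)) \<ominus>\<^bsub>W\<^esub> T (s m)) \<le> 4 * N * (1/2) ^ m" for m p
      using N by (intro order_trans[OF diff] mult_left_mono) auto
    have "vcauchy W (\<lambda>m. T (s m))"
      unfolding vcauchy_def
    proof (intro conjI allI impI)
      fix e :: real assume e: "0 < e"
      have "(\<lambda>m. 4 * N * (1/2) ^ m) \<longlonglongrightarrow> 0"
        by (intro tendsto_mult_right_zero LIMSEQ_power_zero) simp
      then obtain M where M: "4 * N * (1/2) ^ M < e / 2"
        using order_tendstoD(2)[of _ 0 sequentially "e / 2"] e
        by (metis (no_types, lifting) eventually_sequentially half_gt_zero order_refl)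
      have "vnorm W (T (s m) \<ominus>\<^bsub>W\<^esub> T (s M)) < e / 2" if "M \<le> m" for m
        using diff'[of M "m - M"] M that by simp
      then have "vnorm W (T (s m) \<ominus>\<^bsub>W\<^esub> T (s n)) < e" if "M \<le> m" "M \<le> n" for m n
        using F.vnorm_minus_triangle[of "T (s m)" "T (s M)" "T (s n)"]
          F.vnorm_minus_commute[of "T (s M)" "T (s n)"] T_in[OF T s_in] that
        by (smt (verit) field_sum_of_halves)
      then show "\<exists>M. \<forall>m n. M \<le> m \<longrightarrow> M \<le> n \<longrightarrow> vnorm W (T (s m) \<ominus>\<^bsub>W\<^esub> T (s n)) < e" by blast
    qed (use T_in[OF T s_in] in auto)
    then obtain w where w: "vconv W (\<lambda>m. T (s m)) w"
      using banach_space_vcauchy_vconv[OF K W] by blast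
    have "s 0 = \<zero>\<^bsub>E\<^esub>" using z by (simp add: s_def zs_0)
    then have "T (s 0) = \<zero>\<^bsub>W\<^esub>" using linear_on_zero[OF lin[OF T]] by simp
    then have "vnorm W (T (s m)) \<le> 4 * N" for m
      using diff'[of 0 m] T_in[OF T s_in] by simp
    then have "vnorm W w \<le> 4 * N" using F.vconv_vnorm_le0[OF w] by simp
    \<comment> \<open>Here the closed graph replaces continuity: \<open>s\<close> tends to
      \<open>z\<close> and its images tend to \<open>w\<close>, so \<open>T z\<close> is
      \<open>w\<close> and inherits its bound.\<close>
    then show ?thesis using closed[OF T s_conv w] by simp
  qed
  have "\<forall>T\<in>\<T>. \<forall>x\<in>carrier E. vnorm W (T x) \<le> 4 * N / (\<delta> / 2) * vnorm E x"
    using linear_on_bound_scale[OF lin, of _ "\<delta> / 2" "4 * N"] bound \<delta> by simp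
  then show ?thesis by blast
qed

text \<open>Slots are released one at a time. For a fixed value \<open>z\<close> of a new slot
  \<open>r\<close>, the induction hypothesis bounds the family of maps indexed by the slots released
  before; the preceding theorem makes this bound uniform in \<open>z\<close>.\<close>

theorem multilinear_on_closed_bounded:
  assumes K: "K = \<real> \<or> K = UNIV" and d: "1 \<le> d"
    and ban: "\<And>r. r \<in> {1..d} \<Longrightarrow> banach_space K (E r)" and W: "banach_space K W"
    and A: "multilinear_on K d E W A"
    and closed: "\<And>r x z l w. r \<in> {1..d} \<Longrightarrow> x \<in> tuples d E \<Longrightarrow> vconv (E r) z l \<Longrightarrow>
      vconv W (\<lambda>n. A (x(r := z n))) w \<Longrightarrow> A (x(r := l)) = w"
  shows "\<exists>C. \<forall>x\<in>tuples d E. vnorm W (A x) \<le> C * (\<Prod>r = 1..d. vnorm (E r) (x r))"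
proof -
  interpret normed_mods K d E W
    using d banach_space_normed_mod[OF K ban] banach_space_normed_mod[OF K W] by (simp add: normed_mods_def)
  \<comment> \<open>Slots in \<open>S\<close> run through the unit ball, the remaining ones stay at
    their values in \<open>x\<close>.\<close>
  define Q where "Q S x = {y \<in> tuples d E. (\<forall>q\<in>S. vnorm (E q) (y q) \<le> 1) \<and> (\<forall>q\<in>{1..d} - S. y q = x q)}" for S x
  have "\<exists>C. \<forall>y\<in>Q S x. vnorm W (A y) \<le> C" if "finite S" "S \<subseteq> {1..d}" "x \<in> tuples d E" for S x
    using that
  proof (induction S arbitrary: x)
    case empty
    have "Q {} x \<subseteq> {x}" using empty tuples_ext by (force simp: Q_def)
    then show ?case by blast
  next
    case (insert r S)
    have r: "r \<in> {1..d}" using insert by simp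
    have x: "x \<in> tuples d E" by fact
    have "\<exists>C. \<forall>T\<in>(\<lambda>y z. A (y(r := z))) ` Q S x. \<forall>z\<in>carrier (E r). vnorm W (T z) \<le> C * vnorm (E r) z"
    proof (rule uniform_boundedness_closed_graph[OF K ban[OF r] W])
      fix T assume "T \<in> (\<lambda>y z. A (y(r := z))) ` Q S x"
      then obtain y where y: "y \<in> tuples d E" "T = (\<lambda>z. A (y(r := z)))" by (auto simp: Q_def)
      show "linear_on K (E r) W T" using multilinear_on_linear_on[OF A r y(1)] y(2) by simp
      show "T l = w" if "vconv (E r) z l" "vconv W (\<lambda>n. T (z n)) w" for z l w
        using closed[OF r y(1)] that y(2) by simp
    next
      fix z assume z: "z \<in> carrier (E r)"
      then obtain C where C: "\<forall>y\<in>Q S (x(r := z)). vnorm W (A y) \<le> C"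
        using insert.IH[of "x(r := z)"] insert.prems r by blast
      have "y(r := z) \<in> Q S (x(r := z))" if "y \<in> Q S x" for y
        using that r z insert.hyps(2) by (auto simp: Q_def)
      then show "\<exists>C. \<forall>T\<in>(\<lambda>y z. A (y(r := z))) ` Q S x. vnorm W (T z) \<le> C" using C by blast
    qed
    then obtain C where C: "\<And>y z. y \<in> Q S x \<Longrightarrow> z \<in> carrier (E r) \<Longrightarrow>
        vnorm W (A (y(r := z))) \<le> C * vnorm (E r) z"
      unfolding ball_simps by meson
    have "vnorm W (A y) \<le> \<bar>C\<bar>" if y: "y \<in> Q (insert r S) x" for y
    proof -
      have yr: "y r \<in> carrier (E r)" "vnorm (E r) (y r) \<le> 1" "0 \<le> vnorm (E r) (y r)"
        using y r tuples_mem tuples_vnorm_nonneg by (auto simp: Q_def)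
      \<comment> \<open>Resetting slot \<open>r\<close> puts \<open>y\<close> into the index set of
        the family; the map belonging to that index takes the value \<open>A y\<close> at
        \<open>y r\<close>.\<close>
      have "y(r := x r) \<in> Q S x"
        using y r tuples_mem[OF x r] insert.hyps(2) by (auto simp: Q_def)
      then have "vnorm W (A y) \<le> C * vnorm (E r) (y r)" using C[of "y(r := x r)" "y r"] yr by simp
      also have "\<dots> \<le> \<bar>C\<bar> * 1" using yr by (intro mult_mono) auto
      finally show ?thesis by simp
    qed
    then show ?case by blast
  qed
  from this[of "{1..d}" zero_tuple] obtain C where C: "\<forall>y\<in>Q {1..d} zero_tuple. vnorm W (A y) \<le> C"
    using zero_tuple by auto
  have "\<forall>x\<in>tuples d E. vnorm W (A x) \<le> C / 1 ^ d * (\<Prod>r = 1..d. vnorm (E r) (x r))"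
    using C by (intro ballI multilinear_on_bound_scale[OF A]) (auto simp: Q_def)
  then show ?thesis by blast
qed

section \<open>Sequence classes and iterated sequences\<close>

lemma scalar_space_simps [simp]:
  "carrier (scalar_space K) = Scal ` K" "zero (scalar_space K) = Scal 0"
  "vnorm (scalar_space K) x = cmod (scal x)"
  "x \<oplus>\<^bsub>scalar_space K\<^esub> y = Scal (scal x + scal y)"
  "a \<odot>\<^bsub>scalar_space K\<^esub> x = Scal (a * scal x)"
  by (simp_all add: scalar_space_def)

lemma normed_mod_scalar_space:
  assumes K: "K = \<real> \<or> K = UNIV"
  shows "normed_mod K (scalar_space K)"
proof -
  have "abelian_group (scalar_space K)"
  proof (rule abelian_groupI)
    fix x assume "x \<in> carrier (scalar_space K)"
    then show "\<exists>y\<in>carrier (scalar_space K). y \<oplus>\<^bsub>scalar_space K\<^esub> x = \<zero>\<^bsub>scalar_space K\<^esub>"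
      using K by (intro bexI[of _ "Scal (- scal x)"]) auto
  qed (use K in auto)
  then have "Module.module (scalar_ring K) (scalar_space K)"
    using K by (intro moduleI cring_scalar_ring) (auto simp: algebra_simps)
  then interpret Module.module "scalar_ring K" "scalar_space K" .
  show ?thesis
    by unfold_locales (use K in \<open>auto simp: norm_mult norm_triangle_ineq\<close>)
qed

lemma banach_space_scalar_space:
  assumes K: "K = \<real> \<or> K = UNIV"
  shows "banach_space K (scalar_space K)"
proof -
  interpret normed_mod K "scalar_space K" using K by (rule normed_mod_scalar_space)
  show ?thesis
  proof (rule banach_spaceI)
    fix x :: "nat \<Rightarrow> 'a univ" assume x: "vcauchy (scalar_space K) x"
    then have x_in: "x n \<in> Scal ` K" for n by (auto simp: vcauchy_def)
    have diff: "vnorm (scalar_space K) (y \<ominus>\<^bsub>scalar_space K\<^esub> z) = cmod (scal y - scal z)"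
      if "y \<in> Scal ` K" "z \<in> Scal ` K" for y z :: "'a univ"
      using that by (subst minus_eq_add_smult) auto
    have "Cauchy (\<lambda>n. scal (x n))"
      unfolding Cauchy_def dist_norm
    proof (intro allI impI)
      fix e :: real assume "0 < e"
      then obtain N where "\<And>m n. N \<le> m \<Longrightarrow> N \<le> n \<Longrightarrow>
          vnorm (scalar_space K) (x m \<ominus>\<^bsub>scalar_space K\<^esub> x n) < e"
        using x unfolding vcauchy_def by blast
      then show "\<exists>M. \<forall>m\<ge>M. \<forall>n\<ge>M. cmod (scal (x m) - scal (x n)) < e"
        using diff[OF x_in x_in] by auto
    qed
    then obtain l where l: "(\<lambda>n. scal (x n)) \<longlonglongrightarrow> l"
      using Cauchy_convergent_iff convergent_def by blast
    have "closed K" using K closed_complex_Reals by auto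
    moreover have "scal (x n) \<in> K" for n using x_in[of n] by auto
    ultimately have "l \<in> K" using closed_sequentially[OF _ _ l] by blast
    moreover have "(\<lambda>n. cmod (scal (x n) - l)) \<longlonglongrightarrow> 0"
      using l by (simp add: LIM_zero_iff tendsto_norm_zero)
    ultimately have "vconv (scalar_space K) x (Scal l)"
      using x_in diff[OF x_in, of "Scal l"] by (auto simp: vconv_def)
    then show "\<exists>l. vconv (scalar_space K) x l" ..
  qed
qed

text \<open>The operator from the scalar field sending 1 to \<open>x\<close>. Through linear
  stability it carries scalar sequences to sequences of multiples of \<open>x\<close>.\<close>

definition scalar_op :: "complex set \<Rightarrow> 'a bspace \<Rightarrow> 'a univ \<Rightarrow> 'a univ \<Rightarrow> 'a univ" where
  "scalar_op K E x = (\<lambda>a\<in>carrier (scalar_space K). scal a \<odot>\<^bsub>E\<^esub> x)"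

lemma scalar_op:
  assumes E: "normed_mod K E" and x: "x \<in> carrier E"
  shows "scalar_op K E x \<in> lin_ops K (scalar_space K) E"
    and "lin_norm (scalar_space K) E (scalar_op K E x) \<le> vnorm E x"
proof -
  interpret normed_mod K E by fact
  interpret S: normed_mod K "scalar_space K" using field_K by (rule normed_mod_scalar_space)
  have le: "vnorm E (scalar_op K E x a) \<le> vnorm E x * vnorm (scalar_space K) a"
    if "a \<in> carrier (scalar_space K)" for a
    using that x by (auto simp: scalar_op_def vnorm_smult)
  have "linear_on K (scalar_space K) E (scalar_op K E x)"
    using x by (auto simp: linear_on_def scalar_op_def add_smult mult_smult)
  then show "scalar_op K E x \<in> lin_ops K (scalar_space K) E"
    using le unfolding lin_ops_iff[OF S.normed_mod_axioms E]
    by (intro conjI exI[of _ "vnorm E x"]) (auto simp: scalar_op_def)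
  show "lin_norm (scalar_space K) E (scalar_op K E x) \<le> vnorm E x"
    using le x by (intro lin_norm_le[OF S.normed_mod_axioms]) auto
qed

context
  fixes K :: "complex set" and X :: "'a bspace \<Rightarrow> 'a bspace" and E :: "'a bspace"
  assumes K: "K = \<real> \<or> K = UNIV" and X: "sequence_class K X" and E: "banach_space K E"
begin

lemma sequence_class_banach_space: "banach_space K (X E)"
  using X E by (simp add: sequence_class_def)

interpretation E: normed_mod K E by (rule banach_space_normed_mod[OF K E])

interpretation XE: normed_mod K "X E"
  by (rule banach_space_normed_mod[OF K sequence_class_banach_space])

text \<open>Everything comes from the contractive inclusion into the bounded sequences: an element
  has the form \<open>Seq x\<close>, and the supremum of the norms of its coordinates is at most its
  norm.\<close>

lemma sequence_class_coord:
  assumes z: "z \<in> carrier (X E)"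
  shows "Seq (coord z) = z" "coord z n \<in> carrier E" "vnorm E (coord z n) \<le> vnorm (X E) z"
proof -
  have "carrier (X E) \<subseteq> Seq ` linfty E" using X E by (simp add: sequence_class_def)
  then obtain x where x: "z = Seq x" "x \<in> linfty E" using z by blast
  then show "Seq (coord z) = z" "coord z n \<in> carrier E" by (auto simp: linfty_def seqs_def)
  have "vnorm E (x n) \<le> linfty_norm E x"
    using x by (auto simp: linfty_norm_def linfty_def intro: cSUP_upper)
  also have "\<dots> \<le> vnorm (X E) (Seq x)"
    using X E x z by (auto simp: sequence_class_def)
  finally show "vnorm E (coord z n) \<le> vnorm (X E) z" using x by simp
qed

lemma sequence_class_coord_linear_on: "linear_on K (X E) E (\<lambda>z. coord z n)"
proof -
  have "coord (a \<oplus>\<^bsub>X E\<^esub> b) n = coord a n \<oplus>\<^bsub>E\<^esub> coord b n"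
    if ab: "a \<in> carrier (X E)" "b \<in> carrier (X E)" for a b
  proof -
    have "\<forall>x y. Seq x \<in> carrier (X E) \<longrightarrow> Seq y \<in> carrier (X E) \<longrightarrow>
        Seq x \<oplus>\<^bsub>X E\<^esub> Seq y = Seq (\<lambda>n. x n \<oplus>\<^bsub>E\<^esub> y n)"
      using X E by (simp add: sequence_class_def)
    from this[rule_format, of "coord a" "coord b"] show ?thesis
      using ab by (simp add: sequence_class_coord(1))
  qed
  moreover have "coord (c \<odot>\<^bsub>X E\<^esub> a) n = c \<odot>\<^bsub>E\<^esub> coord a n" if ca: "c \<in> K" "a \<in> carrier (X E)" for a c
  proof -
    have "\<forall>c\<in>K. \<forall>x. Seq x \<in> carrier (X E) \<longrightarrow> c \<odot>\<^bsub>X E\<^esub> Seq x = Seq (\<lambda>n. c \<odot>\<^bsub>E\<^esub> x n)"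
      using X E by (simp add: sequence_class_def)
    from this[rule_format, of c "coord a"] show ?thesis
      using ca by (simp add: sequence_class_coord(1))
  qed
  ultimately show ?thesis using sequence_class_coord(2) by (auto simp: linear_on_def)
qed

text \<open>The axioms normalise only scalar unit sequences. Linear stability under
  \<open>scalar_op K E x\<close>, whose norm is at most that of \<open>x\<close>, transfers the
  bound to vectors.\<close>

lemma sequence_class_unit_seq:
  fixes i :: nat
  assumes stable: "linearly_stable K X" and x: "x \<in> carrier E"
  defines "z \<equiv> Seq (\<lambda>n. if n = i then x else \<zero>\<^bsub>E\<^esub>)"
  shows "z \<in> carrier (X E)" "vnorm (X E) z \<le> vnorm E x"
proof -
  let ?e = "\<lambda>n. Scal (if n = i then 1 else 0) :: 'a univ"
  have S: "banach_space K (scalar_space K :: 'a bspace)" using K by (rule banach_space_scalar_space)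
  have "?e \<in> c00 (scalar_space K)"
    by (auto simp: c00_def seqs_def eventually_sequentially intro!: exI[of _ "Suc i"])
  moreover have "Seq ` c00 (scalar_space K) \<subseteq> carrier (X (scalar_space K))"
    using X S by (simp add: sequence_class_def)
  ultimately have e: "Seq ?e \<in> carrier (X (scalar_space K))" by blast
  have e1: "vnorm (X (scalar_space K)) (Seq ?e) = 1"
    using X by (simp add: sequence_class_def)
  let ?u = "scalar_op K E x"
  note u = scalar_op[OF E.normed_mod_axioms x]
  have z: "Seq (\<lambda>n. ?u (?e n)) = z"
    using x by (auto simp: z_def scalar_op_def intro!: ext)
  have "Seq (\<lambda>n. ?u (?e n)) \<in> carrier (X E) \<and>
      vnorm (X E) (Seq (\<lambda>n. ?u (?e n))) \<le> lin_norm (scalar_space K) E ?u * vnorm (X (scalar_space K)) (Seq ?e)"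
    using stable S E u(1) e unfolding linearly_stable_def by blast
  then show "z \<in> carrier (X E)" "vnorm (X E) z \<le> vnorm E x" unfolding z using u(2) e1 by auto
qed

end

text \<open>The action of a sequence class on operators, restricted to the carrier because operators
  are extensional.\<close>

definition seq_op :: "('a bspace \<Rightarrow> 'a bspace) \<Rightarrow> 'a bspace \<Rightarrow> ('a univ \<Rightarrow> 'a univ) \<Rightarrow> 'a univ \<Rightarrow> 'a univ" where
  "seq_op X E u = (\<lambda>z\<in>carrier (X E). Seq (\<lambda>n. u (coord z n)))"

text \<open>Linear stability supplies the values and the norm bound. Linearity is verified
  coordinatewise, as elements of \<open>X F\<close> are determined by their coordinates.\<close>

lemma seq_op:
  assumes K: "K = \<real> \<or> K = UNIV" and X: "sequence_class K X" "linearly_stable K X"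
    and E: "banach_space K E" and F: "banach_space K F" and u: "u \<in> lin_ops K E F"
  shows "seq_op X E u \<in> lin_ops K (X E) (X F)"
    and "lin_norm (X E) (X F) (seq_op X E u) \<le> lin_norm E F u"
    and "z \<in> carrier (X E) \<Longrightarrow> coord (seq_op X E u z) n = u (coord z n)"
proof -
  note nE = banach_space_normed_mod[OF K E] and nF = banach_space_normed_mod[OF K F]
  note nXE = banach_space_normed_mod[OF K sequence_class_banach_space[OF K X(1) E]]
    and nXF = banach_space_normed_mod[OF K sequence_class_banach_space[OF K X(1) F]]
  note lin = lin_ops_linear_on[OF nE nF u]
  note cE = sequence_class_coord[OF K X(1) E] and cF = sequence_class_coord[OF K X(1) F]
  interpret E: normed_mod K "X E" by (rule nXE)
  interpret F: normed_mod K "X F" by (rule nXF)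
  have st: "Seq (\<lambda>n. u (coord z n)) \<in> carrier (X F) \<and>
      vnorm (X F) (Seq (\<lambda>n. u (coord z n))) \<le> lin_norm E F u * vnorm (X E) z"
    if z: "z \<in> carrier (X E)" for z
  proof -
    have "Seq (coord z) \<in> carrier (X E)" using z cE(1)[OF z] by simp
    then have "Seq (\<lambda>n. u (coord z n)) \<in> carrier (X F) \<and>
      vnorm (X F) (Seq (\<lambda>n. u (coord z n))) \<le> lin_norm E F u * vnorm (X E) (Seq (coord z))"
      using X(2) E F u unfolding linearly_stable_def by blast
    then show ?thesis using cE(1)[OF z] by simp
  qed
  then have st': "seq_op X E u z \<in> carrier (X F)"
      "vnorm (X F) (seq_op X E u z) \<le> lin_norm E F u * vnorm (X E) z" if "z \<in> carrier (X E)" for z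
    using that by (auto simp: seq_op_def)
  show co: "coord (seq_op X E u z) n = u (coord z n)" if "z \<in> carrier (X E)" for z n
    using that by (simp add: seq_op_def)
  have eqI: "a = b"
    if ab: "a \<in> carrier (X F)" "b \<in> carrier (X F)" and eq: "\<And>n. coord a n = coord b n" for a b
  proof -
    have "Seq (coord a) = Seq (coord b)" using eq by auto
    then show ?thesis by (simp only: cF(1)[OF ab(1)] cF(1)[OF ab(2)])
  qed
  note lE = sequence_class_coord_linear_on[OF K X(1) E] and lF = sequence_class_coord_linear_on[OF K X(1) F]
  have "linear_on K (X E) (X F) (seq_op X E u)"
    unfolding linear_on_def
  proof (intro conjI ballI)
    show "seq_op X E u \<in> carrier (X E) \<rightarrow> carrier (X F)" using st' by auto
    fix x assume x: "x \<in> carrier (X E)"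
    { fix y assume y: "y \<in> carrier (X E)"
      show "seq_op X E u (x \<oplus>\<^bsub>X E\<^esub> y) = seq_op X E u x \<oplus>\<^bsub>X F\<^esub> seq_op X E u y"
      proof (rule eqI)
        fix n
        show "coord (seq_op X E u (x \<oplus>\<^bsub>X E\<^esub> y)) n = coord (seq_op X E u x \<oplus>\<^bsub>X F\<^esub> seq_op X E u y) n"
          by (simp only: co[OF E.M.a_closed[OF x y]] co[OF x] co[OF y] linear_on_add[OF lE x y]
            linear_on_add[OF lF st'(1)[OF x] st'(1)[OF y]] linear_on_add[OF lin cE(2)[OF x] cE(2)[OF y]])
      qed (use x y st'(1) in auto) }
    fix a assume a: "a \<in> K"
    show "seq_op X E u (a \<odot>\<^bsub>X E\<^esub> x) = a \<odot>\<^bsub>X F\<^esub> seq_op X E u x"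
    proof (rule eqI)
      fix n
      show "coord (seq_op X E u (a \<odot>\<^bsub>X E\<^esub> x)) n = coord (a \<odot>\<^bsub>X F\<^esub> seq_op X E u x) n"
        by (simp only: co[OF E.smult_in[OF a x]] co[OF x] linear_on_smult[OF lE a x]
          linear_on_smult[OF lF a st'(1)[OF x]] linear_on_smult[OF lin a cE(2)[OF x]])
    qed (use x a st'(1) in auto)
  qed
  then show "seq_op X E u \<in> lin_ops K (X E) (X F)"
    using st' by (auto simp: lin_ops_iff[OF nXE nXF] seq_op_def)
  show "lin_norm (X E) (X F) (seq_op X E u) \<le> lin_norm E F u"
    using st' lin_norm_nonneg[OF nE nF u] by (intro lin_norm_le[OF nXE])
qed

text \<open>Reads a nested sequence at the index tuple \<open>n\<close>, one level per list element;
  on the iterated spaces it is inverse to \<open>nested_seq\<close>.\<close>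

primrec nested_coord :: "nat list \<Rightarrow> (nat \<Rightarrow> nat) \<Rightarrow> 'a univ \<Rightarrow> 'a univ" where
  "nested_coord [] n w = w"
| "nested_coord (s # ss) n w = nested_coord ss n (coord w (n s))"

text \<open>Along the recursion only positions in \<open>ss\<close> are updated, so \<open>g\<close>
  is evaluated nowhere but at functions agreeing with \<open>m\<close> elsewhere.\<close>

lemma nested_seq_cong:
  assumes "\<And>n. (\<And>t. t \<notin> set ss \<Longrightarrow> n t = m t) \<Longrightarrow> g n = h n"
  shows "nested_seq ss g m = nested_seq ss h m"
  using assms
proof (induction ss arbitrary: m)
  case (Cons s ss)
  have "nested_seq ss g (m(s := i)) = nested_seq ss h (m(s := i))" for i
    by (rule Cons.IH) (auto intro!: Cons.prems)
  then show ?case by simp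
qed simp

lemma nested_coord_nested_seq:
  assumes "distinct ss"
  shows "nested_coord ss n (nested_seq ss g m) = g (\<lambda>t. if t \<in> set ss then n t else m t)"
  using assms
proof (induction ss arbitrary: m)
  case (Cons s ss)
  then have "nested_coord (s # ss) n (nested_seq (s # ss) g m)
      = g (\<lambda>t. if t \<in> set ss then n t else (m(s := n s)) t)"
    by simp
  also have "(\<lambda>t. if t \<in> set ss then n t else (m(s := n s)) t) = (\<lambda>t. if t \<in> set (s # ss) then n t else m t)"
    using Cons.prems by auto
  finally show ?case .
qed simp

context
  fixes K :: "complex set" and Y :: "nat \<Rightarrow> 'a bspace \<Rightarrow> 'a bspace"
  assumes K: "K = \<real> \<or> K = UNIV"
begin

lemma foldr_banach_space:
  assumes "\<And>s. s \<in> set ss \<Longrightarrow> sequence_class K (Y s)" "banach_space K F"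
  shows "banach_space K (foldr Y ss F)"
  using assms(1)
proof (induction ss)
  case (Cons s ss)
  then show ?case using sequence_class_banach_space[OF K, of "Y s" "foldr Y ss F"] by simp
qed (use assms(2) in simp)

lemma nested_coord_linear_on:
  assumes "\<And>s. s \<in> set ss \<Longrightarrow> sequence_class K (Y s)" and F: "banach_space K F"
  shows "linear_on K (foldr Y ss F) F (nested_coord ss n)"
  using assms(1)
proof (induction ss)
  case (Cons s ss)
  have s: "sequence_class K (Y s)" and W: "banach_space K (foldr Y ss F)"
    using Cons.prems foldr_banach_space[OF _ F, of ss] by auto
  have "linear_on K (foldr Y ss F) F (nested_coord ss n)" using Cons by auto
  then show ?case
    using sequence_class_coord_linear_on[OF K s W, of "n s"] by (simp add: linear_on_def Pi_iff)
qed (auto simp: linear_on_def)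

lemma vnorm_nested_coord_le:
  assumes "\<And>s. s \<in> set ss \<Longrightarrow> sequence_class K (Y s)" and F: "banach_space K F"
    and "w \<in> carrier (foldr Y ss F)"
  shows "vnorm F (nested_coord ss n w) \<le> vnorm (foldr Y ss F) w"
  using assms(1,3)
proof (induction ss arbitrary: w)
  case (Cons s ss)
  have s: "sequence_class K (Y s)" and W: "banach_space K (foldr Y ss F)"
    using Cons.prems foldr_banach_space[OF _ F, of ss] by auto
  have w: "w \<in> carrier (Y s (foldr Y ss F))" using Cons.prems by simp
  have "vnorm F (nested_coord ss n (coord w (n s))) \<le> vnorm (foldr Y ss F) (coord w (n s))"
    using Cons.prems(1) by (intro Cons.IH sequence_class_coord(2)[OF K s W w]) auto
  then show ?case using sequence_class_coord(3)[OF K s W w, of "n s"] by simp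
qed simp

lemma nested_seq_nested_coord:
  assumes "distinct ss" "\<And>s. s \<in> set ss \<Longrightarrow> sequence_class K (Y s)" and F: "banach_space K F"
    and "w \<in> carrier (foldr Y ss F)"
  shows "nested_seq ss (\<lambda>n. nested_coord ss n w) m = w"
  using assms(1,2,4)
proof (induction ss arbitrary: w m)
  case (Cons s ss)
  have s: "sequence_class K (Y s)" and W: "banach_space K (foldr Y ss F)"
    using Cons.prems foldr_banach_space[OF _ F, of ss] by auto
  have w: "w \<in> carrier (Y s (foldr Y ss F))" using Cons.prems by simp
  have "nested_seq ss (\<lambda>n. nested_coord ss n (coord w (n s))) (m(s := i)) = coord w i" for i
  proof -
    \<comment> \<open>\<open>s\<close> is absent from \<open>ss\<close>, hence \<open>n s\<close> is
      \<open>i\<close> at every index function that the recursion reaches.\<close>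
    have "nested_seq ss (\<lambda>n. nested_coord ss n (coord w (n s))) (m(s := i))
        = nested_seq ss (\<lambda>n. nested_coord ss n (coord w i)) (m(s := i))"
      by (rule nested_seq_cong) (use Cons.prems(1) in auto)
    also have "\<dots> = coord w i"
      using Cons.prems sequence_class_coord(2)[OF K s W w] by (intro Cons.IH) auto
    finally show ?thesis .
  qed
  then show ?case using sequence_class_coord(1)[OF K s W w] by simp
qed simp

text \<open>Both elements are rebuilt from their entries by \<open>nested_seq\<close>.\<close>

lemma nested_coord_ext:
  assumes "distinct ss" "\<And>s. s \<in> set ss \<Longrightarrow> sequence_class K (Y s)" "banach_space K F"
    and "v \<in> carrier (foldr Y ss F)" "w \<in> carrier (foldr Y ss F)"
    and eq: "\<And>n. nested_coord ss n v = nested_coord ss n w"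
  shows "v = w"
proof -
  have "nested_seq ss (\<lambda>n. nested_coord ss n v) m = nested_seq ss (\<lambda>n. nested_coord ss n w) m" for m
    by (simp only: eq)
  then show ?thesis
    by (simp only: nested_seq_nested_coord[OF assms(1,2,3,4)] nested_seq_nested_coord[OF assms(1,2,3,5)])
qed

text \<open>Iterating \<open>seq_op\<close> from the innermost space outwards never increases the
  norm. The lifted operator is described only by its entries, which suffices since entries determine
  elements.\<close>

lemma foldr_lift:
  assumes "\<And>s. s \<in> set ss \<Longrightarrow> sequence_class K (Y s) \<and> linearly_stable K (Y s)"
    and E: "banach_space K E" and F: "banach_space K F" and u: "u \<in> lin_ops K E F"
  shows "\<exists>v\<in>lin_ops K (foldr Y ss E) (foldr Y ss F).
    lin_norm (foldr Y ss E) (foldr Y ss F) v \<le> lin_norm E F u \<and>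
    (\<forall>w\<in>carrier (foldr Y ss E). \<forall>n. nested_coord ss n (v w) = u (nested_coord ss n w))"
  using assms(1)
proof (induction ss)
  case Nil
  then show ?case using u by (intro bexI[of _ u]) auto
next
  case (Cons s ss)
  let ?E = "foldr Y ss E" and ?F = "foldr Y ss F"
  obtain v where v: "v \<in> lin_ops K ?E ?F" "lin_norm ?E ?F v \<le> lin_norm E F u"
    "\<And>w n. w \<in> carrier ?E \<Longrightarrow> nested_coord ss n (v w) = u (nested_coord ss n w)"
    using Cons by auto
  have s: "sequence_class K (Y s)" "linearly_stable K (Y s)"
    and W: "banach_space K ?E" "banach_space K ?F"
    using Cons.prems foldr_banach_space[OF _ E, of ss] foldr_banach_space[OF _ F, of ss] by auto
  note op = seq_op[OF K s W v(1)]
  show ?case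
  proof (intro bexI[of _ "seq_op (Y s) ?E v"] conjI ballI allI)
    show "lin_norm (foldr Y (s # ss) E) (foldr Y (s # ss) F) (seq_op (Y s) ?E v) \<le> lin_norm E F u"
      using op(2) v(2) by simp
    fix w n assume "w \<in> carrier (foldr Y (s # ss) E)"
    then have w: "w \<in> carrier (Y s ?E)" by simp
    then show "nested_coord (s # ss) n (seq_op (Y s) ?E v w) = u (nested_coord (s # ss) n w)"
      using op(3)[OF w] v(3)[OF sequence_class_coord(2)[OF K s(1) W(1) w]] by simp
  qed (use op(1) in simp)
qed

end

section \<open>Spaces of multilinear operators\<close>

lemma multilin_space_simps [simp]:
  "carrier (multilin_space K d E F) = multilin_ops K d E F"
  "zero (multilin_space K d E F) = (\<lambda>x\<in>tuples d E. \<zero>\<^bsub>F\<^esub>)"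
  "A \<oplus>\<^bsub>multilin_space K d E F\<^esub> B = (\<lambda>x\<in>tuples d E. A x \<oplus>\<^bsub>F\<^esub> B x)"
  "a \<odot>\<^bsub>multilin_space K d E F\<^esub> A = (\<lambda>x\<in>tuples d E. a \<odot>\<^bsub>F\<^esub> A x)"
  by (simp_all add: multilin_space_def)

text \<open>Stated for any set of maps closed under the operations, so that it covers the full
  operator space and the summing operators alike; additive inverses are multiples by -1.\<close>

lemma module_multilin_space_carrier:
  assumes F: "normed_mod K F" and H: "H \<subseteq> tuples d E \<rightarrow>\<^sub>E carrier F"
    and zero: "(\<lambda>x\<in>tuples d E. \<zero>\<^bsub>F\<^esub>) \<in> H"
    and add: "\<And>A B. A \<in> H \<Longrightarrow> B \<in> H \<Longrightarrow> (\<lambda>x\<in>tuples d E. A x \<oplus>\<^bsub>F\<^esub> B x) \<in> H"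
    and smult: "\<And>a A. a \<in> K \<Longrightarrow> A \<in> H \<Longrightarrow> (\<lambda>x\<in>tuples d E. a \<odot>\<^bsub>F\<^esub> A x) \<in> H"
  shows "Module.module (scalar_ring K) (multilin_space K d E F\<lparr>carrier := H\<rparr>)"
proof -
  interpret F: normed_mod K F by fact
  let ?R = "multilin_space K d E F\<lparr>carrier := H\<rparr>"
  have in_F: "A x \<in> carrier F" if "A \<in> H" "x \<in> tuples d E" for A x using that H by (auto simp: PiE_iff)
  have ext: "A = B" if "A \<in> extensional (tuples d E)" "B \<in> extensional (tuples d E)"
    "\<And>x. x \<in> tuples d E \<Longrightarrow> A x = B x" for A B using that by (rule extensionalityI)
  have Hext: "A \<in> extensional (tuples d E)" if "A \<in> H" for A using that H by (auto simp: PiE_iff)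
  have "\<exists>B\<in>H. B \<oplus>\<^bsub>?R\<^esub> A = \<zero>\<^bsub>?R\<^esub>" if A: "A \<in> H" for A
  proof -
    have "(\<lambda>x\<in>tuples d E. (- 1) \<odot>\<^bsub>F\<^esub> A x) \<in> H" using smult[of "- 1" A] A by simp
    moreover have "(\<lambda>x\<in>tuples d E. (- 1) \<odot>\<^bsub>F\<^esub> A x) \<oplus>\<^bsub>?R\<^esub> A = \<zero>\<^bsub>?R\<^esub>"
      using A in_F by (intro ext) (auto simp: F.minus_one_smult F.M.l_neg)
    ultimately show ?thesis by blast
  qed
  then have "abelian_group ?R"
    using zero add in_F Hext by (intro abelian_groupI) (auto intro!: ext simp: F.M.a_ac)
  then show ?thesis
    using cring_scalar_ring[OF F.field_K] smult in_F Hext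
    by (intro moduleI) (auto intro!: ext simp: F.M.a_ac F.add_smult F.mult_smult F.smult_add)
qed

context normed_mods
begin

lemma multilin_ops_PiE: "multilin_ops K d E F \<subseteq> tuples d E \<rightarrow>\<^sub>E carrier F"
  by (auto simp: multilin_ops_def)

lemma multilin_opsI:
  assumes "A \<in> extensional (tuples d E)" "multilinear_on K d E F A"
    and "\<And>x. x \<in> tuples d E \<Longrightarrow> vnorm F (A x) \<le> C * (\<Prod>r = 1..d. vnorm (E r) (x r))"
  shows "A \<in> multilin_ops K d E F"
  using assms by (auto simp: multilin_ops_iff)

lemma E_add: "r \<in> {1..d} \<Longrightarrow> y \<in> carrier (E r) \<Longrightarrow> z \<in> carrier (E r) \<Longrightarrow> y \<oplus>\<^bsub>E r\<^esub> z \<in> carrier (E r)"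
  and E_smult: "r \<in> {1..d} \<Longrightarrow> a \<in> K \<Longrightarrow> y \<in> carrier (E r) \<Longrightarrow> a \<odot>\<^bsub>E r\<^esub> y \<in> carrier (E r)"
proof -
  assume r: "r \<in> {1..d}"
  interpret Er: normed_mod K "E r" using r by (rule E)
  show "y \<in> carrier (E r) \<Longrightarrow> z \<in> carrier (E r) \<Longrightarrow> y \<oplus>\<^bsub>E r\<^esub> z \<in> carrier (E r)"
    "a \<in> K \<Longrightarrow> y \<in> carrier (E r) \<Longrightarrow> a \<odot>\<^bsub>E r\<^esub> y \<in> carrier (E r)" by auto
qed

lemma multilin_ops_add_slot:
  assumes "A \<in> multilin_ops K d E F" "r \<in> {1..d}" "x \<in> tuples d E" "y \<in> carrier (E r)" "z \<in> carrier (E r)"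
  shows "A (x(r := y \<oplus>\<^bsub>E r\<^esub> z)) = A (x(r := y)) \<oplus>\<^bsub>F\<^esub> A (x(r := z))"
  using linear_on_add[OF multilinear_on_linear_on[OF multilin_ops_multilinear_on]] assms by blast

lemma multilin_ops_smult_slot:
  assumes "A \<in> multilin_ops K d E F" "r \<in> {1..d}" "x \<in> tuples d E" "a \<in> K" "y \<in> carrier (E r)"
  shows "A (x(r := a \<odot>\<^bsub>E r\<^esub> y)) = a \<odot>\<^bsub>F\<^esub> A (x(r := y))"
  using linear_on_smult[OF multilinear_on_linear_on[OF multilin_ops_multilinear_on]] assms by blast

lemma multilin_ops_zero: "(\<lambda>x\<in>tuples d E. \<zero>\<^bsub>F\<^esub>) \<in> multilin_ops K d E F"
  by (rule multilin_opsI[of _ 0], simp, rule multilinear_onI)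
    (auto simp: tuples_upd E_add E_smult)

lemma multilin_ops_add:
  assumes A: "A \<in> multilin_ops K d E F" and B: "B \<in> multilin_ops K d E F"
  shows "(\<lambda>x\<in>tuples d E. A x \<oplus>\<^bsub>F\<^esub> B x) \<in> multilin_ops K d E F" (is "?S \<in> _")
proof (rule multilin_opsI)
  show "multilinear_on K d E F ?S"
  proof (rule multilinear_onI)
    show "?S x \<in> carrier F" if "x \<in> tuples d E" for x
      using that A B by (simp add: multilin_ops_closed)
    fix r x y assume r: "r \<in> {1..d}" and x: "x \<in> tuples d E" and y: "y \<in> carrier (E r)"
    { fix z assume z: "z \<in> carrier (E r)"
      show "?S (x(r := y \<oplus>\<^bsub>E r\<^esub> z)) = ?S (x(r := y)) \<oplus>\<^bsub>F\<^esub> ?S (x(r := z))"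
        using r x y z A B
        by (simp add: tuples_upd E_add multilin_ops_add_slot multilin_ops_closed F.M.a_ac) }
    fix a assume a: "a \<in> K"
    show "?S (x(r := a \<odot>\<^bsub>E r\<^esub> y)) = a \<odot>\<^bsub>F\<^esub> ?S (x(r := y))"
      using r x y a A B
      by (simp add: tuples_upd E_smult multilin_ops_smult_slot multilin_ops_closed F.smult_add)
  qed
  fix x assume x: "x \<in> tuples d E"
  have "vnorm F (?S x) \<le> vnorm F (A x) + vnorm F (B x)"
    using x A B F.vnorm_triangle multilin_ops_closed by simp
  also have "\<dots> \<le> multilin_norm d E F A * (\<Prod>r = 1..d. vnorm (E r) (x r))
      + multilin_norm d E F B * (\<Prod>r = 1..d. vnorm (E r) (x r))"
    using x A B by (intro add_mono multilin_norm_vnorm_le)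
  finally show "vnorm F (?S x) \<le> (multilin_norm d E F A + multilin_norm d E F B) * (\<Prod>r = 1..d. vnorm (E r) (x r))"
    by (simp add: algebra_simps)
qed simp

lemma multilin_ops_smult:
  assumes a: "a \<in> K" and A: "A \<in> multilin_ops K d E F"
  shows "(\<lambda>x\<in>tuples d E. a \<odot>\<^bsub>F\<^esub> A x) \<in> multilin_ops K d E F" (is "?S \<in> _")
proof (rule multilin_opsI)
  show "multilinear_on K d E F ?S"
  proof (rule multilinear_onI)
    show "?S x \<in> carrier F" if "x \<in> tuples d E" for x
      using that A a by (simp add: multilin_ops_closed)
    fix r x y assume r: "r \<in> {1..d}" and x: "x \<in> tuples d E" and y: "y \<in> carrier (E r)"
    { fix z assume z: "z \<in> carrier (E r)"
      show "?S (x(r := y \<oplus>\<^bsub>E r\<^esub> z)) = ?S (x(r := y)) \<oplus>\<^bsub>F\<^esub> ?S (x(r := z))"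
        using r x y z A a
        by (simp add: tuples_upd E_add multilin_ops_add_slot multilin_ops_closed F.smult_add) }
    fix c assume c: "c \<in> K"
    show "?S (x(r := c \<odot>\<^bsub>E r\<^esub> y)) = c \<odot>\<^bsub>F\<^esub> ?S (x(r := y))"
      using r x y a c A
      by (simp add: tuples_upd E_smult multilin_ops_smult_slot multilin_ops_closed mult.commute
          flip: F.mult_smult)
  qed
  fix x assume x: "x \<in> tuples d E"
  have "vnorm F (?S x) = cmod a * vnorm F (A x)"
    using x A a F.vnorm_smult multilin_ops_closed by simp
  also have "\<dots> \<le> cmod a * (multilin_norm d E F A * (\<Prod>r = 1..d. vnorm (E r) (x r)))"
    using x A by (intro mult_left_mono multilin_norm_vnorm_le) auto
  finally show "vnorm F (?S x) \<le> cmod a * multilin_norm d E F A * (\<Prod>r = 1..d. vnorm (E r) (x r))"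
    by (simp add: algebra_simps)
qed simp

lemma module_multilin_space: "Module.module (scalar_ring K) (multilin_space K d E F)"
proof -
  have "multilin_space K d E F = multilin_space K d E F\<lparr>carrier := multilin_ops K d E F\<rparr>"
    by (simp add: multilin_space_def)
  moreover have "Module.module (scalar_ring K) (multilin_space K d E F\<lparr>carrier := multilin_ops K d E F\<rparr>)"
    by (rule module_multilin_space_carrier[OF F multilin_ops_PiE multilin_ops_zero
          multilin_ops_add multilin_ops_smult])
  ultimately show ?thesis by metis
qed

text \<open>The bound in the form of a constant times \<open>vnorm (E r) y\<close>, as required to
  pass to limits in a single slot.\<close>

lemma multilin_ops_slot_bounded:
  assumes A: "A \<in> multilin_ops K d E F" and r: "r \<in> {1..d}" and x: "x \<in> tuples d E"
    and y: "y \<in> carrier (E r)"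
  shows "vnorm F (A (x(r := y)))
    \<le> multilin_norm d E F A * (\<Prod>q\<in>{1..d} - {r}. vnorm (E q) (x q)) * vnorm (E r) y"
proof -
  have "vnorm F (A (x(r := y))) \<le> multilin_norm d E F A * (\<Prod>q = 1..d. vnorm (E q) ((x(r := y)) q))"
    using x r y by (intro multilin_norm_vnorm_le[OF A]) auto
  also have "(\<Prod>q = 1..d. vnorm (E q) ((x(r := y)) q))
      = vnorm (E r) y * (\<Prod>q\<in>{1..d} - {r}. vnorm (E q) (x q))"
    using r by (subst prod.remove[of _ r]) auto
  finally show ?thesis by (simp only: mult_ac)
qed

end

section \<open>The induced map\<close>

text \<open>Bridges two ways of multiplying: compatibility groups the factors by blocks, the scalar
  product operator runs through all slots.\<close>

lemma block_prod:
  fixes f :: "nat \<Rightarrow> 'b :: comm_monoid_mult"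
  assumes "block_partition d k I"
  shows "(\<Prod>s = 1..k. \<Prod>r\<in>I s. f r) = (\<Prod>r = 1..d. f r)"
proof -
  have "finite (I s)" if "s \<in> {1..k}" for s
    using assms that by (intro finite_subset[of "I s" "{1..d}"]) (auto simp: block_partition_def)
  then have "(\<Prod>r\<in>(\<Union>s\<in>{1..k}. I s). f r) = (\<Prod>s = 1..k. \<Prod>r\<in>I s. f r)"
    using assms
    by (intro prod.UNION_disjoint) (auto simp: block_partition_def disjoint_family_on_def)
  then show ?thesis using assms by (simp add: block_partition_def)
qed

lemma part_of_eq:
  assumes "block_partition d k I" "s \<in> {1..k}" "r \<in> I s"
  shows "part_of k I r = s"
  unfolding part_of_def
proof (rule the_equality)
  show "s' = s" if "s' \<in> {1..k} \<and> r \<in> I s'" for s'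
  proof (rule ccontr)
    assume "s' \<noteq> s"
    then have "I s' \<inter> I s = {}"
      using assms that unfolding block_partition_def disjoint_family_on_def by blast
    then show False using assms(3) that by blast
  qed
qed (use assms in auto)

locale summing_setting =
  fixes K :: "complex set" and d k :: nat
    and I :: "nat \<Rightarrow> nat set" and j :: "nat \<Rightarrow> nat \<Rightarrow> nat"
    and X Y :: "nat \<Rightarrow> 'a bspace \<Rightarrow> 'a bspace"
  assumes K: "K = \<real> \<or> K = UNIV" and d: "1 \<le> d"
    and partition: "block_partition d k I"
    and X: "\<And>r. r \<in> {1..d} \<Longrightarrow> sequence_class K (X r)"
    and X_stable: "\<And>r. r \<in> {1..d} \<Longrightarrow> linearly_stable K (X r)"
    and Y: "\<And>s. s \<in> {1..k} \<Longrightarrow> sequence_class K (Y s)"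
    and Y_stable: "\<And>s. s \<in> {1..k} \<Longrightarrow> linearly_stable K (Y s)"
    and compatible: "block_compatible K d k I j X Y"
begin

abbreviation W :: "'a bspace \<Rightarrow> 'a bspace" where
  "W \<equiv> iterated_space k Y"

abbreviation XE :: "(nat \<Rightarrow> 'a bspace) \<Rightarrow> nat \<Rightarrow> 'a bspace" where
  "XE E \<equiv> \<lambda>r. X r (E r)"

abbreviation hat :: "(nat \<Rightarrow> 'a bspace) \<Rightarrow> ((nat \<Rightarrow> 'a univ) \<Rightarrow> 'a univ) \<Rightarrow> (nat \<Rightarrow> 'a univ) \<Rightarrow> 'a univ" where
  "hat \<equiv> induced_map d k I j X"

abbreviation summing :: "(nat \<Rightarrow> 'a bspace) \<Rightarrow> 'a bspace \<Rightarrow> ((nat \<Rightarrow> 'a univ) \<Rightarrow> 'a univ) set" where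
  "summing \<equiv> summing_ops K d k I j X Y"

abbreviation norm_s :: "(nat \<Rightarrow> 'a bspace) \<Rightarrow> 'a bspace \<Rightarrow> ((nat \<Rightarrow> 'a univ) \<Rightarrow> 'a univ) \<Rightarrow> real" where
  "norm_s \<equiv> summing_norm d k I j X Y"

definition entry :: "(nat \<Rightarrow> nat) \<Rightarrow> 'a univ \<Rightarrow> 'a univ" where
  "entry n = nested_coord [1..<Suc k] n"

text \<open>An arbitrary \<open>n\<close> is cut to \<open>{1..k}\<close> because iterated sequences
  evaluate their family only at such extensional index functions.\<close>

definition idx :: "(nat \<Rightarrow> nat) \<Rightarrow> nat \<Rightarrow> nat" where
  "idx n = block_map d k I j (restrict n {1..k})"

definition entries :: "(nat \<Rightarrow> nat) \<Rightarrow> (nat \<Rightarrow> 'a univ) \<Rightarrow> nat \<Rightarrow> 'a univ" where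
  "entries n x = (\<lambda>r\<in>{1..d}. coord (x r) (idx n r))"

lemma set_parts: "s \<in> set [1..<Suc k] \<longleftrightarrow> s \<in> {1..k}"
  by auto

lemmas Y' = Y[folded set_parts] and Y_stable' = Y_stable[folded set_parts]

lemma normed: "banach_space K E \<Longrightarrow> normed_mod K E"
  by (rule banach_space_normed_mod[OF K])

lemma W_banach: "banach_space K F \<Longrightarrow> banach_space K (W F)"
  unfolding iterated_space_def by (rule foldr_banach_space[OF K Y'])

lemma XE_banach: "r \<in> {1..d} \<Longrightarrow> banach_space K (E r) \<Longrightarrow> banach_space K (XE E r)"
  by (rule sequence_class_banach_space[OF K X])

lemma entry_linear_on: "banach_space K F \<Longrightarrow> linear_on K (W F) F (entry n)"
  unfolding iterated_space_def entry_def by (rule nested_coord_linear_on[OF K Y'])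

lemma vnorm_entry_le: "banach_space K F \<Longrightarrow> w \<in> carrier (W F) \<Longrightarrow> vnorm F (entry n w) \<le> vnorm (W F) w"
  unfolding iterated_space_def entry_def by (rule vnorm_nested_coord_le[OF K Y'])

lemma normed_pair_WF: "banach_space K F \<Longrightarrow> normed_pair K (W F) F"
  by (intro normed_pair.intro normed W_banach)

lemma vconv_entry:
  assumes F: "banach_space K F" and w: "vconv (W F) w l"
  shows "vconv F (\<lambda>m. entry n (w m)) (entry n l)"
  using normed_pair.linear_on_vconv[OF normed_pair_WF[OF F] entry_linear_on[OF F] _ w, where C = 1]
    vnorm_entry_le[OF F] by simp

lemma entry_ext:
  "banach_space K F \<Longrightarrow> v \<in> carrier (W F) \<Longrightarrow> w \<in> carrier (W F) \<Longrightarrow> (\<And>n. entry n v = entry n w) \<Longrightarrow> v = w"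
  unfolding iterated_space_def entry_def by (rule nested_coord_ext[OF K distinct_upt Y'])

lemma entry_iterated_seq: "entry n (iterated_seq k g) = g (restrict n {1..k})"
proof -
  \<comment> \<open>The starting function is \<open>undefined\<close> off \<open>{1..k}\<close>,
    just as \<open>restrict n {1..k}\<close> is; its values 0 on \<open>{1..k}\<close> are all
    overwritten.\<close>
  have "(\<lambda>t. if t \<in> set [1..<Suc k] then n t else (\<lambda>s\<in>{1..k}. 0) t) = restrict n {1..k}"
    unfolding set_parts by (auto simp: restrict_def)
  then show ?thesis
    unfolding entry_def iterated_seq_def
    using nested_coord_nested_seq[OF distinct_upt, of 1 "Suc k" n g "\<lambda>s\<in>{1..k}. 0"] by simp
qed

text \<open>Rebuilding \<open>w\<close> from its entries with \<open>nested_seq\<close> meets only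
  index functions that are \<open>undefined\<close> off \<open>{1..k}\<close>, and on these
  \<open>restrict\<close> changes nothing.\<close>

lemma iterated_seqI:
  assumes F: "banach_space K F" and w: "w \<in> carrier (W F)"
    and eq: "\<And>n. entry n w = g (restrict n {1..k})"
  shows "iterated_seq k g = w"
proof -
  let ?m = "\<lambda>s\<in>{1..k}. 0 :: nat"
  have "iterated_seq k g = nested_seq [1..<Suc k] (\<lambda>n. nested_coord [1..<Suc k] n w) ?m"
    unfolding iterated_seq_def
  proof (rule nested_seq_cong)
    fix n assume n: "\<And>t. t \<notin> set [1..<Suc k] \<Longrightarrow> n t = ?m t"
    have "n = restrict n {1..k}"
    proof
      fix t
      show "n t = restrict n {1..k} t"
      proof (cases "t \<in> {1..k}")
        case False
        then have "n t = ?m t" using n[of t] unfolding set_parts by blast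
        then show ?thesis using False by (simp only: restrict_apply if_False)
      qed simp
    qed
    then have "g n = g (restrict n {1..k})" by metis
    then show "g n = nested_coord [1..<Suc k] n w" using eq[of n] by (simp add: entry_def)
  qed
  also have "\<dots> = w"
    using w unfolding iterated_space_def by (intro nested_seq_nested_coord[OF K _ Y' F]) auto
  finally show ?thesis .
qed

lemma entry_hat:
  assumes "x \<in> tuples d (XE E)"
  shows "entry n (hat E A x) = A (entries n x)"
  using assms by (simp add: induced_map_def entry_iterated_seq entries_def idx_def)

lemma hat_eqI:
  assumes "banach_space K F" "x \<in> tuples d (XE E)" "w \<in> carrier (W F)"
    and "\<And>n. entry n w = A (entries n x)"
  shows "hat E A x = w"
  using iterated_seqI[OF assms(1,3), of "\<lambda>n. A (\<lambda>r\<in>{1..d}. coord (x r) (block_map d k I j n r))"] assms(2,4)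
  by (simp add: induced_map_def entries_def idx_def)

lemma summing_iff:
  "A \<in> summing E F \<longleftrightarrow> A \<in> multilin_ops K d E F \<and> (\<forall>x\<in>tuples d (XE E). hat E A x \<in> carrier (W F))"
  by (simp add: summing_ops_def)

text \<open>The common route to membership: name a candidate for the value of the induced map and
  compare entries.\<close>

lemma summingI:
  assumes "banach_space K F" "A \<in> multilin_ops K d E F"
    and "\<And>x. x \<in> tuples d (XE E) \<Longrightarrow> w x \<in> carrier (W F)"
    and "\<And>n x. x \<in> tuples d (XE E) \<Longrightarrow> entry n (w x) = A (entries n x)"
  shows "A \<in> summing E F" "x \<in> tuples d (XE E) \<Longrightarrow> hat E A x = w x"
proof -
  show *: "hat E A x = w x" if "x \<in> tuples d (XE E)" for x
    using that assms by (intro hat_eqI) auto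
  show "A \<in> summing E F" using assms by (simp add: summing_iff *)
qed

lemma summing_multilin: "A \<in> summing E F \<Longrightarrow> A \<in> multilin_ops K d E F"
  by (simp add: summing_iff)

lemma hat_in: "A \<in> summing E F \<Longrightarrow> x \<in> tuples d (XE E) \<Longrightarrow> hat E A x \<in> carrier (W F)"
  by (simp add: summing_iff)

lemma coord_in: "r \<in> {1..d} \<Longrightarrow> banach_space K (E r) \<Longrightarrow> z \<in> carrier (X r (E r)) \<Longrightarrow> coord z i \<in> carrier (E r)"
  by (rule sequence_class_coord(2)[OF K X])

context
  fixes E :: "nat \<Rightarrow> 'a bspace" and F :: "'a bspace"
  assumes E: "\<And>r. r \<in> {1..d} \<Longrightarrow> banach_space K (E r)" and F: "banach_space K F"
begin

lemma normed_mods_EF: "normed_mods K d E F"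
  using d E F normed by (auto simp: normed_mods_def)

lemma normed_mods_XW: "normed_mods K d (XE E) (W F)"
  using d E F normed XE_banach W_banach by (auto simp: normed_mods_def)

interpretation EF: normed_mods K d E F by (rule normed_mods_EF)
interpretation XW: normed_mods K d "XE E" "W F" by (rule normed_mods_XW)

lemma coord_in_E: "r \<in> {1..d} \<Longrightarrow> z \<in> carrier (X r (E r)) \<Longrightarrow> coord z i \<in> carrier (E r)"
  by (rule coord_in[where E = E, OF _ E])

lemma XE_banach_E: "r \<in> {1..d} \<Longrightarrow> banach_space K (X r (E r))"
  by (rule XE_banach[where E = E, OF _ E])

lemma entries_in: "x \<in> tuples d (XE E) \<Longrightarrow> entries n x \<in> tuples d E"
  unfolding entries_def by (intro tuples_restrict coord_in_E tuples_mem)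

lemma entries_upd: "r \<in> {1..d} \<Longrightarrow> entries n (x(r := y)) = (entries n x)(r := coord y (idx n r))"
  by (auto simp: entries_def)

lemma coord_linear_on: "r \<in> {1..d} \<Longrightarrow> linear_on K (X r (E r)) (E r) (\<lambda>z. coord z i)"
  by (rule sequence_class_coord_linear_on[OF K X E])

text \<open>Taking coordinates is linear and \<open>A\<close> is multilinear, so the entries of both
  sides agree; both sides lie in \<open>W F\<close>, where entries decide.\<close>

lemma hat_multilinear_on:
  assumes A: "A \<in> summing E F"
  shows "multilinear_on K d (XE E) (W F) (hat E A)"
proof (rule multilinear_onI)
  show "hat E A x \<in> carrier (W F)" if "x \<in> tuples d (XE E)" for x using hat_in[OF A that] .
  note A' = summing_multilin[OF A]
  fix r x y assume r: "r \<in> {1..d}" and x: "x \<in> tuples d (XE E)" and y: "y \<in> carrier (X r (E r))"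
  have xy: "x(r := y) \<in> tuples d (XE E)" using x r y by auto
  { fix z assume z: "z \<in> carrier (X r (E r))"
    then have xz: "x(r := z) \<in> tuples d (XE E)" using x r by auto
    have yz: "x(r := y \<oplus>\<^bsub>X r (E r)\<^esub> z) \<in> tuples d (XE E)" using x r XW.E_add[OF r y z] by auto
    show "hat E A (x(r := y \<oplus>\<^bsub>X r (E r)\<^esub> z)) = hat E A (x(r := y)) \<oplus>\<^bsub>W F\<^esub> hat E A (x(r := z))"
    proof (rule entry_ext[OF F])
      fix n
      show "entry n (hat E A (x(r := y \<oplus>\<^bsub>X r (E r)\<^esub> z)))
          = entry n (hat E A (x(r := y)) \<oplus>\<^bsub>W F\<^esub> hat E A (x(r := z)))"
        by (simp only: entry_hat[OF yz] entry_hat[OF xy] entry_hat[OF xz] entries_upd[OF r]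
          linear_on_add[OF entry_linear_on[OF F] hat_in[OF A xy] hat_in[OF A xz]]
          linear_on_add[OF coord_linear_on[OF r] y z]
          EF.multilin_ops_add_slot[OF A' r entries_in[OF x] coord_in_E[OF r y] coord_in_E[OF r z]])
    qed (use hat_in[OF A] xy xz yz in auto) }
  fix a assume a: "a \<in> K"
  have ay: "x(r := a \<odot>\<^bsub>X r (E r)\<^esub> y) \<in> tuples d (XE E)" using x r XW.E_smult[OF r a y] by auto
  show "hat E A (x(r := a \<odot>\<^bsub>X r (E r)\<^esub> y)) = a \<odot>\<^bsub>W F\<^esub> hat E A (x(r := y))"
  proof (rule entry_ext[OF F])
    fix n
    show "entry n (hat E A (x(r := a \<odot>\<^bsub>X r (E r)\<^esub> y))) = entry n (a \<odot>\<^bsub>W F\<^esub> hat E A (x(r := y)))"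
      by (simp only: entry_hat[OF ay] entry_hat[OF xy] entries_upd[OF r]
          linear_on_smult[OF entry_linear_on[OF F] a hat_in[OF A xy]]
          linear_on_smult[OF coord_linear_on[OF r] a y]
          EF.multilin_ops_smult_slot[OF A' r entries_in[OF x] a coord_in_E[OF r y]])
  qed (use hat_in[OF A] xy ay a in auto)
qed

text \<open>The graph of the induced map is closed in each variable because the entries of a sequence
  depend continuously on it; no boundedness of the induced map is part of the definition.\<close>

lemma hat_multilin_ops:
  assumes A: "A \<in> summing E F"
  shows "hat E A \<in> multilin_ops K d (XE E) (W F)"
proof -
  note A' = summing_multilin[OF A]
  have "\<exists>C. \<forall>x\<in>tuples d (XE E). vnorm (W F) (hat E A x) \<le> C * (\<Prod>r = 1..d. vnorm (XE E r) (x r))"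
  proof (rule multilinear_on_closed_bounded[where K = K and E = "XE E" and A = "hat E A"])
    fix r x z l w
    assume r: "r \<in> {1..d}" and x: "x \<in> tuples d (XE E)" and z: "vconv (X r (E r)) z l"
      and w: "vconv (W F) (\<lambda>m. hat E A (x(r := z m))) w"
    have zl: "z m \<in> carrier (X r (E r))" "l \<in> carrier (X r (E r))" for m
      using z by (auto simp: vconv_def)
    have xz: "x(r := z m) \<in> tuples d (XE E)" and xl: "x(r := l) \<in> tuples d (XE E)" for m
      using x r zl by auto
    interpret P: normed_pair K "X r (E r)" "E r"
      by (intro normed_pair.intro normed XE_banach_E E r)
    interpret Q: normed_pair K "E r" F
      by (intro normed_pair.intro normed E F r)
    show "hat E A (x(r := l)) = w"
    proof (rule entry_ext[OF F hat_in[OF A xl]])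
      show "w \<in> carrier (W F)" using w by (simp add: vconv_def)
      fix n
      \<comment> \<open>Reading a coordinate never increases the norm, hence the constant 1.\<close>
      have "vconv (E r) (\<lambda>m. coord (z m) (idx n r)) (coord l (idx n r))"
        using z sequence_class_coord(3)[OF K X[OF r] E[OF r]]
        by (intro P.linear_on_vconv[OF coord_linear_on[OF r], where C = 1]) auto
      then have "vconv F (\<lambda>m. A ((entries n x)(r := coord (z m) (idx n r))))
          (A ((entries n x)(r := coord l (idx n r))))"
        using EF.multilin_ops_slot_bounded[OF A' r entries_in[OF x]]
        by (intro Q.linear_on_vconv[OF EF.multilinear_on_linear_on[OF
              EF.multilin_ops_multilinear_on[OF A'] r entries_in[OF x]]])
      then have "vconv F (\<lambda>m. entry n (hat E A (x(r := z m)))) (entry n (hat E A (x(r := l))))"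
        by (simp only: entry_hat[OF xz] entry_hat[OF xl] entries_upd[OF r])
      then show "entry n (hat E A (x(r := l))) = entry n w"
        using vconv_entry[OF F w] EF.F.vconv_unique by blast
    qed
  qed (use K d XE_banach_E W_banach[OF F] hat_multilinear_on[OF A] in auto)
  then show ?thesis
    using hat_multilinear_on[OF A] by (simp add: XW.multilin_ops_iff induced_map_def)
qed

section \<open>The summing norm\<close>

lemma norm_s_eq: "norm_s E F A = multilin_norm d (XE E) (W F) (hat E A)"
  by (simp add: summing_norm_def)

lemma norm_s_nonneg: "A \<in> summing E F \<Longrightarrow> 0 \<le> norm_s E F A"
  unfolding norm_s_eq by (intro XW.multilin_norm_nonneg hat_multilin_ops)

lemma vnorm_hat_le:
  "A \<in> summing E F \<Longrightarrow> x \<in> tuples d (XE E) \<Longrightarrow>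
    vnorm (W F) (hat E A x) \<le> norm_s E F A * (\<Prod>r = 1..d. vnorm (X r (E r)) (x r))"
  unfolding norm_s_eq by (rule XW.multilin_norm_vnorm_le[OF hat_multilin_ops])

lemma norm_s_upper:
  "A \<in> summing E F \<Longrightarrow> x \<in> tuples d (XE E) \<Longrightarrow> (\<And>r. r \<in> {1..d} \<Longrightarrow> vnorm (X r (E r)) (x r) \<le> 1) \<Longrightarrow>
    vnorm (W F) (hat E A x) \<le> norm_s E F A"
  unfolding norm_s_eq by (rule XW.multilin_norm_upper[OF hat_multilin_ops])

lemma norm_s_least:
  assumes le: "\<And>x. x \<in> tuples d (XE E) \<Longrightarrow> (\<And>r. r \<in> {1..d} \<Longrightarrow> vnorm (X r (E r)) (x r) \<le> 1) \<Longrightarrow>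
    vnorm (W F) (hat E A x) \<le> C"
  shows "norm_s E F A \<le> C"
  unfolding norm_s_eq
proof (rule XW.multilin_norm_least)
  fix x assume x: "x \<in> tuples d (XE E)" and x1: "\<And>r. r \<in> {1..d} \<Longrightarrow> vnorm (X r (E r)) (x r) \<le> 1"
  show "vnorm (W F) (hat E A x) \<le> C" by (rule le[OF x x1])
qed

lemma vnorm_le_norm_s:
  assumes A: "A \<in> summing E F" and x: "x \<in> tuples d E"
  shows "vnorm F (A x) \<le> norm_s E F A * (\<Prod>r = 1..d. vnorm (E r) (x r))"
proof -
  let ?n = "\<lambda>_. 0 :: nat"
  \<comment> \<open>With \<open>x r\<close> at position \<open>idx ?n r\<close> of slot
    \<open>r\<close>, the entry of the induced map at the index tuple 0 is \<open>A x\<close>; the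
    norm of each sequence is at most that of \<open>x r\<close>.\<close>
  define z where "z = (\<lambda>r\<in>{1..d}. Seq (\<lambda>i. if i = idx ?n r then x r else \<zero>\<^bsub>E r\<^esub>))"
  have zr: "z r \<in> carrier (X r (E r)) \<and> vnorm (X r (E r)) (z r) \<le> vnorm (E r) (x r)" if r: "r \<in> {1..d}" for r
    using sequence_class_unit_seq[OF K X[OF r] E[OF r] X_stable[OF r] tuples_mem[OF x r], of "idx ?n r"] r
    by (simp add: z_def)
  then have z: "z \<in> tuples d (XE E)" by (auto simp: tuples_def PiE_iff z_def)
  have "entries ?n z = x"
    using entries_in[OF z] x by (rule tuples_ext) (simp add: entries_def z_def)
  then have "vnorm F (A x) = vnorm F (entry ?n (hat E A z))" using entry_hat[OF z, of ?n A] by simp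
  also have "\<dots> \<le> vnorm (W F) (hat E A z)" by (rule vnorm_entry_le[OF F hat_in[OF A z]])
  also have "\<dots> \<le> norm_s E F A * (\<Prod>r = 1..d. vnorm (X r (E r)) (z r))" by (rule vnorm_hat_le[OF A z])
  also have "\<dots> \<le> norm_s E F A * (\<Prod>r = 1..d. vnorm (E r) (x r))"
    using zr XW.tuples_vnorm_nonneg[OF z] by (intro mult_left_mono prod_mono norm_s_nonneg[OF A]) auto
  finally show ?thesis .
qed

section \<open>The normed space of summing operators\<close>

lemma summing_zero: "(\<lambda>x\<in>tuples d E. \<zero>\<^bsub>F\<^esub>) \<in> summing E F"
proof (rule summingI(1)[OF F EF.multilin_ops_zero])
  interpret P: normed_pair K "W F" F by (rule normed_pair_WF[OF F])
  show "\<zero>\<^bsub>W F\<^esub> \<in> carrier (W F)" by simp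
  show "entry n \<zero>\<^bsub>W F\<^esub> = (\<lambda>x\<in>tuples d E. \<zero>\<^bsub>F\<^esub>) (entries n x)" if "x \<in> tuples d (XE E)" for n x
    using P.linear_on_zero[OF entry_linear_on[OF F]] entries_in[OF that] by simp
qed

lemma summing_add:
  assumes A: "A \<in> summing E F" and B: "B \<in> summing E F"
  shows "(\<lambda>x\<in>tuples d E. A x \<oplus>\<^bsub>F\<^esub> B x) \<in> summing E F"
    and "x \<in> tuples d (XE E) \<Longrightarrow>
      hat E (\<lambda>x\<in>tuples d E. A x \<oplus>\<^bsub>F\<^esub> B x) x = hat E A x \<oplus>\<^bsub>W F\<^esub> hat E B x"
proof -
  have *: "hat E A x \<oplus>\<^bsub>W F\<^esub> hat E B x \<in> carrier (W F)"
    "entry n (hat E A x \<oplus>\<^bsub>W F\<^esub> hat E B x) = (\<lambda>x\<in>tuples d E. A x \<oplus>\<^bsub>F\<^esub> B x) (entries n x)"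
    if x: "x \<in> tuples d (XE E)" for n x
    using linear_on_add[OF entry_linear_on[OF F] hat_in[OF A x] hat_in[OF B x]]
      hat_in[OF A x] hat_in[OF B x] entries_in[OF x] by (simp_all add: entry_hat[OF x])
  note add = EF.multilin_ops_add[OF summing_multilin[OF A] summing_multilin[OF B]]
  show "(\<lambda>x\<in>tuples d E. A x \<oplus>\<^bsub>F\<^esub> B x) \<in> summing E F" by (rule summingI(1)[OF F add *])
  show "x \<in> tuples d (XE E) \<Longrightarrow>
      hat E (\<lambda>x\<in>tuples d E. A x \<oplus>\<^bsub>F\<^esub> B x) x = hat E A x \<oplus>\<^bsub>W F\<^esub> hat E B x"
    by (rule summingI(2)[OF F add *])
qed

lemma summing_smult:
  assumes a: "a \<in> K" and A: "A \<in> summing E F"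
  shows "(\<lambda>x\<in>tuples d E. a \<odot>\<^bsub>F\<^esub> A x) \<in> summing E F"
    and "x \<in> tuples d (XE E) \<Longrightarrow> hat E (\<lambda>x\<in>tuples d E. a \<odot>\<^bsub>F\<^esub> A x) x = a \<odot>\<^bsub>W F\<^esub> hat E A x"
proof -
  have *: "a \<odot>\<^bsub>W F\<^esub> hat E A x \<in> carrier (W F)"
    "entry n (a \<odot>\<^bsub>W F\<^esub> hat E A x) = (\<lambda>x\<in>tuples d E. a \<odot>\<^bsub>F\<^esub> A x) (entries n x)"
    if x: "x \<in> tuples d (XE E)" for n x
    using linear_on_smult[OF entry_linear_on[OF F] a hat_in[OF A x]]
      hat_in[OF A x] entries_in[OF x] a by (simp_all add: entry_hat[OF x])
  note smult = EF.multilin_ops_smult[OF a summing_multilin[OF A]]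
  show "(\<lambda>x\<in>tuples d E. a \<odot>\<^bsub>F\<^esub> A x) \<in> summing E F" by (rule summingI(1)[OF F smult *])
  show "x \<in> tuples d (XE E) \<Longrightarrow> hat E (\<lambda>x\<in>tuples d E. a \<odot>\<^bsub>F\<^esub> A x) x = a \<odot>\<^bsub>W F\<^esub> hat E A x"
    by (rule summingI(2)[OF F smult *])
qed

abbreviation summing_space :: "(complex, (nat \<Rightarrow> 'a univ) \<Rightarrow> 'a univ) normed_module" where
  "summing_space \<equiv> multilin_space K d E F\<lparr>carrier := summing E F, vnorm := norm_s E F\<rparr>"

lemma summing_PiE: "summing E F \<subseteq> tuples d E \<rightarrow>\<^sub>E carrier F"
  using EF.multilin_ops_PiE by (auto simp only: summing_iff)

lemma module_summing: "Module.module (scalar_ring K) (multilin_space K d E F\<lparr>carrier := summing E F\<rparr>)"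
  by (rule module_multilin_space_carrier[OF normed[OF F] summing_PiE summing_zero
        summing_add(1) summing_smult(1)])

lemma summing_submodule: "submodule (summing E F) (scalar_ring K) (multilin_space K d E F)"
  using module.module_incl_imp_submodule[OF EF.module_multilin_space _ module_summing] summing_multilin
  by (simp add: subset_iff)

lemma normed_mod_summing: "normed_mod K summing_space"
proof -
  \<comment> \<open>The module axioms do not involve \<open>vnorm\<close>, so unfolding them
    disposes of the changed norm field.\<close>
  have "Module.module (scalar_ring K) summing_space"
    using module_summing unfolding Module.module_def abelian_group_def abelian_monoid_def
      abelian_group_axioms_def module_axioms_def by simp
  then interpret Module.module "scalar_ring K" summing_space .
  show ?thesis
  proof
    fix A assume "A \<in> carrier summing_space"
    then have A: "A \<in> summing E F" by simp
    show "0 \<le> vnorm summing_space A" using norm_s_nonneg[OF A] by simp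
    show "vnorm summing_space A = 0 \<longleftrightarrow> A = \<zero>\<^bsub>summing_space\<^esub>"
    proof
      assume 0: "vnorm summing_space A = 0"
      \<comment> \<open>The summing norm controls every value of \<open>A\<close>, so it vanishes
        only for the zero operator.\<close>
      have "A x = \<zero>\<^bsub>F\<^esub>" if x: "x \<in> tuples d E" for x
      proof -
        have Ax: "A x \<in> carrier F" by (rule EF.multilin_ops_closed[OF summing_multilin[OF A] x])
        have "vnorm F (A x) \<le> 0" using vnorm_le_norm_s[OF A x] 0 by simp
        then show ?thesis using EF.F.vnorm_eq_0_iff[OF Ax] EF.F.vnorm_nonneg[OF Ax] by linarith
      qed
      then show "A = \<zero>\<^bsub>summing_space\<^esub>"
        using A summing_PiE by (intro extensionalityI[of _ "tuples d E"]) (auto simp: PiE_iff)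
    next
      assume "A = \<zero>\<^bsub>summing_space\<^esub>"
      then have A0: "A = (\<lambda>x\<in>tuples d E. \<zero>\<^bsub>F\<^esub>)" by simp
      interpret P: normed_pair K "W F" F by (rule normed_pair_WF[OF F])
      have "norm_s E F A \<le> 0"
      proof (rule norm_s_least)
        fix x assume x: "x \<in> tuples d (XE E)"
        have "hat E A x = \<zero>\<^bsub>W F\<^esub>"
          using P.linear_on_zero[OF entry_linear_on[OF F]] entries_in[OF x]
          by (intro hat_eqI[OF F x]) (auto simp: A0)
        then show "vnorm (W F) (hat E A x) \<le> 0" by simp
      qed
      then show "vnorm summing_space A = 0" using norm_s_nonneg[OF A] by simp
    qed
    { fix B assume "B \<in> carrier summing_space"
      then have B: "B \<in> summing E F" by simp
      have "norm_s E F (\<lambda>x\<in>tuples d E. A x \<oplus>\<^bsub>F\<^esub> B x) \<le> norm_s E F A + norm_s E F B"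
      proof (rule norm_s_least)
        fix x assume x: "x \<in> tuples d (XE E)" and x1: "\<And>r. r \<in> {1..d} \<Longrightarrow> vnorm (X r (E r)) (x r) \<le> 1"
        have "vnorm (W F) (hat E A x \<oplus>\<^bsub>W F\<^esub> hat E B x) \<le> vnorm (W F) (hat E A x) + vnorm (W F) (hat E B x)"
          by (rule XW.F.vnorm_triangle[OF hat_in[OF A x] hat_in[OF B x]])
        also have "\<dots> \<le> norm_s E F A + norm_s E F B"
          by (intro add_mono norm_s_upper A B x x1)
        finally show "vnorm (W F) (hat E (\<lambda>x\<in>tuples d E. A x \<oplus>\<^bsub>F\<^esub> B x) x) \<le> norm_s E F A + norm_s E F B"
          by (simp add: summing_add(2)[OF A B x])
      qed
      then show "vnorm summing_space (A \<oplus>\<^bsub>summing_space\<^esub> B) \<le> vnorm summing_space A + vnorm summing_space B"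
        by simp }
    fix a assume a: "a \<in> K"
    let ?B = "\<lambda>x\<in>tuples d E. a \<odot>\<^bsub>F\<^esub> A x"
    note B = summing_smult(1)[OF a A]
    have hatB: "vnorm (W F) (hat E ?B x) = cmod a * vnorm (W F) (hat E A x)" if x: "x \<in> tuples d (XE E)" for x
      using XW.F.vnorm_smult[OF a hat_in[OF A x]] by (simp add: summing_smult(2)[OF a A x])
    have "norm_s E F ?B = cmod a * norm_s E F A"
    proof (rule antisym)
      show "norm_s E F ?B \<le> cmod a * norm_s E F A"
      proof (rule norm_s_least)
        fix x assume x: "x \<in> tuples d (XE E)" and x1: "\<And>r. r \<in> {1..d} \<Longrightarrow> vnorm (X r (E r)) (x r) \<le> 1"
        show "vnorm (W F) (hat E ?B x) \<le> cmod a * norm_s E F A"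
          unfolding hatB[OF x] by (intro mult_left_mono norm_s_upper[OF A x x1]) auto
      qed
      show "cmod a * norm_s E F A \<le> norm_s E F ?B"
      proof (cases "a = 0")
        case False
        \<comment> \<open>Dividing the bound for \<open>?B\<close> by \<open>cmod a\<close> makes it
          a bound for \<open>A\<close>, which is the reverse inequality.\<close>
        have "norm_s E F A \<le> norm_s E F ?B / cmod a"
        proof (rule norm_s_least)
          fix x assume x: "x \<in> tuples d (XE E)" and x1: "\<And>r. r \<in> {1..d} \<Longrightarrow> vnorm (X r (E r)) (x r) \<le> 1"
          have "cmod a * vnorm (W F) (hat E A x) \<le> norm_s E F ?B"
            using norm_s_upper[OF B x x1] hatB[OF x] by simp
          then show "vnorm (W F) (hat E A x) \<le> norm_s E F ?B / cmod a"
            using False by (simp add: field_simps)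
        qed
        then show ?thesis using False by (simp add: field_simps)
      qed (use norm_s_nonneg[OF B] in simp)
    qed
    then show "vnorm summing_space (a \<odot>\<^bsub>summing_space\<^esub> A) = cmod a * vnorm summing_space A" by simp
  qed (rule K)
qed

end

end

section \<open>The ideal of summing operators\<close>

context summing_setting
begin

lemma summing_banach_space:
  assumes E: "\<And>r. r \<in> {1..d} \<Longrightarrow> banach_space K (E r)" and F: "banach_space K F"
  shows "banach_space K (multilin_space K d E F\<lparr>carrier := summing E F, vnorm := norm_s E F\<rparr>)"
    (is "banach_space K ?S")
proof -
  interpret EF: normed_mods K d E F by (rule normed_mods_EF[OF E F])
  interpret XW: normed_mods K d "XE E" "W F" by (rule normed_mods_XW[OF E F])
  interpret S: normed_mod K ?S by (rule normed_mod_summing[OF E F])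
  have minus_eq: "A \<ominus>\<^bsub>?S\<^esub> B = (\<lambda>x\<in>tuples d E. A x \<ominus>\<^bsub>F\<^esub> B x)"
    and hat_minus: "x \<in> tuples d (XE E) \<Longrightarrow> hat E (A \<ominus>\<^bsub>?S\<^esub> B) x = hat E A x \<ominus>\<^bsub>W F\<^esub> hat E B x"
    if A: "A \<in> summing E F" and B: "B \<in> summing E F" for A B x
  proof -
    let ?B = "\<lambda>x\<in>tuples d E. (- 1) \<odot>\<^bsub>F\<^esub> B x"
    have B': "?B \<in> summing E F" by (rule summing_smult(1)[OF E F _ B]) auto
    have AB: "A \<ominus>\<^bsub>?S\<^esub> B = (\<lambda>x\<in>tuples d E. A x \<oplus>\<^bsub>F\<^esub> ?B x)"
      using S.minus_eq_add_smult[of B A] B by simp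
    show "A \<ominus>\<^bsub>?S\<^esub> B = (\<lambda>x\<in>tuples d E. A x \<ominus>\<^bsub>F\<^esub> B x)"
      unfolding AB using EF.multilin_ops_closed[OF summing_multilin[OF B]]
      by (intro restrict_ext) (simp add: EF.F.minus_eq_add_smult)
    assume x: "x \<in> tuples d (XE E)"
    have "hat E (A \<ominus>\<^bsub>?S\<^esub> B) x = hat E A x \<oplus>\<^bsub>W F\<^esub> hat E ?B x"
      unfolding AB by (rule summing_add(2)[OF E F A B' x])
    also have "hat E ?B x = (- 1) \<odot>\<^bsub>W F\<^esub> hat E B x"
      by (rule summing_smult(2)[OF E F XW.F.K_minus[OF XW.F.K_1] B x])
    finally show "hat E (A \<ominus>\<^bsub>?S\<^esub> B) x = hat E A x \<ominus>\<^bsub>W F\<^esub> hat E B x"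
      by (simp only: XW.F.minus_eq_add_smult[OF hat_in[OF B x]])
  qed
  show ?thesis
  proof (rule S.banach_spaceI)
    fix A :: "nat \<Rightarrow> (nat \<Rightarrow> 'a univ) \<Rightarrow> 'a univ" assume A: "vcauchy ?S A"
    then have As: "A m \<in> summing E F" for m by (auto simp: vcauchy_def)
    have cauchy: "\<exists>N. \<forall>m n. N \<le> m \<longrightarrow> N \<le> n \<longrightarrow> norm_s E F (A m \<ominus>\<^bsub>?S\<^esub> A n) < e" if "0 < e" for e
      using A that by (simp add: vcauchy_def)
    have minus_in: "A m \<ominus>\<^bsub>?S\<^esub> A n \<in> summing E F" for m n
      using S.M.minus_closed[of "A m" "A n"] As by simp
    \<comment> \<open>Used twice: \<open>f\<close> is evaluation of the operator at a tuple, then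
      evaluation of its induced map, and \<open>c\<close> is the product of the norms in the tuple.
      This product can be 0, so \<open>e\<close> is divided by \<open>c + 1\<close>.\<close>
    have vcauchyI: "vcauchy V (\<lambda>m. f (A m))"
      if "\<And>m. f (A m) \<in> carrier V"
        and "\<And>m n. vnorm V (f (A m) \<ominus>\<^bsub>V\<^esub> f (A n)) \<le> norm_s E F (A m \<ominus>\<^bsub>?S\<^esub> A n) * c"
        and c: "0 \<le> c" for V :: "'a bspace" and f c
      unfolding vcauchy_def
    proof (intro conjI allI impI)
      fix e :: real assume e: "0 < e"
      have "0 < e / (c + 1)" using e c by simp
      then obtain N where N: "\<And>m n. N \<le> m \<Longrightarrow> N \<le> n \<Longrightarrow> norm_s E F (A m \<ominus>\<^bsub>?S\<^esub> A n) < e / (c + 1)"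
        using cauchy by blast
      have "vnorm V (f (A m) \<ominus>\<^bsub>V\<^esub> f (A n)) < e" if mn: "N \<le> m" "N \<le> n" for m n
      proof -
        have "vnorm V (f (A m) \<ominus>\<^bsub>V\<^esub> f (A n)) \<le> norm_s E F (A m \<ominus>\<^bsub>?S\<^esub> A n) * c" by fact
        also have "\<dots> \<le> norm_s E F (A m \<ominus>\<^bsub>?S\<^esub> A n) * (c + 1)"
          using norm_s_nonneg[OF E F minus_in] by (intro mult_left_mono) auto
        also have "\<dots> < e / (c + 1) * (c + 1)" using N[OF mn] c by (intro mult_strict_right_mono) auto
        also have "\<dots> = e" using c by simp
        finally show ?thesis .
      qed
      then show "\<exists>N. \<forall>m n. N \<le> m \<longrightarrow> N \<le> n \<longrightarrow> vnorm V (f (A m) \<ominus>\<^bsub>V\<^esub> f (A n)) < e" by blast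
    qed (use that(1) in auto)
    have "\<exists>l. vconv F (\<lambda>m. A m x) l" if x: "x \<in> tuples d E" for x
    proof (rule banach_space_vcauchy_vconv[OF K F], rule vcauchyI[of "\<lambda>B. B x"])
      show "A m x \<in> carrier F" for m by (rule EF.multilin_ops_closed[OF summing_multilin[OF As] x])
      show "0 \<le> (\<Prod>r = 1..d. vnorm (E r) (x r))" by (rule EF.tuples_prod_nonneg[OF x])
      show "vnorm F (A m x \<ominus>\<^bsub>F\<^esub> A n x) \<le> norm_s E F (A m \<ominus>\<^bsub>?S\<^esub> A n) * (\<Prod>r = 1..d. vnorm (E r) (x r))" for m n
        using vnorm_le_norm_s[OF E F minus_in x, of m n] x by (simp add: minus_eq[OF As As])
    qed
    then obtain l where l: "\<And>x. x \<in> tuples d E \<Longrightarrow> vconv F (\<lambda>m. A m x) (l x)" by metis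
    define L where "L = restrict l (tuples d E)"
    have L: "vconv F (\<lambda>m. A m x) (L x)" if "x \<in> tuples d E" for x using l that by (simp add: L_def)
    have "\<exists>w. vconv (W F) (\<lambda>m. hat E (A m) x) w" if x: "x \<in> tuples d (XE E)" for x
    proof (rule banach_space_vcauchy_vconv[OF K W_banach[OF F]], rule vcauchyI[of "\<lambda>B. hat E B x"])
      show "hat E (A m) x \<in> carrier (W F)" for m by (rule hat_in[OF As x])
      show "0 \<le> (\<Prod>r = 1..d. vnorm (X r (E r)) (x r))" by (rule XW.tuples_prod_nonneg[OF x])
      show "vnorm (W F) (hat E (A m) x \<ominus>\<^bsub>W F\<^esub> hat E (A n) x)
          \<le> norm_s E F (A m \<ominus>\<^bsub>?S\<^esub> A n) * (\<Prod>r = 1..d. vnorm (X r (E r)) (x r))" for m n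
        using vnorm_hat_le[OF E F minus_in x, of m n] x by (simp add: hat_minus[OF As As])
    qed
    then obtain w where w: "\<And>x. x \<in> tuples d (XE E) \<Longrightarrow> vconv (W F) (\<lambda>m. hat E (A m) x) (w x)" by metis
    have L_multi: "multilinear_on K d E F L"
    proof (rule multilinear_onI)
      show "L x \<in> carrier F" if "x \<in> tuples d E" for x using L[OF that] by (simp add: vconv_def)
      fix r x y assume r: "r \<in> {1..d}" and x: "x \<in> tuples d E" and y: "y \<in> carrier (E r)"
      have xy: "x(r := y) \<in> tuples d E" using x r y by auto
      { fix z assume z: "z \<in> carrier (E r)"
        have xz: "x(r := z) \<in> tuples d E" using x r z by auto
        have yz: "x(r := y \<oplus>\<^bsub>E r\<^esub> z) \<in> tuples d E" using x r EF.E_add[OF r y z] by auto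
        show "L (x(r := y \<oplus>\<^bsub>E r\<^esub> z)) = L (x(r := y)) \<oplus>\<^bsub>F\<^esub> L (x(r := z))"
          using EF.F.vconv_unique[OF L[OF yz]] EF.F.vconv_add[OF L[OF xy] L[OF xz]]
          by (simp only: EF.multilin_ops_add_slot[OF summing_multilin[OF As] r x y z]) }
      fix a assume a: "a \<in> K"
      have ay: "x(r := a \<odot>\<^bsub>E r\<^esub> y) \<in> tuples d E" using x r EF.E_smult[OF r a y] by auto
      show "L (x(r := a \<odot>\<^bsub>E r\<^esub> y)) = a \<odot>\<^bsub>F\<^esub> L (x(r := y))"
        using EF.F.vconv_unique[OF L[OF ay]] EF.F.vconv_smult[OF L[OF xy] a]
        by (simp only: EF.multilin_ops_smult_slot[OF summing_multilin[OF As] r x a y])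
    qed
    \<comment> \<open>A Cauchy sequence is bounded: from \<open>N\<close> on the norms are at most
      \<open>norm_s E F (A N) + 1\<close>, and this constant bounds the limit
      \<open>L\<close>.\<close>
    obtain N where N: "\<And>m n. N \<le> m \<Longrightarrow> N \<le> n \<Longrightarrow> norm_s E F (A m \<ominus>\<^bsub>?S\<^esub> A n) < 1"
      using cauchy[of 1] by auto
    have "L \<in> multilin_ops K d E F"
    proof (rule EF.multilin_opsI[OF _ L_multi])
      show "L \<in> extensional (tuples d E)" by (simp add: L_def)
      fix x assume x: "x \<in> tuples d E"
      show "vnorm F (L x) \<le> (norm_s E F (A N) + 1) * (\<Prod>r = 1..d. vnorm (E r) (x r))"
      proof (rule EF.F.vconv_vnorm_le0[OF L[OF x]], rule eventually_sequentiallyI)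
        fix m assume m: "N \<le> m"
        have "norm_s E F (A m) \<le> norm_s E F (A N) + norm_s E F (A m \<ominus>\<^bsub>?S\<^esub> A N)"
          using S.vnorm_le_add_minus[of "A m" "A N"] As by simp
        also have "\<dots> \<le> norm_s E F (A N) + 1" using N[OF m order_refl] by simp
        finally show "vnorm F (A m x) \<le> (norm_s E F (A N) + 1) * (\<Prod>r = 1..d. vnorm (E r) (x r))"
          using order_trans[OF vnorm_le_norm_s[OF E F As x] mult_right_mono] EF.tuples_prod_nonneg[OF x]
          by blast
      qed
    qed
    \<comment> \<open>\<open>w\<close> is offered as the induced map of \<open>L\<close>; it remains
      to match the entries.\<close>
    note Ls = summingI[where w = w, OF F this]
    have w_in: "w x \<in> carrier (W F)" and w_entry: "entry n (w x) = L (entries n x)"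
      if x: "x \<in> tuples d (XE E)" for n x
    proof -
      show "w x \<in> carrier (W F)" using w[OF x] by (simp add: vconv_def)
      \<comment> \<open>Entries respect limits in \<open>W F\<close>, so
        \<open>entry n (w x)\<close> and \<open>L (entries n x)\<close> are limits of one sequence
        in \<open>F\<close>.\<close>
      have "vconv F (\<lambda>m. A m (entries n x)) (entry n (w x))"
        using vconv_entry[OF F w[OF x], of n] by (simp only: entry_hat[OF x])
      then show "entry n (w x) = L (entries n x)"
        using EF.F.vconv_unique[OF _ L[OF entries_in[OF E F x]]] by blast
    qed
    have L_in: "L \<in> summing E F" by (rule Ls(1)[OF w_in w_entry])
    have hatL: "hat E L x = w x" if "x \<in> tuples d (XE E)" for x by (rule Ls(2)[OF w_in w_entry that])
    \<comment> \<open>The Cauchy estimate for fixed \<open>m\<close> is passed to the limit in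
      \<open>n\<close> for each \<open>x\<close> separately. The resulting bound is uniform over the
      unit balls but no longer strict, hence \<open>e / 2\<close> below.\<close>
    have close: "norm_s E F (A m \<ominus>\<^bsub>?S\<^esub> L) \<le> e"
      if M: "\<And>n. M \<le> n \<Longrightarrow> norm_s E F (A n \<ominus>\<^bsub>?S\<^esub> A m) < e" for m M e
    proof (rule norm_s_least[OF E F])
      fix x assume x: "x \<in> tuples d (XE E)" and x1: "\<And>r. r \<in> {1..d} \<Longrightarrow> vnorm (X r (E r)) (x r) \<le> 1"
      have "vnorm (W F) (w x \<ominus>\<^bsub>W F\<^esub> hat E (A m) x) \<le> e"
      proof (rule XW.F.vconv_vnorm_le[OF w[OF x] hat_in[OF As x]], rule eventually_sequentiallyI)
        fix n assume n: "M \<le> n"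
        have "vnorm (W F) (hat E (A n \<ominus>\<^bsub>?S\<^esub> A m) x) \<le> norm_s E F (A n \<ominus>\<^bsub>?S\<^esub> A m)"
          by (rule norm_s_upper[OF E F minus_in x x1])
        then show "vnorm (W F) (hat E (A n) x \<ominus>\<^bsub>W F\<^esub> hat E (A m) x) \<le> e"
          using M[OF n] unfolding hat_minus[OF As As x] by linarith
      qed
      then show "vnorm (W F) (hat E (A m \<ominus>\<^bsub>?S\<^esub> L) x) \<le> e"
        using XW.F.vnorm_minus_commute[OF w_in[OF x] hat_in[OF As x]]
        by (simp add: hat_minus[OF As L_in x] hatL[OF x])
    qed
    have "(\<lambda>m. norm_s E F (A m \<ominus>\<^bsub>?S\<^esub> L)) \<longlonglongrightarrow> 0"
    proof (rule LIMSEQ_I)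
      fix e :: real assume "0 < e"
      then obtain M where M: "\<And>m n. M \<le> m \<Longrightarrow> M \<le> n \<Longrightarrow> norm_s E F (A m \<ominus>\<^bsub>?S\<^esub> A n) < e / 2"
        using cauchy[of "e / 2"] by auto
      have "norm (norm_s E F (A m \<ominus>\<^bsub>?S\<^esub> L) - 0) < e" if m: "M \<le> m" for m
      proof -
        have "norm_s E F (A m \<ominus>\<^bsub>?S\<^esub> L) \<le> e / 2" by (rule close[OF M[OF _ m]])
        moreover have "0 \<le> norm_s E F (A m \<ominus>\<^bsub>?S\<^esub> L)"
          using S.vnorm_nonneg[OF S.M.minus_closed, of "A m" L] As L_in by simp
        ultimately show ?thesis using \<open>0 < e\<close> by simp
      qed
      then show "\<exists>M. \<forall>m\<ge>M. norm (norm_s E F (A m \<ominus>\<^bsub>?S\<^esub> L) - 0) < e" by blast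
    qed
    then show "\<exists>L. vconv ?S A L" using As L_in by (intro exI[of _ L]) (auto simp: vconv_def)
  qed
qed

text \<open>The induced map of the composition at \<open>x\<close> is \<open>v\<close> of the
  induced map of \<open>A\<close> at \<open>z x\<close>, where \<open>z\<close> applies each
  \<open>u r\<close> coordinatewise and \<open>v\<close> lifts \<open>t\<close> to the iterated
  spaces. The lifts obey the norm bounds of the original operators, so the estimates
  multiply.\<close>

lemma compose_op_summing:
  assumes E: "\<And>r. r \<in> {1..d} \<Longrightarrow> banach_space K (E r)" and G: "\<And>r. r \<in> {1..d} \<Longrightarrow> banach_space K (G r)"
    and F: "banach_space K F" and H: "banach_space K H"
    and A: "A \<in> summing E F" and t: "t \<in> lin_ops K F H"
    and u: "\<And>r. r \<in> {1..d} \<Longrightarrow> u r \<in> lin_ops K (G r) (E r)"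
  shows "compose_op d G t A u \<in> summing G H"
    and "norm_s G H (compose_op d G t A u)
      \<le> lin_norm F H t * norm_s E F A * (\<Prod>r = 1..d. lin_norm (G r) (E r) (u r))"
proof -
  interpret EF: normed_mods K d E F by (rule normed_mods_EF[OF E F])
  interpret GH: normed_mods K d G H by (rule normed_mods_EF[OF G H])
  interpret XW: normed_mods K d "XE E" "W F" by (rule normed_mods_XW[OF E F])
  note t_lin = lin_ops_linear_on[OF EF.F GH.F t]
  have u_lin: "linear_on K (G r) (E r) (u r)" if r: "r \<in> {1..d}" for r
    by (rule lin_ops_linear_on[OF GH.E[OF r] EF.E[OF r] u[OF r]])
  note A' = summing_multilin[OF A]
  let ?C = "compose_op d G t A u"
  let ?u = "\<lambda>x. \<lambda>r\<in>{1..d}. u r (x r)"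
  have u_in: "?u x \<in> tuples d E" if x: "x \<in> tuples d G" for x
    using linear_on_closed[OF u_lin tuples_mem[OF x]] by (intro tuples_restrict)
  have u_upd: "?u (x(r := y)) = (?u x)(r := u r y)" if "r \<in> {1..d}" for x r y using that by auto
  have C: "?C x = t (A (?u x))" if "x \<in> tuples d G" for x using that by (simp add: compose_op_def)
  have t_nonneg: "0 \<le> lin_norm F H t" by (rule lin_norm_nonneg[OF EF.F GH.F t])
  have u_nonneg: "0 \<le> lin_norm (G r) (E r) (u r)" if r: "r \<in> {1..d}" for r
    by (rule lin_norm_nonneg[OF GH.E[OF r] EF.E[OF r] u[OF r]])
  \<comment> \<open>Continuity of the composition is part of being summing and is settled before the
    induced map is considered.\<close>
  have Cm: "?C \<in> multilin_ops K d G H"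
  proof (rule GH.multilin_opsI)
    show "?C \<in> extensional (tuples d G)" by (simp add: compose_op_def)
    show "multilinear_on K d G H ?C"
    proof (rule multilinear_onI)
      show "?C x \<in> carrier H" if "x \<in> tuples d G" for x
        unfolding C[OF that] by (rule linear_on_closed[OF t_lin EF.multilin_ops_closed[OF A' u_in[OF that]]])
      fix r x y assume r: "r \<in> {1..d}" and x: "x \<in> tuples d G" and y: "y \<in> carrier (G r)"
      have xy: "x(r := y) \<in> tuples d G" using x r y by auto
      have uy: "u r y \<in> carrier (E r)" by (rule linear_on_closed[OF u_lin[OF r] y])
      have Auy: "A ((?u x)(r := u r y)) \<in> carrier F"
        by (rule EF.multilin_ops_closed[OF A' tuples_upd[OF u_in[OF x] r uy]])
      { fix z assume z: "z \<in> carrier (G r)"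
        have xz: "x(r := z) \<in> tuples d G" using x r z by auto
        have yz: "x(r := y \<oplus>\<^bsub>G r\<^esub> z) \<in> tuples d G" using x r GH.E_add[OF r y z] by auto
        have uz: "u r z \<in> carrier (E r)" by (rule linear_on_closed[OF u_lin[OF r] z])
        have Auz: "A ((?u x)(r := u r z)) \<in> carrier F"
          by (rule EF.multilin_ops_closed[OF A' tuples_upd[OF u_in[OF x] r uz]])
        show "?C (x(r := y \<oplus>\<^bsub>G r\<^esub> z)) = ?C (x(r := y)) \<oplus>\<^bsub>H\<^esub> ?C (x(r := z))"
          by (simp only: C[OF yz] C[OF xy] C[OF xz] u_upd[OF r] linear_on_add[OF u_lin[OF r] y z]
            EF.multilin_ops_add_slot[OF A' r u_in[OF x] uy uz] linear_on_add[OF t_lin Auy Auz]) }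
      fix a assume a: "a \<in> K"
      have ay: "x(r := a \<odot>\<^bsub>G r\<^esub> y) \<in> tuples d G" using x r GH.E_smult[OF r a y] by auto
      show "?C (x(r := a \<odot>\<^bsub>G r\<^esub> y)) = a \<odot>\<^bsub>H\<^esub> ?C (x(r := y))"
        by (simp only: C[OF ay] C[OF xy] u_upd[OF r] linear_on_smult[OF u_lin[OF r] a y]
            EF.multilin_ops_smult_slot[OF A' r u_in[OF x] a uy] linear_on_smult[OF t_lin a Auy])
    qed
    fix x assume x: "x \<in> tuples d G"
    have "vnorm H (?C x) \<le> lin_norm F H t * vnorm F (A (?u x))"
      unfolding C[OF x] by (rule lin_ops_vnorm_le[OF EF.F GH.F t EF.multilin_ops_closed[OF A' u_in[OF x]]])
    also have "\<dots> \<le> lin_norm F H t * (multilin_norm d E F A * (\<Prod>r = 1..d. vnorm (E r) (?u x r)))"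
      by (intro mult_left_mono t_nonneg EF.multilin_norm_vnorm_le[OF A' u_in[OF x]])
    also have "\<dots> \<le> lin_norm F H t * (multilin_norm d E F A *
        (\<Prod>r = 1..d. lin_norm (G r) (E r) (u r) * vnorm (G r) (x r)))"
    proof (intro mult_left_mono t_nonneg EF.multilin_norm_nonneg[OF A'] prod_mono conjI)
      fix r assume r: "r \<in> {1..d}"
      show "0 \<le> vnorm (E r) (?u x r)" by (rule EF.tuples_vnorm_nonneg[OF u_in[OF x] r])
      show "vnorm (E r) (?u x r) \<le> lin_norm (G r) (E r) (u r) * vnorm (G r) (x r)"
        using lin_ops_vnorm_le[OF GH.E[OF r] EF.E[OF r] u[OF r] tuples_mem[OF x r]] r by simp
    qed
    finally show "vnorm H (?C x) \<le> lin_norm F H t * multilin_norm d E F A *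
        (\<Prod>r = 1..d. lin_norm (G r) (E r) (u r)) * (\<Prod>r = 1..d. vnorm (G r) (x r))"
      by (simp add: prod.distrib mult.assoc)
  qed
  obtain v where v: "v \<in> lin_ops K (W F) (W H)" "lin_norm (W F) (W H) v \<le> lin_norm F H t"
    and v_entry: "\<And>w n. w \<in> carrier (W F) \<Longrightarrow> entry n (v w) = t (entry n w)"
    using foldr_lift[OF K _ F H t, of "[1..<Suc k]" Y] Y' Y_stable'
    unfolding iterated_space_def entry_def by blast
  have WF: "normed_mod K (W F)" and WH: "normed_mod K (W H)" using normed W_banach F H by blast+
  define z where "z x = (\<lambda>r\<in>{1..d}. seq_op (X r) (G r) (u r) (x r))" for x
  have z: "z x r \<in> carrier (X r (E r)) \<and>
      vnorm (X r (E r)) (z x r) \<le> lin_norm (G r) (E r) (u r) * vnorm (X r (G r)) (x r) \<and>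
      coord (z x r) i = u r (coord (x r) i)"
    if x: "x \<in> tuples d (XE G)" and r: "r \<in> {1..d}" for x r i
  proof -
    have n: "normed_mod K (X r (G r))" "normed_mod K (X r (E r))"
      by (intro normed XE_banach r G E)+
    note op = seq_op[OF K X[OF r] X_stable[OF r] G[OF r] E[OF r] u[OF r]]
    note xr = tuples_mem[OF x r]
    have "vnorm (X r (E r)) (seq_op (X r) (G r) (u r) (x r)) \<le> lin_norm (G r) (E r) (u r) * vnorm (X r (G r)) (x r)"
      using lin_ops_vnorm_le[OF n op(1) xr]
        mult_right_mono[OF op(2) normed_mod.vnorm_nonneg[OF n(1) xr]] by linarith
    then show ?thesis
      using linear_on_closed[OF lin_ops_linear_on[OF n op(1)] xr] op(3)[OF xr, of i] r by (simp add: z_def)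
  qed
  have z_in: "z x \<in> tuples d (XE E)" if x: "x \<in> tuples d (XE G)" for x
    using z[OF x] by (auto simp: tuples_def PiE_iff z_def)
  have z_entries: "entries n (z x) = ?u (entries n x)" if x: "x \<in> tuples d (XE G)" for x n
    using z[OF x] by (auto simp: entries_def)
  have w: "v (hat E A (z x)) \<in> carrier (W H)"
    "entry n (v (hat E A (z x))) = ?C (entries n x)" if x: "x \<in> tuples d (XE G)" for n x
  proof -
    show "v (hat E A (z x)) \<in> carrier (W H)"
      by (rule linear_on_closed[OF lin_ops_linear_on[OF WF WH v(1)] hat_in[OF A z_in[OF x]]])
    show "entry n (v (hat E A (z x))) = ?C (entries n x)"
      by (simp only: v_entry[OF hat_in[OF A z_in[OF x]]] entry_hat[OF z_in[OF x]]
        z_entries[OF x] C[OF entries_in[OF G H x]])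
  qed
  show "?C \<in> summing G H" by (rule summingI(1)[OF H Cm w])
  show "norm_s G H ?C \<le> lin_norm F H t * norm_s E F A * (\<Prod>r = 1..d. lin_norm (G r) (E r) (u r))"
  proof (rule norm_s_least[OF G H])
    fix x assume x: "x \<in> tuples d (XE G)" and x1: "\<And>r. r \<in> {1..d} \<Longrightarrow> vnorm (X r (G r)) (x r) \<le> 1"
    have "vnorm (W H) (hat G ?C x) = vnorm (W H) (v (hat E A (z x)))"
      by (simp only: summingI(2)[OF H Cm w x])
    also have "\<dots> \<le> lin_norm (W F) (W H) v * vnorm (W F) (hat E A (z x))"
      by (rule lin_ops_vnorm_le[OF WF WH v(1) hat_in[OF A z_in[OF x]]])
    also have "\<dots> \<le> lin_norm F H t * (norm_s E F A * (\<Prod>r = 1..d. vnorm (X r (E r)) (z x r)))"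
      using hat_in[OF A z_in[OF x]]
      by (intro mult_mono v(2) vnorm_hat_le[OF E F A z_in[OF x]] t_nonneg normed_mod.vnorm_nonneg[OF WF])
    also have "\<dots> \<le> lin_norm F H t * (norm_s E F A * (\<Prod>r = 1..d. lin_norm (G r) (E r) (u r)))"
    proof (intro mult_left_mono t_nonneg norm_s_nonneg[OF E F A] prod_mono conjI)
      fix r assume r: "r \<in> {1..d}"
      show "0 \<le> vnorm (X r (E r)) (z x r)" by (rule XW.tuples_vnorm_nonneg[OF z_in[OF x] r])
      have "vnorm (X r (E r)) (z x r) \<le> lin_norm (G r) (E r) (u r) * vnorm (X r (G r)) (x r)"
        using z[OF x r] by blast
      also have "\<dots> \<le> lin_norm (G r) (E r) (u r) * 1" by (intro mult_left_mono x1 r u_nonneg)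
      finally show "vnorm (X r (E r)) (z x r) \<le> lin_norm (G r) (E r) (u r)" by simp
    qed
    finally show "vnorm (W H) (hat G ?C x)
        \<le> lin_norm F H t * norm_s E F A * (\<Prod>r = 1..d. lin_norm (G r) (E r) (u r))"
      by (simp only: mult.assoc)
  qed
qed

lemma scalar_product_op_summing:
  defines "S \<equiv> scalar_space K :: 'a bspace"
  shows "scalar_product_op K d \<in> summing (\<lambda>r. S) S"
    and "norm_s (\<lambda>r. S) S (scalar_product_op K d) = 1"
proof -
  have S: "banach_space K S" unfolding S_def by (rule banach_space_scalar_space[OF K])
  interpret SS: normed_mods K d "\<lambda>r. S" S by (rule normed_mods_EF[OF S S])
  let ?P = "scalar_product_op K d :: (nat \<Rightarrow> 'a univ) \<Rightarrow> 'a univ"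
  have P: "?P x = Scal (\<Prod>r = 1..d. scal (x r))" if "x \<in> tuples d (\<lambda>r. S)" for x
    using that by (simp add: scalar_product_op_def S_def)
  have scal_in: "scal y \<in> K" "Scal (scal y) = y" if "y \<in> carrier S" for y
    using that by (auto simp: S_def)
  have P_upd: "(\<Prod>q = 1..d. scal ((x(r := y)) q)) = scal y * (\<Prod>q\<in>{1..d} - {r}. scal (x q))"
    if "r \<in> {1..d}" for x :: "nat \<Rightarrow> 'a univ" and r y
    using that by (subst prod.remove[of _ r]) auto
  have Pm: "?P \<in> multilin_ops K d (\<lambda>r. S) S"
  proof (rule SS.multilin_opsI)
    show "?P \<in> extensional (tuples d (\<lambda>r. S))" by (simp add: scalar_product_op_def S_def)
    show "multilinear_on K d (\<lambda>r. S) S ?P"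
    proof (rule multilinear_onI)
      show "?P x \<in> carrier S" if x: "x \<in> tuples d (\<lambda>r. S)" for x
      proof -
        have "(\<Prod>r = 1..d. scal (x r)) \<in> K" using scal_in(1) tuples_mem[OF x] by (intro SS.F.K_prod) auto
        then show ?thesis by (simp add: P[OF x]) (simp add: S_def)
      qed
      fix r x y assume r: "r \<in> {1..d}" and x: "x \<in> tuples d (\<lambda>r. S)" and y: "y \<in> carrier S"
      have xy: "x(r := y) \<in> tuples d (\<lambda>r. S)" using x r y by auto
      { fix z assume z: "z \<in> carrier S"
        have xz: "x(r := z) \<in> tuples d (\<lambda>r. S)" using x r z by auto
        have yz: "x(r := y \<oplus>\<^bsub>S\<^esub> z) \<in> tuples d (\<lambda>r. S)" using x r SS.E_add[OF r y z] by auto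
        show "?P (x(r := y \<oplus>\<^bsub>S\<^esub> z)) = ?P (x(r := y)) \<oplus>\<^bsub>S\<^esub> ?P (x(r := z))"
          by (simp only: P[OF xy] P[OF xz] P[OF yz] P_upd[OF r]) (simp add: S_def algebra_simps) }
      fix a assume a: "a \<in> K"
      have ay: "x(r := a \<odot>\<^bsub>S\<^esub> y) \<in> tuples d (\<lambda>r. S)" using x r SS.E_smult[OF r a y] by auto
      show "?P (x(r := a \<odot>\<^bsub>S\<^esub> y)) = a \<odot>\<^bsub>S\<^esub> ?P (x(r := y))"
        by (simp only: P[OF xy] P[OF ay] P_upd[OF r]) (simp add: S_def)
    qed
    show "vnorm S (?P x) \<le> 1 * (\<Prod>r = 1..d. vnorm S (x r))" if "x \<in> tuples d (\<lambda>r. S)" for x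
      by (simp add: P[OF that]) (simp add: S_def prod_norm)
  qed
  define h where "h x n = (Scal (\<Prod>s = 1..k. \<Prod>r\<in>I s. scal (coord (x r) (j r (n s)))) :: 'a univ)"
    for x :: "nat \<Rightarrow> 'a univ" and n
  have h: "iterated_seq k (h x) \<in> carrier (W S) \<and>
      vnorm (W S) (iterated_seq k (h x)) \<le> (\<Prod>r = 1..d. vnorm (X r S) (x r))"
    if x: "x \<in> tuples d (XE (\<lambda>r. S))" for x
  proof -
    \<comment> \<open>Compatibility speaks of sequences \<open>Scal (l r i)\<close>; taking
      \<open>scal\<close> of the coordinates as \<open>l\<close> recovers every \<open>x r\<close>
      in this form.\<close>
    have x_eq: "Seq (\<lambda>i. Scal (scal (coord (x r) i))) = x r" if r: "r \<in> {1..d}" for r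
    proof -
      have "(\<lambda>i. Scal (scal (coord (x r) i))) = coord (x r)"
        using scal_in(2)[OF coord_in_E[OF S S r tuples_mem[OF x r]]] by (rule ext)
      then show ?thesis using sequence_class_coord(1)[OF K X[OF r] S tuples_mem[OF x r]] by simp
    qed
    have "(let z = iterated_seq k (h x) in z \<in> carrier (W S) \<and>
        vnorm (W S) z \<le> (\<Prod>r = 1..d. vnorm (X r S) (Seq (\<lambda>i. Scal (scal (coord (x r) i))))))"
      using compatible[unfolded block_compatible_def, rule_format, of "\<lambda>r i. scal (coord (x r) i)"]
        x_eq tuples_mem[OF x] by (simp add: h_def[abs_def] S_def)
    then show ?thesis using x_eq by (simp add: Let_def)
  qed
  have h_entry: "entry n (iterated_seq k (h x)) = ?P (entries n x)"
    if x: "x \<in> tuples d (XE (\<lambda>r. S))" for n x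
  proof -
    let ?f = "\<lambda>r. scal (coord (x r) (idx n r))"
    have "h x (restrict n {1..k}) = Scal (\<Prod>s = 1..k. \<Prod>r\<in>I s. ?f r)"
    proof -
      \<comment> \<open>Inside the block \<open>I s\<close> the function \<open>part_of k I\<close>
        is constantly \<open>s\<close>, so the index \<open>n s\<close> used by compatibility is the
        one used by the induced map.\<close>
      have "j r (restrict n {1..k} s) = idx n r" if s: "s \<in> {1..k}" "r \<in> I s" for s r
      proof -
        have "r \<in> {1..d}" using s partition by (auto simp: block_partition_def)
        then show ?thesis using part_of_eq[OF partition s] by (simp add: idx_def block_map_def)
      qed
      then show ?thesis unfolding h_def by (intro arg_cong[of _ _ Scal] prod.cong refl) simp
    qed
    also have "\<dots> = Scal (\<Prod>r = 1..d. ?f r)" by (simp only: block_prod[OF partition])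
    also have "\<dots> = ?P (entries n x)"
      unfolding P[OF entries_in[OF S S x]] by (simp add: entries_def)
    finally show ?thesis by (simp only: entry_iterated_seq)
  qed
  have h_in: "iterated_seq k (h x) \<in> carrier (W S)" if "x \<in> tuples d (XE (\<lambda>r. S))" for x
    using h[OF that] by blast
  show Ps: "?P \<in> summing (\<lambda>r. S) S" by (rule summingI(1)[OF S Pm h_in h_entry])
  show "norm_s (\<lambda>r. S) S ?P = 1"
  proof (rule antisym)
    show "norm_s (\<lambda>r. S) S ?P \<le> 1"
    proof (rule norm_s_least[OF S S])
      fix x assume x: "x \<in> tuples d (XE (\<lambda>r. S))" and x1: "\<And>r. r \<in> {1..d} \<Longrightarrow> vnorm (X r S) (x r) \<le> 1"
      have "vnorm (W S) (hat (\<lambda>r. S) ?P x) \<le> (\<Prod>r = 1..d. vnorm (X r S) (x r))"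
        using h[OF x] by (simp add: summingI(2)[OF S Pm h_in h_entry x])
      also have "\<dots> \<le> 1"
        using x1 normed_mods.tuples_vnorm_nonneg[OF normed_mods_XW[OF S S] x] by (intro prod_le_1) auto
      finally show "vnorm (W S) (hat (\<lambda>r. S) ?P x) \<le> 1" .
    qed
    \<comment> \<open>The norm is not below 1 because it controls the values of the operator, and
      the tuple of ones has value 1.\<close>
    let ?x = "\<lambda>r\<in>{1..d}. Scal 1 :: 'a univ"
    have x: "?x \<in> tuples d (\<lambda>r. S)" using SS.F.K_1 by (intro tuples_restrict) (auto simp: S_def)
    show "1 \<le> norm_s (\<lambda>r. S) S ?P"
      using vnorm_le_norm_s[OF S S Ps x] unfolding P[OF x] by (simp add: S_def)
  qed
qed

lemma rank_one_op_summing: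
  assumes E: "\<And>r. r \<in> {1..d} \<Longrightarrow> banach_space K (E r)" and F: "banach_space K F"
    and \<phi>: "\<And>r. r \<in> {1..d} \<Longrightarrow> \<phi> r \<in> lin_ops K (E r) (scalar_space K)" and b: "b \<in> carrier F"
  shows "rank_one_op d E F \<phi> b \<in> summing E F"
proof -
  have S: "banach_space K (scalar_space K :: 'a bspace)" by (rule banach_space_scalar_space[OF K])
  have "rank_one_op d E F \<phi> b = compose_op d E (scalar_op K F b) (scalar_product_op K d) \<phi>"
    unfolding rank_one_op_def compose_op_def
  proof (rule restrict_ext)
    fix x assume x: "x \<in> tuples d E"
    have \<phi>x: "\<phi> r (x r) \<in> Scal ` K" if r: "r \<in> {1..d}" for r
      using linear_on_closed[OF lin_ops_linear_on[OF normed[OF E[OF r]] normed[OF S] \<phi>[OF r]] tuples_mem[OF x r]]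
      by simp
    then have "(\<lambda>r\<in>{1..d}. \<phi> r (x r)) \<in> tuples d (\<lambda>r. scalar_space K)"
      by (intro tuples_restrict) simp
    moreover have "(\<Prod>r = 1..d. scal (\<phi> r (x r))) \<in> K"
      using \<phi>x by (intro normed_mod.K_prod[OF normed[OF S]]) force
    ultimately show "(\<Prod>r = 1..d. scal (\<phi> r (x r))) \<odot>\<^bsub>F\<^esub> b
        = scalar_op K F b (scalar_product_op K d (\<lambda>r\<in>{1..d}. \<phi> r (x r)))"
      by (simp add: scalar_product_op_def scalar_op_def)
  qed
  then show ?thesis
    using compose_op_summing(1)[OF S E S F scalar_product_op_summing(1) scalar_op(1)[OF normed[OF F] b] \<phi>]
    by simp
qed

lemma summing_banach_ideal: "banach_ideal K d summing norm_s"
  unfolding banach_ideal_def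
proof (intro conjI allI impI ballI)
  show "norm_s (\<lambda>r. scalar_space K) (scalar_space K) (scalar_product_op K d) = 1"
    by (rule scalar_product_op_summing(2))
next
  fix E :: "nat \<Rightarrow> 'a bspace" and F :: "'a bspace"
  assume "\<forall>r\<in>{1..d}. banach_space K (E r)" and F: "banach_space K F"
  then have E: "\<And>r. r \<in> {1..d} \<Longrightarrow> banach_space K (E r)" by blast
  show "submodule (summing E F) (scalar_ring K) (multilin_space K d E F)"
    by (rule summing_submodule[OF E F])
  show "banach_space K (multilin_space K d E F\<lparr>carrier := summing E F, vnorm := norm_s E F\<rparr>)"
    by (rule summing_banach_space[OF E F])
  fix \<phi> b assume "\<forall>r\<in>{1..d}. \<phi> r \<in> lin_ops K (E r) (scalar_space K)" "b \<in> carrier F"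
  then show "rank_one_op d E F \<phi> b \<in> summing E F"
    by (intro rank_one_op_summing E F) auto
next
  fix E G :: "nat \<Rightarrow> 'a bspace" and F H :: "'a bspace" and A t u
  assume EG: "\<forall>r\<in>{1..d}. banach_space K (E r) \<and> banach_space K (G r)"
    and F: "banach_space K F" and H: "banach_space K H" and A: "A \<in> summing E F"
    and t: "t \<in> lin_ops K F H" and "\<forall>r\<in>{1..d}. u r \<in> lin_ops K (G r) (E r)"
  then have E: "\<And>r. r \<in> {1..d} \<Longrightarrow> banach_space K (E r)"
    and G: "\<And>r. r \<in> {1..d} \<Longrightarrow> banach_space K (G r)"
    and u: "\<And>r. r \<in> {1..d} \<Longrightarrow> u r \<in> lin_ops K (G r) (E r)"
    by blast+
  show "compose_op d G t A u \<in> summing G H"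
    by (rule compose_op_summing(1)[OF E G F H A t u])
  show "norm_s G H (compose_op d G t A u)
      \<le> lin_norm F H t * norm_s E F A * (\<Prod>r = 1..d. lin_norm (G r) (E r) (u r))"
    by (rule compose_op_summing(2)[OF E G F H A t u])
qed

end

theorem theorem2p15:
  fixes K :: "complex set" and d k :: nat
    and I :: "nat \<Rightarrow> nat set" and j :: "nat \<Rightarrow> nat \<Rightarrow> nat"
    and X Y :: "nat \<Rightarrow> 'a bspace \<Rightarrow> 'a bspace"
  assumes "K = \<real> \<or> K = UNIV"
    and "1 \<le> k" and "k \<le> d"
    and "block_partition d k I"
    and "injectivity_condition d k I j"
    and "\<forall>r\<in>{1..d}. sequence_class K (X r) \<and> linearly_stable K (X r)"
    and "\<forall>s\<in>{1..k}. sequence_class K (Y s) \<and> linearly_stable K (Y s)"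
    and "block_compatible K d k I j X Y"
  shows "banach_ideal K d (summing_ops K d k I j X Y) (summing_norm d k I j X Y)"
proof -
  interpret summing_setting K d k I j X Y
    by (rule summing_setting.intro) (use assms in auto)
  show ?thesis by (rule summing_banach_ideal)
qed

end
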